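(* (Constant term for type $CC_n$.) One has $$\frac{1}{W_0(t,t_n)}\,\mathrm{ct}\Big(\frac1{\Delta^+_{CC}}\Big)=\frac1{W_0(t,t_n)}(1,1)_+=\langle1,1\rangle_+=N_0^{gd}(t^+)\,N_0^s(t^+),$$ where, with $(z_1,\dots,z_k;q)_\infty=(z_1;q)_\infty\cdots(z_k;q)_\infty$, $$N_0^{gd}(t^+)=\prod_{i=1}^n\frac{(abcd\,t^{2(n-i)},\,q^{-1}abcd\,t^{2(n-i)};q)_\infty}{(qt^{n-i},\,q^{-1}abcd\,t^{n-i},\,abt^{n-i},\,act^{n-i},\,adt^{n-i},\,bct^{n-i},\,bdt^{n-i},\,cdt^{n-i};q)_\infty}$$ and $$N_0^s(t^+)=\prod_{1\le i<j\le n}\frac{(t^{j-i},\,t^{2n-i-j}t_0t_n,\,qt^{j-i},\,qt^{2n-i-j}t_0t_n;q)_\infty}{(t\,t^{j-i},\,t\,t^{2n-i-j}t_0t_n,\,qt^{-1}t^{j-i},\,qt^{-1}t^{2n-i-j}t_0t_n;q)_\infty}.$$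
   Context: Let $n\ge1$, with parameters $q^{1/2},t^{1/2},t_0^{1/2},u_0^{1/2},t_n^{1/2},u_n^{1/2}$, and $a=q^{1/2}t_0^{1/2}u_0^{1/2}$, $b=-q^{1/2}t_0^{1/2}u_0^{-1/2}$, $c=t_n^{1/2}u_n^{1/2}$, $d=-t_n^{1/2}u_n^{-1/2}$ (so $t_0t_n=q^{-1}abcd$), $(z;q)_\infty=\prod_{r\ge0}(1-zq^r)$. $W_0(t,t_n)=\sum_{w}t^{\ell_s(w)}t_n^{\ell_d(w)}$, the sum over the hyperoctahedral group $W_{\mathrm{fin}}$ (order $2^nn!$) of signed permutations with simple reflections $s_1,\dots,s_{n-1}$ (adjacent transpositions) and $s_n$ (sign change of the last letter), $\ell_s(w)$ (resp. $\ell_d(w)$) being the number of factors $s_i$, $i<n$ (resp. $s_n$) in a reduced word of $w$. Put $$\Delta^+_{CC}=\prod_{1\le i<j\le n}\frac{(tx_ix_j^{-1},\,tx_ix_j,\,tqx_i^{-1}x_j,\,tqx_i^{-1}x_j^{-1};q)_\infty}{(x_ix_j^{-1},\,x_ix_j,\,qx_i^{-1}x_j,\,qx_i^{-1}x_j^{-1};q)_\infty}\prod_{i=1}^n\frac{(cx_i,\,qcx_i^{-1},\,dx_i,\,qdx_i^{-1},\,ax_i,\,ax_i^{-1},\,bx_i,\,bx_i^{-1};q)_\infty}{(x_i^2,\,qx_i^{-2};q)_\infty},$$ $$\nabla_{CC}=\prod_{1\le i<j\le n}\frac{(tx_ix_j^{-1},\,tx_ix_j,\,tx_i^{-1}x_j,\,tx_i^{-1}x_j^{-1};q)_\infty}{(x_ix_j^{-1},\,x_ix_j,\,x_i^{-1}x_j,\,x_i^{-1}x_j^{-1};q)_\infty}\prod_{i=1}^n\frac{(ax_i,\,ax_i^{-1},\,bx_i,\,bx_i^{-1},\,cx_i,\,cx_i^{-1},\,dx_i,\,dx_i^{-1};q)_\infty}{(x_i^2,\,x_i^{-2};q)_\infty}.$$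 $\mathrm{ct}$ denotes the constant term in $x_1,\dots,x_n$; $(1,1)_+=\mathrm{ct}(1/\Delta^+_{CC})$ and $\langle1,1\rangle_+=\frac1{2^nn!}\mathrm{ct}(1/\nabla_{CC})$. Reading of $\mathrm{ct}$: regard the parameters as generic complex numbers with $0<|q|<1$ and $|t|,|a|,|b|,|c|,|d|$ sufficiently small, and take the constant term of the Laurent expansion on the torus $|x_1|=\cdots=|x_n|=1$. *)

theory Defs
  imports "HOL-Analysis.Analysis" "HOL-Combinatorics.Permutations"
begin

definition qpoch_inf :: "complex \<Rightarrow> complex \<Rightarrow> complex" where
  "qpoch_inf z q = (\<Prod>r. 1 - z * q ^ r)"

text \<open>The multiple symbol \<open>(z\<^sub>1, \<dots>, z\<^sub>k; q)\<^sub>\<infinity>\<close>.\<close>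

definition qpochs :: "complex list \<Rightarrow> complex \<Rightarrow> complex" where
  "qpochs zs q = (\<Prod>z\<leftarrow>zs. qpoch_inf z q)"

definition index_pairs :: "nat \<Rightarrow> (nat \<times> nat) set" where
  "index_pairs n = {(i, j). 1 \<le> i \<and> i < j \<and> j \<le> n}"

text \<open>Signed permutations are odd permutations of \<open>{-n..n}\<close> (hence fixing 0), acting on
  \<open>int\<close> as the identity outside that range.\<close>

definition signed_perms :: "nat \<Rightarrow> (int \<Rightarrow> int) set" where
  "signed_perms n = {w. w permutes {- int n..int n} \<and> (\<forall>i. w (- i) = - w i)}"

definition simple_refl :: "nat \<Rightarrow> nat \<Rightarrow> int \<Rightarrow> int" where
  "simple_refl n i =
     (if i < n
      then Transposition.transpose (int i) (int i + 1) \<circ>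
           Transposition.transpose (- int i) (- (int i + 1))
      else Transposition.transpose (int n) (- int n))"

definition word_prod :: "nat \<Rightarrow> nat list \<Rightarrow> int \<Rightarrow> int" where
  "word_prod n is = foldr (\<lambda>i w. simple_refl n i \<circ> w) is id"

definition word_for :: "nat \<Rightarrow> (int \<Rightarrow> int) \<Rightarrow> nat list \<Rightarrow> bool" where
  "word_for n w is \<longleftrightarrow> set is \<subseteq> {1..n} \<and> word_prod n is = w"

definition reduced_word :: "nat \<Rightarrow> (int \<Rightarrow> int) \<Rightarrow> nat list \<Rightarrow> bool" where
  "reduced_word n w is \<longleftrightarrow>
     word_for n w is \<and> (\<forall>js. word_for n w js \<longrightarrow> length is \<le> length js)"

text \<open>The two counts below do not depend on the reduced word that is chosen.\<close>

definition ell_s :: "nat \<Rightarrow> (int \<Rightarrow> int) \<Rightarrow> nat" where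
  "ell_s n w = length (filter (\<lambda>i. i < n) (SOME is. reduced_word n w is))"

definition ell_d :: "nat \<Rightarrow> (int \<Rightarrow> int) \<Rightarrow> nat" where
  "ell_d n w = length (filter (\<lambda>i. i = n) (SOME is. reduced_word n w is))"

definition W0 :: "nat \<Rightarrow> complex \<Rightarrow> complex \<Rightarrow> complex" where
  "W0 n t tn = (\<Sum>w\<in>signed_perms n. t ^ ell_s n w * tn ^ ell_d n w)"

text \<open>The variables are \<open>x 1, \<dots>, x n\<close>. Where a denominator of \<open>Delta_CC_plus\<close> or \<open>Nabla_CC\<close>
  vanishes near the unit torus (for instance at \<open>x i = x j\<close>), these functions have a pole, and the
  convention \<open>z / 0 = 0\<close> makes the reciprocals \<open>1 / Delta_CC_plus\<close> and \<open>1 / Nabla_CC\<close> equal to 0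
  there, which is their correct analytic value.\<close>

definition Delta_CC_plus ::
  "nat \<Rightarrow> complex \<Rightarrow> complex \<Rightarrow> complex \<Rightarrow> complex \<Rightarrow> complex \<Rightarrow> complex \<Rightarrow>
   (nat \<Rightarrow> complex) \<Rightarrow> complex" where
  "Delta_CC_plus n q t a b c d x =
     (\<Prod>(i, j)\<in>index_pairs n.
        qpochs [t * x i * inverse (x j), t * x i * x j,
                t * q * inverse (x i) * x j, t * q * inverse (x i) * inverse (x j)] q /
        qpochs [x i * inverse (x j), x i * x j,
                q * inverse (x i) * x j, q * inverse (x i) * inverse (x j)] q) *
     (\<Prod>i=1..n.
        qpochs [c * x i, q * c * inverse (x i), d * x i, q * d * inverse (x i),
                a * x i, a * inverse (x i), b * x i, b * inverse (x i)] q /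
        qpochs [(x i)\<^sup>2, q * inverse ((x i)\<^sup>2)] q)"

definition Nabla_CC ::
  "nat \<Rightarrow> complex \<Rightarrow> complex \<Rightarrow> complex \<Rightarrow> complex \<Rightarrow> complex \<Rightarrow> complex \<Rightarrow>
   (nat \<Rightarrow> complex) \<Rightarrow> complex" where
  "Nabla_CC n q t a b c d x =
     (\<Prod>(i, j)\<in>index_pairs n.
        qpochs [t * x i * inverse (x j), t * x i * x j,
                t * inverse (x i) * x j, t * inverse (x i) * inverse (x j)] q /
        qpochs [x i * inverse (x j), x i * x j,
                inverse (x i) * x j, inverse (x i) * inverse (x j)] q) *
     (\<Prod>i=1..n.
        qpochs [a * x i, a * inverse (x i), b * x i, b * inverse (x i),
                c * x i, c * inverse (x i), d * x i, d * inverse (x i)] q /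
        qpochs [(x i)\<^sup>2, inverse ((x i)\<^sup>2)] q)"

text \<open>\<open>coef\<close> is the family of coefficients of the Laurent expansion of \<open>f\<close> in \<open>x 1, \<dots>, x n\<close>,
  absolutely convergent on some polyannulus around the torus \<open>\<bar>x 1\<bar> = \<dots> = \<bar>x n\<bar> = 1\<close>.
  Exponents are functions supported on \<open>{1..n}\<close>.\<close>

definition laurent_expansion ::
  "nat \<Rightarrow> ((nat \<Rightarrow> complex) \<Rightarrow> complex) \<Rightarrow> ((nat \<Rightarrow> int) \<Rightarrow> complex) \<Rightarrow> bool" where
  "laurent_expansion n f coef \<longleftrightarrow>
     (\<exists>r::real. r > 1 \<and>
        (\<forall>x. (\<forall>i\<in>{1..n}. 1 / r < norm (x i) \<and> norm (x i) < r) \<longrightarrow>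
           ((\<lambda>k. coef k * (\<Prod>i=1..n. x i powi k i)) has_sum f x)
             {k. \<forall>i. i \<notin> {1..n} \<longrightarrow> k i = 0}))"

definition ct :: "nat \<Rightarrow> ((nat \<Rightarrow> complex) \<Rightarrow> complex) \<Rightarrow> complex" where
  "ct n f = (THE v. \<exists>coef. laurent_expansion n f coef \<and> v = coef (\<lambda>_. 0))"

text \<open>\<open>pair11_plus\<close> is \<open>(1,1)\<^sub>+\<close>, and \<open>angle11_plus\<close> is \<open>\<langle>1,1\<rangle>\<^sub>+\<close>.\<close>

definition pair11_plus ::
  "nat \<Rightarrow> complex \<Rightarrow> complex \<Rightarrow> complex \<Rightarrow> complex \<Rightarrow> complex \<Rightarrow> complex \<Rightarrow> complex" where
  "pair11_plus n q t a b c d = ct n (\<lambda>x. 1 / Delta_CC_plus n q t a b c d x)"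

definition angle11_plus ::
  "nat \<Rightarrow> complex \<Rightarrow> complex \<Rightarrow> complex \<Rightarrow> complex \<Rightarrow> complex \<Rightarrow> complex \<Rightarrow> complex" where
  "angle11_plus n q t a b c d =
     1 / (2 ^ n * fact n) * ct n (\<lambda>x. 1 / Nabla_CC n q t a b c d x)"

text \<open>With \<open>0 < \<bar>q\<bar> < 1\<close>, \<open>0 < \<bar>t\<bar> < 1\<close>, \<open>\<bar>a\<bar>, \<bar>b\<bar>, \<bar>c\<bar>, \<bar>d\<bar> < 1\<close> and \<open>t0 * tn = a * b * c * d / q\<close>,
  the only factors of the denominators of \<open>N0_gd\<close> and \<open>N0_s\<close> that can vanish are
  \<open>1 - t0 * tn * t ^ k\<close> with \<open>k \<le> 2 * n - 2\<close>.\<close>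

definition N0_gd ::
  "nat \<Rightarrow> complex \<Rightarrow> complex \<Rightarrow> complex \<Rightarrow> complex \<Rightarrow> complex \<Rightarrow> complex \<Rightarrow> complex" where
  "N0_gd n q t a b c d =
     (\<Prod>i=1..n.
        qpochs [a * b * c * d * t ^ (2 * (n - i)),
                inverse q * a * b * c * d * t ^ (2 * (n - i))] q /
        qpochs [q * t ^ (n - i), inverse q * a * b * c * d * t ^ (n - i),
                a * b * t ^ (n - i), a * c * t ^ (n - i), a * d * t ^ (n - i),
                b * c * t ^ (n - i), b * d * t ^ (n - i), c * d * t ^ (n - i)] q)"

definition N0_s :: "nat \<Rightarrow> complex \<Rightarrow> complex \<Rightarrow> complex \<Rightarrow> complex \<Rightarrow> complex" where
  "N0_s n q t t0 tn =
     (\<Prod>(i, j)\<in>index_pairs n.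
        qpochs [t ^ (j - i), t ^ (2 * n - i - j) * t0 * tn,
                q * t ^ (j - i), q * t ^ (2 * n - i - j) * t0 * tn] q /
        qpochs [t * t ^ (j - i), t * t ^ (2 * n - i - j) * t0 * tn,
                q * inverse t * t ^ (j - i), q * inverse t * t ^ (2 * n - i - j) * t0 * tn] q)"

end

theory Submission
  imports Defs "HOL-Complex_Analysis.Complex_Analysis" "HOL-Probability.Probability"
begin

text \<open>Since \<open>ct\<close> of a function with a Laurent expansion is its average over the unit torus, everything
  is about torus integrals. The type I integral
  \<open>\<integral> \<Prod> (x\<^sub>i\<^sup>\<plusminus>\<^sup>1 x\<^sub>j\<^sup>\<plusminus>\<^sup>1) \<Prod> (x\<^sub>i\<^sup>\<plusminus>\<^sup>2) / \<Prod> (a\<^sub>k x\<^sub>i\<^sup>\<plusminus>\<^sup>1)\<close> with \<open>2n + 2\<close> parameters satisfies a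
  first-order \<open>q\<close>-difference equation in each parameter: a partial fraction expansion writes the
  difference of the two sides as a sum of terms \<open>h(x\<^sub>i) - h(q x\<^sub>i)\<close>, which integrate to zero by Cauchy's
  theorem. Letting the parameters tend to 0 evaluates the integral up to a constant depending on \<open>n\<close>.
  Applying it to either group of variables of
  \<open>1 / \<Prod> (t\<^sup>1\<^sup>/\<^sup>2 x\<^sub>i\<^sup>\<plusminus>\<^sup>1 y\<^sub>k\<^sup>\<plusminus>\<^sup>1)\<close>, with \<open>n\<close> variables \<open>x\<close> and \<open>n - 1\<close> variables \<open>y\<close>, gives by Fubini a
  recursion in \<open>n\<close> for the constant term of \<open>1 / \<nabla>\<close>, and the limit \<open>t \<rightarrow> 1\<close>, in which the variables
  decouple, fixes the constants. The constant term of \<open>1 / \<Delta>\<^sup>+\<close> is reduced to this one by symmetrising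
  one variable at a time; the factors picked up are those of \<open>W\<^sub>0\<close>.\<close>

section \<open>The infinite \<open>q\<close>-shifted factorial\<close>

text \<open>The number of parameters dictates the shape of the argument. The partial fractions come
  from interpolating a monic polynomial of degree one less than the number of nodes. With the nodes
  \<open>0\<close>, \<open>inverse a\<close> and the \<open>2n\<close> points \<open>x_i\<close>,
  \<open>1/x_i\<close> there is room for exactly \<open>2n + 1\<close> parameters beside
  \<open>a\<close>. In the two-group kernel the variables \<open>x\<close> then act on
  \<open>y\<close> as \<open>2n\<close> parameters, the number wanted by \<open>n - 1\<close>
  variables, while \<open>y\<close> supplies \<open>2n - 2\<close> parameters to \<open>x\<close>,
  so that exactly four, namely \<open>a, b, c, d\<close>, can be added. Letting parameters tend to 0
  does not tell the value at 0. That constant enters the recursion only through its quotient for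
  consecutive \<open>n\<close>; decoupling reduces it to one variable, where a special choice of
  parameters turns the integrand into a Laurent polynomial. Interpolation needs distinct nodes, so
  the pointwise identities hold only off a null set of the torus, which integrals ignore. The same
  interpolation with the nodes \<open>0\<close>, \<open>s\<close>, \<open>- s\<close>, where
  \<open>s\<close> is a square root of \<open>t\<close>, yields the factors of
  \<open>W0\<close>.\<close>

locale nome =
  fixes q :: complex
  assumes q0: "0 < norm q" and q1: "norm q < 1"
begin

lemma q_nz [simp]: "q \<noteq> 0"
  using q0 by auto

abbreviation qp :: "complex \<Rightarrow> complex" where "qp z \<equiv> qpoch_inf z q"

lemma convergent_prod_qp: "convergent_prod (\<lambda>r. 1 - z * q ^ r)"
  by (intro abs_convergent_prod_imp_convergent_prod)
     (auto simp: abs_convergent_prod_conv_summable norm_mult norm_power q1 intro!: summable_mult summable_geometric)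

lemma qp_tendsto: "(\<lambda>N. \<Prod>r<N. 1 - z * q ^ r) \<longlonglongrightarrow> qp z"
  unfolding qpoch_inf_def
  using convergent_prod_LIMSEQ[OF convergent_prod_qp, of z] LIMSEQ_lessThan_iff_atMost by blast

lemma qp_Suc: "qp z = (1 - z) * qp (q * z)"
proof -
  have "(\<lambda>N. \<Prod>r<Suc N. 1 - z * q ^ r) \<longlonglongrightarrow> qp z"
    using qp_tendsto by (rule LIMSEQ_Suc)
  moreover have "(\<Prod>r<Suc N. 1 - z * q ^ r) = (1 - z) * (\<Prod>r<N. 1 - (q * z) * q ^ r)" for N
    unfolding prod.lessThan_Suc_shift by (simp add: mult_ac)
  moreover have "(\<lambda>N. (1 - z) * (\<Prod>r<N. 1 - (q * z) * q ^ r)) \<longlonglongrightarrow> (1 - z) * qp (q * z)"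
    by (intro tendsto_intros qp_tendsto)
  ultimately show ?thesis
    using LIMSEQ_unique by auto
qed

lemma qp_0 [simp]: "qp 0 = 1"
  by (simp add: qpoch_inf_def)

lemma qp_1 [simp]: "qp 1 = 0"
  by (subst qp_Suc) simp

lemma qp_nonzero: "norm z < 1 \<Longrightarrow> qp z \<noteq> 0"
  unfolding qpoch_inf_def
proof (intro prodinf_nonzero convergent_prod_qp)
  fix r assume "norm z < 1"
  hence "norm (z * q ^ r) < 1"
    using q0 q1 mult_left_le[of "norm q ^ r" "norm z"] by (simp add: norm_mult norm_power power_le_one)
  thus "1 - z * q ^ r \<noteq> 0" by auto
qed

text \<open>On a disc of radius 1 around any point the factors differ from 1 by at most a fixed
  geometric series, so the partial products converge locally uniformly.\<close>

lemma qp_holomorphic: "qp holomorphic_on A"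
proof -
  have unif: "uniform_limit (cball z0 1) (\<lambda>N z. \<Prod>r<N. 1 - z * q ^ r) qp sequentially" for z0
  proof -
    have "uniformly_convergent_on (cball z0 1) (\<lambda>N z. \<Prod>r<N. 1 - z * q ^ r)"
    proof (rule uniformly_convergent_on_prod')
      show "uniformly_convergent_on (cball z0 1) (\<lambda>N z. \<Sum>r<N. norm (1 - z * q ^ r - 1))"
      proof (rule Weierstrass_m_test'_ev)
        show "\<forall>\<^sub>F r in sequentially. \<forall>z\<in>cball z0 1. norm (norm (1 - z * q ^ r - 1)) \<le> (norm z0 + 1) * norm q ^ r"
        proof (intro always_eventually allI ballI)
          fix r z assume "z \<in> cball z0 1"
          hence "norm z \<le> norm z0 + 1"
            using norm_triangle_sub[of z z0] by (auto simp: dist_norm norm_minus_commute)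
          thus "norm (norm (1 - z * q ^ r - 1)) \<le> (norm z0 + 1) * norm q ^ r"
            by (simp add: norm_mult norm_power mult_right_mono)
        qed
        show "summable (\<lambda>r. (norm z0 + 1) * norm q ^ r)"
          by (intro summable_mult summable_geometric) (use q1 in auto)
      qed
    qed (auto intro!: continuous_intros)
    then obtain l where l: "uniform_limit (cball z0 1) (\<lambda>N z. \<Prod>r<N. 1 - z * q ^ r) l sequentially"
      by (auto simp: uniformly_convergent_on_def)
    have "l z = qp z" if "z \<in> cball z0 1" for z
      using LIMSEQ_unique[OF tendsto_uniform_limitI[OF l that] qp_tendsto] .
    with l show ?thesis
      by (subst uniform_limit_cong') auto
  qed
  have "qp holomorphic_on UNIV"
  proof (rule holomorphic_uniform_sequence)
    show "(\<lambda>z. \<Prod>r<N. 1 - z * q ^ r) holomorphic_on UNIV" for N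
      by (intro holomorphic_intros)
    fix z0 :: complex
    show "\<exists>d>0. cball z0 d \<subseteq> UNIV \<and> uniform_limit (cball z0 d) (\<lambda>N z. \<Prod>r<N. 1 - z * q ^ r) qp sequentially"
      using unif[of z0] by (intro exI[of _ 1]) auto
  qed auto
  thus ?thesis by (rule holomorphic_on_subset) auto
qed

lemma qp_holomorphic' [holomorphic_intros]:
  "f holomorphic_on A \<Longrightarrow> (\<lambda>x. qp (f x)) holomorphic_on A"
  using holomorphic_on_compose[OF _ qp_holomorphic, of f A] by (simp add: o_def)

lemma qp_continuous: "continuous_on A qp"
  by (rule holomorphic_on_imp_continuous_on[OF qp_holomorphic])

lemma qp_continuous' [continuous_intros]:
  "continuous_on A f \<Longrightarrow> continuous_on A (\<lambda>x. qp (f x))"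
  using continuous_on_compose[OF _ qp_continuous, of A f] by (simp add: o_def)

lemma qp_tendsto_compose [tendsto_intros]:
  "(f \<longlongrightarrow> l) F \<Longrightarrow> ((\<lambda>x. qp (f x)) \<longlongrightarrow> qp l) F"
  using qp_continuous[of UNIV] by (auto simp: continuous_on_eq_continuous_at isCont_def intro: isCont_tendsto_compose)

lemma qp_measurable [measurable]: "qp \<in> borel_measurable borel"
  by (intro borel_measurable_continuous_onI qp_continuous)

lemma qp_bounded: "\<exists>B. \<forall>z. norm z \<le> r \<longrightarrow> norm (qp z) \<le> B"
proof -
  have "compact (qp ` cball 0 r)"
    by (intro compact_continuous_image qp_continuous compact_cball)
  thus ?thesis
    by (metis (no_types, lifting) bounded_iff compact_imp_bounded imageI mem_cball_0)
qed

lemma inverse_qp_bounded: "r < 1 \<Longrightarrow> \<exists>B. \<forall>z. norm z \<le> r \<longrightarrow> norm (inverse (qp z)) \<le> B"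
proof -
  assume "r < 1"
  have "compact ((\<lambda>z. inverse (qp z)) ` cball 0 r)"
    by (intro compact_continuous_image continuous_intros compact_cball) (use \<open>r < 1\<close> in \<open>auto intro!: qp_nonzero\<close>)
  thus ?thesis
    by (metis (no_types, lifting) bounded_iff compact_imp_bounded imageI mem_cball_0)
qed

lemma nome_square: "nome (q\<^sup>2)"
  using q0 q1 by unfold_locales (auto simp: norm_power power_less_one_iff)

text \<open>Together with \<open>qp_mult_minus\<close> this serves the one-variable evaluation
  \<open>norm_const_1\<close>, in which the bases \<open>q\<close> and \<open>q\<^sup>2\<close>
  meet.\<close>

lemma qp_even_odd: "qp z = qpoch_inf z (q\<^sup>2) * qpoch_inf (z * q) (q\<^sup>2)"
proof -
  interpret sq: nome "q\<^sup>2" by (rule nome_square)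
  have "(\<lambda>N. (\<Prod>r<N. 1 - z * (q\<^sup>2) ^ r) * (\<Prod>r<N. 1 - (z * q) * (q\<^sup>2) ^ r)) \<longlonglongrightarrow> qpoch_inf z (q\<^sup>2) * qpoch_inf (z * q) (q\<^sup>2)"
    by (intro tendsto_intros sq.qp_tendsto)
  moreover have "(\<Prod>r<N. 1 - z * (q\<^sup>2) ^ r) * (\<Prod>r<N. 1 - (z * q) * (q\<^sup>2) ^ r) = (\<Prod>r<2 * N. 1 - z * q ^ r)" for N
    by (induction N) (simp_all add: mult_ac flip: power_mult)
  moreover have "(\<lambda>N. \<Prod>r<2 * N. 1 - z * q ^ r) \<longlonglongrightarrow> qp z"
    using LIMSEQ_subseq_LIMSEQ[OF qp_tendsto[of z], of "\<lambda>N. 2 * N"] by (simp add: strict_mono_def o_def)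
  ultimately show ?thesis
    using LIMSEQ_unique by auto
qed

lemma qp_mult_minus: "qp z * qp (- z) = qpoch_inf (z\<^sup>2) (q\<^sup>2)"
proof -
  interpret sq: nome "q\<^sup>2" by (rule nome_square)
  have "(\<lambda>N. (\<Prod>r<N. 1 - z * q ^ r) * (\<Prod>r<N. 1 - (- z) * q ^ r)) \<longlonglongrightarrow> qp z * qp (- z)"
    by (intro tendsto_intros qp_tendsto)
  moreover have "(\<Prod>r<N. 1 - z * q ^ r) * (\<Prod>r<N. 1 - (- z) * q ^ r) = (\<Prod>r<N. 1 - z\<^sup>2 * (q\<^sup>2) ^ r)" for N
    unfolding prod.distrib[symmetric]
    by (intro prod.cong refl) (simp add: algebra_simps power2_eq_square power_mult_distrib)
  ultimately show ?thesis
    using LIMSEQ_unique[OF _ sq.qp_tendsto] by auto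
qed

end

section \<open>Averages over the unit torus\<close>

text \<open>Normalised Haar measure of the unit circle. It lives on the sphere and not on the whole
  plane, so that every point of a product space has coordinates of norm 1 and bounds hold everywhere
  instead of almost everywhere.\<close>

definition circ :: "complex measure" where
  "circ = distr (restrict_space lborel {0..1}) (restrict_space borel (sphere 0 1)) (\<lambda>u. cis (2 * pi * u))"

abbreviation torus :: "'i set \<Rightarrow> ('i \<Rightarrow> complex) measure" where
  "torus S \<equiv> Pi\<^sub>M S (\<lambda>_. circ)"

lemma circ_e_measurable:
  "(\<lambda>u. cis (2 * pi * u)) \<in> restrict_space lborel {0..1} \<rightarrow>\<^sub>M restrict_space borel (sphere 0 1)"
  by (intro measurable_restrict_space2 measurable_restrict_space1 borel_measurable_continuous_onI) (auto intro!: continuous_intros simp: cis_conv_exp)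

lemma space_circ [simp]: "space circ = sphere 0 1"
  by (simp add: circ_def space_restrict_space)

lemma sets_circ: "sets circ = sets (restrict_space borel (sphere 0 1))"
  by (simp add: circ_def)

lemma prob_space_circ: "prob_space circ"
proof -
  have "prob_space (restrict_space lborel {0..1::real})"
    by (rule prob_space_restrict_space) auto
  thus ?thesis
    unfolding circ_def by (rule prob_space.prob_space_distr) (rule circ_e_measurable)
qed

lemma product_prob_space_circ: "product_prob_space (\<lambda>_. circ)"
  by (simp add: product_prob_spaceI prob_space_circ)

lemma product_sigma_finite_circ: "product_sigma_finite (\<lambda>_. circ)"
  using product_prob_space_circ by (rule product_prob_space.axioms)

lemma prob_space_torus: "prob_space (torus S)"
  by (intro prob_space_PiM prob_space_circ)

lemma measurable_circ_borel: "f \<in> borel_measurable borel \<Longrightarrow> f \<in> borel_measurable circ"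
  by (simp add: measurable_cong_sets[OF sets_circ refl] measurable_restrict_space1)

lemma integral_circ:
  fixes f :: "complex \<Rightarrow> complex"
  assumes "f \<in> borel_measurable circ"
  shows "(\<integral>y. f y \<partial>circ) = (LBINT u:{0..1}. f (cis (2 * pi * u)))"
proof -
  have f: "f \<in> borel_measurable (restrict_space borel (sphere 0 1))"
    using assms by (rule measurable_cong_sets[OF sets_circ refl, THEN equalityD1, THEN subsetD])
  have "(\<integral>y. f y \<partial>circ) = (\<integral>u. f (cis (2 * pi * u)) \<partial>restrict_space lborel {0..1})"
    unfolding circ_def by (rule integral_distr[OF circ_e_measurable f])
  also have "\<dots> = (LBINT u:{0..1}. f (cis (2 * pi * u)))"
    unfolding set_lebesgue_integral_def by (rule integral_restrict_space) simp
  finally show ?thesis .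
qed

lemma integral_circ_continuous:
  fixes f :: "complex \<Rightarrow> complex"
  assumes "f \<in> borel_measurable circ" "continuous_on (sphere 0 1) f"
  shows "(\<integral>y. f y \<partial>circ) = integral {0..1} (\<lambda>u. f (cis (2 * pi * u)))"
proof -
  have "continuous_on {0..1} (\<lambda>u. f (cis (2 * pi * u)))"
    by (rule continuous_on_compose2[OF assms(2)]) (auto intro!: continuous_intros)
  hence "set_integrable lborel {0..1} (\<lambda>u. f (cis (2 * pi * u)))"
    by (rule borel_integrable_atLeastAtMost')
  thus ?thesis
    by (simp only: integral_circ[OF assms(1)] set_borel_integral_eq_integral(2))
qed

lemma integral_circ_inverse:
  fixes f :: "complex \<Rightarrow> complex"
  assumes f: "f \<in> borel_measurable circ"
  shows "(\<integral>y. f (inverse y) \<partial>circ) = (\<integral>y. f y \<partial>circ)"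
proof -
  have "inverse \<in> circ \<rightarrow>\<^sub>M restrict_space borel (sphere 0 1)"
    by (rule measurable_restrict_space2) (auto simp: norm_inverse intro!: measurable_circ_borel)
  hence inv: "inverse \<in> circ \<rightarrow>\<^sub>M circ"
    by (rule measurable_cong_sets[OF refl sets_circ, THEN equalityD2, THEN subsetD])
  have "(\<integral>y. f y \<partial>circ) = (LBINT u. indicator {0..1} u *\<^sub>R f (cis (2 * pi * u)))"
    unfolding integral_circ[OF f] set_lebesgue_integral_def ..
  \<comment> \<open>The substitution \<open>u \<mapsto> 1 - u\<close> runs through the circle
    backwards.\<close>
  also have "\<dots> = (LBINT u. indicator {0..1} (1 + (-1) * u) *\<^sub>R f (cis (2 * pi * (1 + (-1) * u))))"
    by (rule trans[OF lborel_integral_real_affine[of "-1" _ 1]]) simp_all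
  also have "\<dots> = (LBINT u. indicator {0..1} u *\<^sub>R f (inverse (cis (2 * pi * u))))"
  proof (rule Bochner_Integration.integral_cong[OF refl])
    fix u :: real
    have "cis (2 * pi * (1 + (-1) * u)) = inverse (cis (2 * pi * u))"
    proof -
      have "2 * pi * (1 + (-1) * u) = 2 * pi - 2 * pi * u" by (simp add: algebra_simps)
      thus ?thesis using cis_divide[of "2 * pi" "2 * pi * u"] by (simp only: inverse_eq_divide cis_2pi)
    qed
    thus "indicator {0..1} (1 + (-1) * u) *\<^sub>R f (cis (2 * pi * (1 + (-1) * u))) =
          indicator {0..1} u *\<^sub>R f (inverse (cis (2 * pi * u)))"
      by (simp only: indicator_def) (simp add: conj_commute)
  qed
  also have "\<dots> = (\<integral>y. f (inverse y) \<partial>circ)"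
    unfolding integral_circ[OF measurable_compose[OF inv f]] set_lebesgue_integral_def ..
  finally show ?thesis by (rule sym)
qed

lemma AE_circ_countable:
  assumes "countable C"
  shows "AE y in circ. y \<notin> C"
proof -
  have Z: "{z} \<inter> sphere 0 1 \<in> sets (restrict_space borel (sphere 0 1))" for z :: complex
    unfolding sets_restrict_space by (rule image_eqI[of _ _ "{z}"]) auto
  have "emeasure circ ({z} \<inter> sphere 0 1) = 0" for z
  proof -
    define N where "N = {u \<in> {0..1::real}. cis (2 * pi * u) = z}"
    have "finite N"
    proof (cases "N = {}")
      case False
      then obtain u0 where u0: "u0 \<in> N" by auto
      \<comment> \<open>Two preimages of \<open>z\<close> differ by an integer and lie in
        \<open>{0..1}\<close>; the differences 1 and -1 do occur, because both endpoints are sent to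
        1.\<close>
      have "N \<subseteq> {u0, u0 + 1, u0 - 1}"
      proof
        fix u assume u: "u \<in> N"
        have "cis (2 * pi * u) = cis (2 * pi * u0)" using u u0 by (auto simp: N_def)
        then obtain k :: int where "\<i> * of_real (2 * pi * u) = \<i> * of_real (2 * pi * u0) + of_int (2 * k) * of_real pi * \<i>"
          unfolding cis_conv_exp exp_eq by auto
        from arg_cong[OF this, of Im] have k: "2 * pi * u = 2 * pi * u0 + 2 * pi * k" by simp
        hence "u = u0 + k"
          by (metis (no_types, opaque_lifting) distrib_left mult_cancel_left mult_eq_0_iff pi_neq_zero zero_neq_numeral)
        moreover have "\<bar>u - u0\<bar> \<le> 1" using u u0 by (auto simp: N_def)
        ultimately have "\<bar>real_of_int k\<bar> \<le> 1" by simp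
        hence "k = 0 \<or> k = 1 \<or> k = -1" by linarith
        thus "u \<in> {u0, u0 + 1, u0 - 1}" using \<open>u = u0 + k\<close> by auto
      qed
      thus ?thesis using finite_subset by blast
    qed auto
    have "emeasure circ ({z} \<inter> sphere 0 1) =
        emeasure (restrict_space lborel {0..1}) ((\<lambda>u. cis (2 * pi * u)) -` ({z} \<inter> sphere 0 1) \<inter> space (restrict_space lborel {0..1}))"
      unfolding circ_def by (rule emeasure_distr[OF circ_e_measurable Z])
    also have "(\<lambda>u. cis (2 * pi * u)) -` ({z} \<inter> sphere 0 1) \<inter> space (restrict_space lborel {0..1}) = N"
      by (auto simp: N_def space_restrict_space)
    also have "emeasure (restrict_space lborel {0..1}) N = emeasure lborel N"
      by (rule emeasure_restrict_space) (auto simp: N_def)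
    also have "\<dots> = 0"
      using \<open>finite N\<close> by (simp add: finite_imp_null_set_lborel null_setsD1)
    finally show ?thesis .
  qed
  hence "{z} \<inter> sphere 0 1 \<in> null_sets circ" for z
    using Z unfolding null_sets_def sets_circ by blast
  hence "(\<Union>z\<in>C. {z} \<inter> sphere 0 1) \<in> null_sets circ"
    by (intro null_sets_UN' assms) auto
  thus ?thesis
    by (rule AE_I') auto
qed

text \<open>Up to the factor \<open>2 * pi * \<i>\<close>, both averages are contour integrals of
  \<open>g z / z\<close>, over the circles of radius \<open>norm p\<close> and 1. Cauchy's theorem
  identifies them, as the annulus in between lies in \<open>A\<close>.\<close>

lemma integral_circ_shift:
  fixes g :: "complex \<Rightarrow> complex"
  assumes hol: "g holomorphic_on A" and A: "open A" "0 \<notin> A" "\<And>z. norm p \<le> norm z \<Longrightarrow> norm z \<le> 1 \<Longrightarrow> z \<in> A"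
    and p: "norm p \<le> 1" "p \<noteq> 0"
    and meas: "g \<in> borel_measurable circ" "(\<lambda>y. g (p * y)) \<in> borel_measurable circ"
  shows "(\<integral>y. g (p * y) \<partial>circ) = (\<integral>y. g y \<partial>circ)"
proof -
  define \<gamma> where "\<gamma> c = (\<lambda>u. c * exp (2 * of_real pi * \<i> * of_real u))" for c :: complex
  have \<gamma>_cis: "\<gamma> c u = c * cis (2 * pi * u)" for c u
    by (simp add: \<gamma>_def cis_conv_exp mult_ac)
  have \<gamma>': "(\<gamma> c has_vector_derivative (2 * of_real pi * \<i> * \<gamma> c u)) (at u)" for c u
  proof -
    have "((\<lambda>z. c * exp (2 * of_real pi * \<i> * z)) has_field_derivative (2 * of_real pi * \<i> * \<gamma> c u)) (at (of_real u))"
      unfolding \<gamma>_def by (auto intro!: derivative_eq_intros)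
    from has_vector_derivative_real_field[OF this] show ?thesis
      by (simp add: \<gamma>_def)
  qed
  have vp: "valid_path (\<gamma> c)" for c
  proof -
    have "\<gamma> c C1_differentiable_on {0..1}"
      unfolding C1_differentiable_on_def
    proof (intro exI conjI ballI)
      show "(\<gamma> c has_vector_derivative (2 * of_real pi * \<i> * \<gamma> c u)) (at u)" for u by (rule \<gamma>')
      show "continuous_on {0..1} (\<lambda>u. 2 * of_real pi * \<i> * \<gamma> c u)"
        unfolding \<gamma>_def by (intro continuous_intros)
    qed
    thus ?thesis
      by (simp add: valid_path_def C1_differentiable_imp_piecewise)
  qed
  have int: "contour_integral (\<gamma> c) (\<lambda>z. g z / z) = 2 * of_real pi * \<i> * (\<integral>y. g (c * y) \<partial>circ)"
    if c: "norm p \<le> norm c" "norm c \<le> 1" "c \<noteq> 0" and m: "(\<lambda>y. g (c * y)) \<in> borel_measurable circ" for c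
  proof -
    have "continuous_on (sphere 0 1) (\<lambda>y. g (c * y))"
      by (rule continuous_on_compose2[OF holomorphic_on_imp_continuous_on[OF hol]])
         (use c in \<open>auto intro!: continuous_intros A simp: norm_mult\<close>)
    hence "(\<integral>y. g (c * y) \<partial>circ) = integral {0..1} (\<lambda>u. g (\<gamma> c u))"
      using integral_circ_continuous[OF m] by (simp add: \<gamma>_cis)
    moreover have "contour_integral (\<gamma> c) (\<lambda>z. g z / z) = integral {0..1} (\<lambda>u. 2 * of_real pi * \<i> * g (\<gamma> c u))"
      unfolding contour_integral_integral
    proof (intro integral_cong)
      fix u :: real
      have "vector_derivative (\<gamma> c) (at u) = 2 * of_real pi * \<i> * \<gamma> c u"
        by (intro vector_derivative_at \<gamma>')
      moreover have "\<gamma> c u \<noteq> 0" using c by (simp add: \<gamma>_def)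
      ultimately show "g (\<gamma> c u) / \<gamma> c u * vector_derivative (\<gamma> c) (at u) = 2 * of_real pi * \<i> * g (\<gamma> c u)"
        by simp
    qed
    ultimately show ?thesis by simp
  qed
  \<comment> \<open>As \<open>p\<close> is complex, the circle has to be turned while it shrinks:
    its starting point moves along the logarithmic spiral \<open>exp (s * Ln p)\<close>, whose norm
    decreases from 1 to \<open>norm p\<close>.\<close>
  have hom: "homotopic_loops A (\<gamma> 1) (\<gamma> p)"
    unfolding homotopic_loops
  proof (intro exI conjI ballI)
    let ?h = "\<lambda>z. exp (of_real (fst z) * Ln p) * exp (2 * of_real pi * \<i> * of_real (snd z))"
    show "continuous_on ({0..1} \<times> {0..1}) ?h"
      by (intro continuous_intros)
    show "?h \<in> {0..1} \<times> {0..1} \<rightarrow> A"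
    proof safe
      fix s u :: real assume s: "s \<in> {0..1}"
      have "norm (?h (s, u)) = exp (s * ln (norm p))"
        using p by (simp add: norm_mult)
      moreover have "exp (s * ln (norm p)) \<le> 1"
        using s p by (simp add: mult_nonneg_nonpos)
      moreover have "exp (s * ln (norm p)) \<ge> exp (ln (norm p))"
        using s p by (subst exp_le_cancel_iff) (simp add: mult_le_cancel_right1 not_less)
      ultimately show "?h (s, u) \<in> A"
        using p by (intro A) auto
    qed
  qed (use p in \<open>auto simp: \<gamma>_def pathstart_def pathfinish_def exp_of_real[symmetric] exp_two_pi_i\<close>)
  have "contour_integral (\<gamma> 1) (\<lambda>z. g z / z) = contour_integral (\<gamma> p) (\<lambda>z. g z / z)"
    by (rule Cauchy_theorem_homotopic_loops[OF hom]) (use A hol vp in \<open>auto intro!: holomorphic_intros\<close>)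
  thus ?thesis
    using int[of 1] int[of p] p meas by simp
qed

text \<open>Passing to the circle of radius 1/2 leaves the average unchanged but multiplies it by
  \<open>(1/2) powi k\<close>, which is not 1 unless \<open>k = 0\<close>.\<close>

lemma integral_circ_power:
  fixes k :: int
  shows "(\<integral>y. y powi k \<partial>circ) = (if k = 0 then 1 else 0)"
proof (cases "k = 0")
  case False
  have pm: "(\<lambda>y::complex. y powi k) \<in> borel_measurable borel"
    by (cases "k \<ge> 0") (simp_all add: power_int_def)
  have "(\<integral>y. ((1/2) * y) powi k \<partial>circ) = (\<integral>y. y powi k \<partial>circ)"
    by (rule integral_circ_shift[where A = "-{0}"])
       (use pm in \<open>auto intro!: holomorphic_intros measurable_circ_borel intro: measurable_compose[OF _ pm]\<close>)
  hence "((1/2) powi k - 1) * (\<integral>y. y powi k \<partial>circ) = (0::complex)"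
    unfolding power_int_mult_distrib integral_mult_right_zero by (simp add: algebra_simps)
  moreover have "(1/2 :: complex) powi k \<noteq> 1"
  proof
    assume "(1/2 :: complex) powi k = 1"
    hence "norm ((1/2 :: complex) powi k) = 1" by simp
    hence "(1/2 :: real) powi k = 1" by (simp add: norm_power_int)
    moreover have "(2::real) ^ m \<noteq> 1" if "m > 0" for m
      using one_less_power[of "2::real" m] that by (metis less_irrefl one_less_numeral_iff semiring_norm(76))
    ultimately show False
      using False by (cases "k > 0") (auto simp: power_int_def field_simps split: if_splits)
  qed
  ultimately show ?thesis using False by simp
qed (use prob_space.prob_space[OF prob_space_circ] in simp)

section \<open>Bounded measurable functions on tori\<close>

lemma measurable_coord: "i \<in> S \<Longrightarrow> (\<lambda>x. x i) \<in> borel_measurable (torus S)"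
  by (rule measurable_compose[OF measurable_component_singleton[of i S "\<lambda>_. circ"] measurable_circ_borel]) auto

lemma norm_coord: "x \<in> space (torus S) \<Longrightarrow> i \<in> S \<Longrightarrow> norm (x i) = 1"
  by (auto simp: space_PiM PiE_def Pi_def)

text \<open>All integrands are bounded, and this class is closed under sums, products and
  substitutions. Integrability and Fubini thus reduce to a syntactic check by
  \<open>bdd_meas_intros\<close>.\<close>

definition bdd_meas :: "'a measure \<Rightarrow> ('a \<Rightarrow> complex) \<Rightarrow> bool" where
  "bdd_meas M f \<longleftrightarrow> f \<in> borel_measurable M \<and> (\<exists>B. \<forall>x\<in>space M. norm (f x) \<le> B)"

lemma bdd_meas_measurable: "bdd_meas M f \<Longrightarrow> f \<in> borel_measurable M"
  by (simp add: bdd_meas_def)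

lemma bdd_measI: "f \<in> borel_measurable M \<Longrightarrow> (\<And>x. x \<in> space M \<Longrightarrow> norm (f x) \<le> B) \<Longrightarrow> bdd_meas M f"
  by (auto simp: bdd_meas_def)

named_theorems bdd_meas_intros

lemma bdd_meas_const [bdd_meas_intros]: "bdd_meas M (\<lambda>_. c)"
  by (rule bdd_measI[of _ _ "norm c"]) auto

lemma bdd_meas_mult [bdd_meas_intros]: assumes "bdd_meas M f" "bdd_meas M g" shows "bdd_meas M (\<lambda>x. f x * g x)"
proof -
  from assms obtain A B where AB: "\<And>x. x \<in> space M \<Longrightarrow> norm (f x) \<le> A" "\<And>x. x \<in> space M \<Longrightarrow> norm (g x) \<le> B"
    by (auto simp: bdd_meas_def)
  show ?thesis
  proof (rule bdd_measI)
    show "(\<lambda>x. f x * g x) \<in> borel_measurable M"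
      using assms by (intro borel_measurable_times bdd_meas_measurable)
    fix x assume "x \<in> space M"
    thus "norm (f x * g x) \<le> A * B"
      using AB[of x] by (auto simp: norm_mult intro!: mult_mono intro: order_trans[OF norm_ge_zero])
  qed
qed

lemma bdd_meas_add [bdd_meas_intros]: assumes "bdd_meas M f" "bdd_meas M g" shows "bdd_meas M (\<lambda>x. f x + g x)"
proof -
  from assms obtain A B where AB: "\<And>x. x \<in> space M \<Longrightarrow> norm (f x) \<le> A" "\<And>x. x \<in> space M \<Longrightarrow> norm (g x) \<le> B"
    by (auto simp: bdd_meas_def)
  show ?thesis
  proof (rule bdd_measI)
    show "(\<lambda>x. f x + g x) \<in> borel_measurable M"
      using assms by (intro borel_measurable_add bdd_meas_measurable)
    fix x assume "x \<in> space M"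
    thus "norm (f x + g x) \<le> A + B"
      using AB[of x] by (auto intro: norm_triangle_mono)
  qed
qed

lemma bdd_meas_uminus [bdd_meas_intros]: "bdd_meas M f \<Longrightarrow> bdd_meas M (\<lambda>x. - f x)"
  using bdd_meas_mult[OF bdd_meas_const[of M "-1"], of f] by simp

lemma bdd_meas_diff [bdd_meas_intros]: "bdd_meas M f \<Longrightarrow> bdd_meas M g \<Longrightarrow> bdd_meas M (\<lambda>x. f x - g x)"
  using bdd_meas_add[OF _ bdd_meas_uminus, of M f g] by simp

lemma bdd_meas_power [bdd_meas_intros]: "bdd_meas M f \<Longrightarrow> bdd_meas M (\<lambda>x. f x ^ n)"
  by (induction n) (auto intro!: bdd_meas_intros)

lemma bdd_meas_prod [bdd_meas_intros]: "(\<And>i. i \<in> I \<Longrightarrow> bdd_meas M (f i)) \<Longrightarrow> bdd_meas M (\<lambda>x. \<Prod>i\<in>I. f i x)"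
  by (induction I rule: infinite_finite_induct) (auto intro!: bdd_meas_intros)

lemma bdd_meas_sum [bdd_meas_intros]: "(\<And>i. i \<in> I \<Longrightarrow> bdd_meas M (f i)) \<Longrightarrow> bdd_meas M (\<lambda>x. \<Sum>i\<in>I. f i x)"
  by (induction I rule: infinite_finite_induct) (auto intro!: bdd_meas_intros)

lemma bdd_meas_prod_list [bdd_meas_intros]: "(\<And>a. a \<in> set as \<Longrightarrow> bdd_meas M (f a)) \<Longrightarrow> bdd_meas M (\<lambda>x. \<Prod>a\<leftarrow>as. f a x)"
  by (induction as) (auto intro!: bdd_meas_intros)

lemma bdd_meas_coord [bdd_meas_intros]: "i \<in> S \<Longrightarrow> bdd_meas (torus S) (\<lambda>x. x i)"
  by (rule bdd_measI[of _ _ 1]) (auto simp: norm_coord measurable_coord)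

lemma bdd_meas_inverse_coord [bdd_meas_intros]: "i \<in> S \<Longrightarrow> bdd_meas (torus S) (\<lambda>x. inverse (x i))"
  by (rule bdd_measI[of _ _ 1]) (auto simp: norm_coord norm_inverse intro!: borel_measurable_inverse measurable_coord)

lemma bdd_meas_integrable:
  assumes "prob_space M" "bdd_meas M f" shows "integrable M f"
proof -
  interpret prob_space M by fact
  from assms(2) obtain B where "\<And>x. x \<in> space M \<Longrightarrow> norm (f x) \<le> B"
    by (auto simp: bdd_meas_def)
  thus ?thesis
    using bdd_meas_measurable[OF assms(2)] by (intro integrable_const_bound[of _ B]) auto
qed

lemma bdd_meas_compose:
  assumes "bdd_meas N f" "g \<in> M \<rightarrow>\<^sub>M N" shows "bdd_meas M (\<lambda>x. f (g x))"
  using assms measurable_space[OF assms(2)] measurable_compose[OF assms(2) bdd_meas_measurable[OF assms(1)]]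
  unfolding bdd_meas_def by blast

lemma bdd_meas_fst: "bdd_meas M f \<Longrightarrow> bdd_meas (M \<Otimes>\<^sub>M N) (\<lambda>p. f (fst p))"
  by (rule bdd_meas_compose[OF _ measurable_fst])

lemma bdd_meas_snd: "bdd_meas N f \<Longrightarrow> bdd_meas (M \<Otimes>\<^sub>M N) (\<lambda>p. f (snd p))"
  by (rule bdd_meas_compose[OF _ measurable_snd])

lemma bdd_meas_coord_pair [bdd_meas_intros]:
  "i \<in> S \<Longrightarrow> bdd_meas (torus S \<Otimes>\<^sub>M N) (\<lambda>p. fst p i)"
  "i \<in> S \<Longrightarrow> bdd_meas (torus S \<Otimes>\<^sub>M N) (\<lambda>p. inverse (fst p i))"
  "i \<in> S \<Longrightarrow> bdd_meas (N \<Otimes>\<^sub>M torus S) (\<lambda>p. snd p i)"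
  "i \<in> S \<Longrightarrow> bdd_meas (N \<Otimes>\<^sub>M torus S) (\<lambda>p. inverse (snd p i))"
  by (rule bdd_meas_fst bdd_meas_snd, rule bdd_meas_intros, assumption)+

section \<open>Iterated integrals, null sets and symmetries of the torus\<close>

lemma torus_Fubini:
  fixes F :: "('i \<Rightarrow> complex) \<Rightarrow> ('j \<Rightarrow> complex) \<Rightarrow> complex"
  assumes "bdd_meas (torus I \<Otimes>\<^sub>M torus J) (\<lambda>p. F (fst p) (snd p))"
  shows "(\<integral>y. (\<integral>x. F x y \<partial>torus I) \<partial>torus J) = (\<integral>x. (\<integral>y. F x y \<partial>torus J) \<partial>torus I)"
proof -
  interpret I: prob_space "torus I" by (rule prob_space_torus)
  interpret J: prob_space "torus J" by (rule prob_space_torus)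
  interpret P: pair_prob_space "torus I" "torus J" ..
  show ?thesis
    using bdd_meas_integrable[OF P.prob_space_axioms assms] by (intro P.Fubini_integral) (simp add: case_prod_unfold)
qed

lemma torus_integral_insert:
  assumes "finite I" "i \<notin> I" "bdd_meas (torus (insert i I)) f"
  shows "(\<integral>x. f x \<partial>torus (insert i I)) = (\<integral>x. (\<integral>y. f (x(i := y)) \<partial>circ) \<partial>torus I)"
  by (rule product_sigma_finite.product_integral_insert[OF product_sigma_finite_circ]) (use assms bdd_meas_integrable prob_space_torus in auto)

lemma torus_integral_prod:
  assumes "finite I" "bdd_meas circ f"
  shows "(\<integral>x. (\<Prod>i\<in>I. f (x i)) \<partial>torus I) = (\<integral>y. f y \<partial>circ) ^ card I"
  using product_sigma_finite.product_integral_prod[OF product_sigma_finite_circ, of I "\<lambda>_. f"] assms bdd_meas_integrable[OF prob_space_circ] by simp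

text \<open>Integrating the indicator of the exceptional set over coordinate \<open>i\<close> first
  gives 0, since each fibre is countable.\<close>

lemma torus_AE_neq:
  fixes f g :: "('i \<Rightarrow> complex) \<Rightarrow> complex"
  assumes "finite S" "i \<in> S" "f \<in> borel_measurable (torus S)" "g \<in> borel_measurable (torus S)"
    and "\<And>x. x \<in> space (torus (S - {i})) \<Longrightarrow> countable {y. norm y = 1 \<and> f (x(i := y)) = g (x(i := y))}"
  shows "AE x in torus S. f x \<noteq> g x"
proof -
  have S: "S = insert i (S - {i})" using assms by auto
  let ?N = "{x \<in> space (torus S). f x = g x}"
  have N: "?N \<in> sets (torus S)" using assms(3,4) by measurable
  have "emeasure (torus S) ?N = (\<integral>\<^sup>+x. indicator ?N x \<partial>torus (insert i (S - {i})))"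
    using N S by simp
  also have "\<dots> = (\<integral>\<^sup>+x. (\<integral>\<^sup>+y. indicator ?N (x(i := y)) \<partial>circ) \<partial>torus (S - {i}))"
    by (rule product_sigma_finite.product_nn_integral_insert[OF product_sigma_finite_circ]) (use assms N S in auto)
  also have "\<dots> = (\<integral>\<^sup>+x. 0 \<partial>torus (S - {i}))"
  proof (rule nn_integral_cong)
    fix x assume x: "x \<in> space (torus (S - {i}))"
    have "AE y in circ. y \<notin> {y. norm y = 1 \<and> f (x(i := y)) = g (x(i := y))}"
      by (rule AE_circ_countable) (rule assms(5)[OF x])
    hence "AE y in circ. indicator ?N (x(i := y)) = (0 :: ennreal)"
      by eventually_elim (auto simp: indicator_def dest!: norm_coord[OF _ assms(2)])
    thus "(\<integral>\<^sup>+y. indicator ?N (x(i := y)) \<partial>circ) = 0"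
      by (subst nn_integral_cong_AE[of _ "\<lambda>_. 0"]) auto
  qed
  also have "\<dots> = 0" by simp
  finally have "?N \<in> null_sets (torus S)" using N by blast
  thus ?thesis by (rule AE_I') auto
qed

text \<open>For a point with coordinates of norm 1 this means that the numbers \<open>x i\<close>
  and \<open>inverse (x i)\<close>, for \<open>i\<close> in \<open>S\<close>, are pairwise distinct,
  which is what interpolation at these points requires.\<close>

definition torus_generic :: "'i set \<Rightarrow> ('i \<Rightarrow> complex) \<Rightarrow> bool" where
  "torus_generic S x \<longleftrightarrow> (\<forall>i\<in>S. (x i)\<^sup>2 \<noteq> 1 \<and> (\<forall>j\<in>S - {i}. x i \<noteq> x j \<and> x i * x j \<noteq> 1))"

lemma AE_torus_generic:
  assumes "finite S"
  shows "AE x in torus S. torus_generic S x"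
proof -
  have 1: "AE x in torus S. (x i)\<^sup>2 \<noteq> 1" if i: "i \<in> S" for i
  proof (rule torus_AE_neq[OF assms i])
    have "{y::complex. norm y = 1 \<and> ((x(i := y)) i)\<^sup>2 = 1} \<subseteq> {1, -1}" for x
      by (auto simp: power2_eq_1_iff)
    thus "countable {y::complex. norm y = 1 \<and> ((x(i := y)) i)\<^sup>2 = 1}" for x
      by (rule countable_subset) auto
  qed (use i in \<open>auto intro!: borel_measurable_power measurable_coord\<close>)
  have 2: "AE x in torus S. x i \<noteq> x j" if i: "i \<in> S" "j \<in> S - {i}" for i j
  proof (rule torus_AE_neq[OF assms i(1)])
    have "{y::complex. norm y = 1 \<and> (x(i := y)) i = (x(i := y)) j} \<subseteq> {x j}" for x
      using i by auto
    thus "countable {y::complex. norm y = 1 \<and> (x(i := y)) i = (x(i := y)) j}" for x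
      by (rule countable_subset) auto
  qed (use i in \<open>auto intro!: measurable_coord\<close>)
  have 3: "AE x in torus S. x i * x j \<noteq> 1" if i: "i \<in> S" "j \<in> S - {i}" for i j
  proof (rule torus_AE_neq[OF assms i(1)])
    have "{y::complex. norm y = 1 \<and> (x(i := y)) i * (x(i := y)) j = 1} \<subseteq> {inverse (x j)}" for x
      using i inverse_unique[of "x j"] by (auto simp: mult.commute)
    thus "countable {y::complex. norm y = 1 \<and> (x(i := y)) i * (x(i := y)) j = 1}" for x
      by (rule countable_subset) auto
  qed (use i in \<open>auto intro!: borel_measurable_times measurable_coord\<close>)
  show ?thesis
    unfolding torus_generic_def by (intro AE_finite_allI AE_conjI 1 2 3) (use assms in auto)
qed

lemma measurable_coord_inverse:
  assumes "i \<in> S"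
  shows "(\<lambda>x. x(i := inverse (x i))) \<in> torus S \<rightarrow>\<^sub>M torus S"
proof (rule measurable_PiM_single')
  show "(\<lambda>x. (x(i := inverse (x i))) j) \<in> torus S \<rightarrow>\<^sub>M circ" if "j \<in> S" for j
  proof (cases "j = i")
    case True
    have "(\<lambda>x. inverse (x i)) \<in> torus S \<rightarrow>\<^sub>M restrict_space borel (sphere 0 1)"
      by (rule measurable_restrict_space2) (use assms in \<open>auto simp: norm_inverse norm_coord intro!: borel_measurable_inverse measurable_coord\<close>)
    thus ?thesis using True measurable_cong_sets[OF refl sets_circ, THEN equalityD2, THEN subsetD] by simp
  qed (use that in \<open>simp add: measurable_component_singleton\<close>)
  show "(\<lambda>x. x(i := inverse (x i))) \<in> space (torus S) \<rightarrow> S \<rightarrow>\<^sub>E space circ"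
    using assms by (auto simp: space_PiM PiE_def Pi_def extensional_def norm_inverse)
qed

lemma torus_integral_coord_inverse:
  assumes "finite S" "i \<in> S" "bdd_meas (torus S) f"
  shows "(\<integral>x. f (x(i := inverse (x i))) \<partial>torus S) = (\<integral>x. f x \<partial>torus S)"
proof -
  have S: "S = insert i (S - {i})" using assms by auto
  have m: "(\<lambda>x. x(i := inverse (x i))) \<in> torus S \<rightarrow>\<^sub>M torus S"
    by (rule measurable_coord_inverse[OF assms(2)])
  have f': "bdd_meas (torus S) (\<lambda>x. f (x(i := inverse (x i))))"
    by (rule bdd_meas_compose[OF assms(3) m])
  have "(\<integral>x. f (x(i := inverse (x i))) \<partial>torus (insert i (S - {i}))) =
        (\<integral>x. (\<integral>y. f (x(i := inverse y)) \<partial>circ) \<partial>torus (S - {i}))"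
    by (subst torus_integral_insert) (use assms f' S in auto)
  also have "\<dots> = (\<integral>x. (\<integral>y. f (x(i := y)) \<partial>circ) \<partial>torus (S - {i}))"
  proof (rule Bochner_Integration.integral_cong[OF refl])
    fix x assume x: "x \<in> space (torus (S - {i}))"
    have "(\<lambda>y. x(i := y)) \<in> circ \<rightarrow>\<^sub>M torus (insert i (S - {i}))"
      by (rule measurable_fun_upd[where J = "S - {i}"]) (use x in auto)
    hence "(\<lambda>y. f (x(i := y))) \<in> borel_measurable circ"
      using bdd_meas_measurable[OF assms(3)] S by (metis measurable_compose)
    thus "(\<integral>y. f (x(i := inverse y)) \<partial>circ) = (\<integral>y. f (x(i := y)) \<partial>circ)"
      by (rule integral_circ_inverse)
  qed
  also have "\<dots> = (\<integral>x. f x \<partial>torus (insert i (S - {i})))"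
    by (rule torus_integral_insert[symmetric]) (use assms S in auto)
  finally show ?thesis using S by simp
qed

text \<open>With inversion of a coordinate this gives invariance under the hyperoctahedral group.
  The permuted point is restricted to \<open>S\<close> because the elements of the product space are
  extensional functions.\<close>

lemma torus_integral_permute:
  assumes "\<pi> permutes S" "bdd_meas (torus S) f"
  shows "(\<integral>x. f (\<lambda>n\<in>S. x (\<pi> n)) \<partial>torus S) = (\<integral>x. f x \<partial>torus S)"
proof -
  have m: "(\<lambda>x. \<lambda>n\<in>S. x (\<pi> n)) \<in> torus S \<rightarrow>\<^sub>M torus S"
    using permutes_in_image[OF assms(1)] by (intro measurable_restrict measurable_component_singleton) auto
  have "distr (torus S) (torus S) (\<lambda>x. \<lambda>n\<in>S. x (\<pi> n)) = torus S"
    using distr_PiM_reindex[of S "\<lambda>_. circ" \<pi> S] assms(1) prob_space_circ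
    by (auto simp: permutes_inj_on permutes_in_image)
  hence "(\<integral>x. f x \<partial>torus S) = (\<integral>x. f x \<partial>distr (torus S) (torus S) (\<lambda>x. \<lambda>n\<in>S. x (\<pi> n)))"
    by simp
  also have "\<dots> = (\<integral>x. f (\<lambda>n\<in>S. x (\<pi> n)) \<partial>torus S)"
    by (rule integral_distr[OF m bdd_meas_measurable[OF assms(2)]])
  finally show ?thesis by simp
qed

context nome
begin

lemma bdd_meas_qp [bdd_meas_intros]:
  assumes "bdd_meas M f" shows "bdd_meas M (\<lambda>x. qp (f x))"
proof -
  from assms obtain r where r: "\<And>x. x \<in> space M \<Longrightarrow> norm (f x) \<le> r" by (auto simp: bdd_meas_def)
  from qp_bounded[of r] obtain B where "\<And>z. norm z \<le> r \<Longrightarrow> norm (qp z) \<le> B" by blast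
  thus ?thesis
    using r measurable_compose[OF bdd_meas_measurable[OF assms] qp_measurable] by (intro bdd_measI[of _ _ B]) auto
qed

lemma bdd_meas_inverse_qp:
  assumes "bdd_meas M f" "\<And>x. x \<in> space M \<Longrightarrow> norm (f x) \<le> r" "r < 1"
  shows "bdd_meas M (\<lambda>x. inverse (qp (f x)))"
proof -
  from inverse_qp_bounded[OF assms(3)] obtain B where "\<And>z. norm z \<le> r \<Longrightarrow> norm (inverse (qp z)) \<le> B" by blast
  thus ?thesis
    using assms(2) measurable_compose[OF bdd_meas_measurable[OF assms(1)] qp_measurable]
    by (intro bdd_measI[of _ _ B]) (auto intro!: borel_measurable_inverse measurable_coord)
qed

end

section \<open>Partial fractions\<close>

text \<open>The sum is the leading coefficient of the Lagrange interpolant at \<open>N\<close> of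
  the monic polynomial with roots \<open>cs\<close>. Its degree is below the number of nodes, so the
  interpolant is that polynomial itself. Every partial fraction identity below is an
  instance.\<close>

lemma lagrange_leading_coeff:
  fixes N :: "complex set"
  assumes "finite N" "card N = Suc (length cs)"
  shows "(\<Sum>s\<in>N. (\<Prod>c\<leftarrow>cs. s - c) / (\<Prod>s'\<in>N - {s}. s - s')) = 1"
proof -
  define w where "w s = (\<Prod>c\<leftarrow>cs. s - c) / (\<Prod>s'\<in>N - {s}. s - s')" for s
  define L where "L s = (\<Prod>s'\<in>N - {s}. [:-s', 1:])" for s
  define p where "p = (\<Sum>s\<in>N. smult (w s) (L s))"
  define r where "r = (\<Prod>c\<leftarrow>cs. [:-c, 1:])"
  have degL: "degree (L s) = length cs" "lead_coeff (L s) = 1" if "s \<in> N" for s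
  proof -
    show "degree (L s) = length cs"
      using assms that unfolding L_def by (simp add: degree_prod_eq_sum_degree)
    show "lead_coeff (L s) = 1"
      unfolding L_def lead_coeff_prod by simp
  qed
  have degr: "degree (\<Prod>c\<leftarrow>xs. [:-c, 1:]) = length xs \<and> lead_coeff (\<Prod>c\<leftarrow>xs. [:-c, 1:]) = 1" for xs :: "complex list"
  proof (induction xs)
    case (Cons c xs)
    have nz: "(\<Prod>c\<leftarrow>xs. [:-c, 1:]) \<noteq> 0" using Cons by force
    have "degree ([:-c, 1:] * (\<Prod>c\<leftarrow>xs. [:-c, 1:])) = Suc (length xs)"
      by (subst degree_mult_eq) (use nz Cons in auto)
    moreover have "lead_coeff ([:-c, 1:] * (\<Prod>c\<leftarrow>xs. [:-c, 1:])) = 1"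
      by (subst lead_coeff_mult) (use Cons in auto)
    ultimately show ?case by (simp only: list.map prod_list.Cons length_Cons)
  qed auto
  have degp: "degree p \<le> length cs"
    unfolding p_def by (rule degree_sum_le) (use assms degL in \<open>auto intro: order_trans[OF degree_smult_le]\<close>)
  have "poly p s = poly r s" if s: "s \<in> N" for s
  proof -
    have "poly p s = (\<Sum>s'\<in>N. w s' * poly (L s') s)"
      by (simp add: p_def poly_sum)
    also have "\<dots> = (\<Sum>s'\<in>N. if s' = s then w s * poly (L s) s else 0)"
      by (intro sum.cong refl) (use s assms in \<open>auto simp: L_def poly_prod\<close>)
    also have "\<dots> = w s * (\<Prod>s'\<in>N - {s}. s - s')"
      using s assms by (simp add: L_def poly_prod)
    also have "\<dots> = (\<Prod>c\<leftarrow>cs. s - c)"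
      using assms by (auto simp: w_def)
    also have "\<dots> = poly r s"
      unfolding r_def by (induction cs) (auto simp: algebra_simps)
    finally show ?thesis .
  qed
  hence "p = r"
    by (rule poly_eqI_degree[where A = N]) (use degp degr[of cs] assms in \<open>auto simp: r_def\<close>)
  hence "coeff p (length cs) = 1"
    using degr[of cs] unfolding r_def by metis
  moreover have "coeff p (length cs) = (\<Sum>s\<in>N. w s)"
    using degL by (simp add: p_def coeff_sum)
  ultimately show ?thesis by (simp add: w_def)
qed

definition nodes :: "('i \<Rightarrow> complex) \<Rightarrow> 'i set \<Rightarrow> complex set" where
  "nodes x S = x ` S \<union> (\<lambda>i. inverse (x i)) ` S"

definition unimodular :: "'i set \<Rightarrow> ('i \<Rightarrow> complex) \<Rightarrow> bool" where
  "unimodular S x \<longleftrightarrow> (\<forall>i\<in>S. norm (x i) = 1)"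

lemma unimodular_torus: "x \<in> space (torus S) \<Longrightarrow> unimodular S x"
  by (simp add: unimodular_def norm_coord)

lemma unimodular_nz: "unimodular S x \<Longrightarrow> i \<in> S \<Longrightarrow> x i \<noteq> 0"
  by (auto simp: unimodular_def)

lemma torus_generic_mono: "torus_generic S x \<Longrightarrow> T \<subseteq> S \<Longrightarrow> torus_generic T x"
  by (auto simp: torus_generic_def)

lemma unimodular_mono: "unimodular S x \<Longrightarrow> T \<subseteq> S \<Longrightarrow> unimodular T x"
  by (auto simp: unimodular_def)

lemma finite_nodes [simp]: "finite S \<Longrightarrow> finite (nodes x S)"
  by (simp add: nodes_def)

lemma
  assumes g: "torus_generic S x" "unimodular S x"
  shows nodes_inj1: "inj_on x S" and nodes_inj2: "inj_on (\<lambda>i. inverse (x i)) S"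
    and nodes_disj: "x ` S \<inter> (\<lambda>i. inverse (x i)) ` S = {}"
proof -
  show 1: "inj_on x S"
    using g by (auto simp: inj_on_def torus_generic_def)
  thus "inj_on (\<lambda>i. inverse (x i)) S"
    by (auto simp: inj_on_def)
  have "x i \<noteq> inverse (x j)" if "i \<in> S" "j \<in> S" for i j
  proof
    assume *: "x i = inverse (x j)"
    hence "x i * x j = 1" using unimodular_nz[OF g(2) that(2)] by simp
    thus False
      using g(1) that by (cases "i = j") (auto simp: torus_generic_def power2_eq_square)
  qed
  thus "x ` S \<inter> (\<lambda>i. inverse (x i)) ` S = {}" by auto
qed

lemma
  assumes "torus_generic S x" "unimodular S x" "finite S"
  shows prod_nodes: "(\<Prod>s\<in>nodes x S. f s) = (\<Prod>i\<in>S. f (x i) * f (inverse (x i)))"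
    and sum_nodes: "(\<Sum>s\<in>nodes x S. f s) = (\<Sum>i\<in>S. f (x i) + f (inverse (x i)))"
    and card_nodes: "card (nodes x S) = 2 * card S"
  using nodes_inj1[OF assms(1,2)] nodes_inj2[OF assms(1,2)] nodes_disj[OF assms(1,2)] assms(3)
  unfolding nodes_def
  by (simp_all add: prod.union_disjoint sum.union_disjoint prod.reindex sum.reindex prod.distrib sum.distrib card_Un_disjoint card_image)

lemma
  assumes g: "torus_generic S x" "unimodular S x" and i: "i \<in> S"
  shows nodes_remove: "nodes x S - {x i} = insert (inverse (x i)) (nodes x (S - {i}))"
    and nodes_remove': "nodes x S - {inverse (x i)} = insert (x i) (nodes x (S - {i}))"
    and nodes_notin: "x i \<notin> nodes x (S - {i})" "inverse (x i) \<notin> nodes x (S - {i})"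
proof -
  note inj = nodes_inj1[OF g] nodes_inj2[OF g] nodes_disj[OF g]
  show *: "x i \<notin> nodes x (S - {i})" "inverse (x i) \<notin> nodes x (S - {i})"
    using inj i unfolding nodes_def inj_on_def by blast+
  have "x i \<noteq> inverse (x i)" using inj(3) i by blast
  moreover have "nodes x S = insert (x i) (insert (inverse (x i)) (nodes x (S - {i})))"
    using i by (auto simp: nodes_def)
  ultimately show "nodes x S - {x i} = insert (inverse (x i)) (nodes x (S - {i}))"
    "nodes x S - {inverse (x i)} = insert (x i) (nodes x (S - {i}))"
    using * by auto
qed

lemma nodes_norm: "unimodular S x \<Longrightarrow> z \<in> nodes x S \<Longrightarrow> norm z = 1"
  by (auto simp: nodes_def unimodular_def norm_inverse)

text \<open>The nodes are the \<open>x i\<close> and their inverses together with a set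
  \<open>Z\<close> off the unit circle, hence disjoint from them. The node paired with
  \<open>x i\<close> is \<open>inverse (x i)\<close> and conversely, so a single formula
  \<open>t i z\<close>, with the factor \<open>z - inverse z\<close>, describes both terms of a
  pair.\<close>

lemma lagrange_torus:
  assumes g: "torus_generic S x" "unimodular S x" and S: "finite S"
    and Z: "finite Z" "\<And>z. z \<in> Z \<Longrightarrow> norm z \<noteq> 1"
    and card: "card Z + 2 * card S = Suc (length cs)"
  defines "t \<equiv> \<lambda>i z. (\<Prod>c\<leftarrow>cs. z - c) / ((\<Prod>s\<in>Z. z - s) * (z - inverse z) * (\<Prod>j\<in>S - {i}. (z - x j) * (z - inverse (x j))))"
  shows "(\<Sum>z\<in>Z. (\<Prod>c\<leftarrow>cs. z - c) / ((\<Prod>s\<in>Z - {z}. z - s) * (\<Prod>j\<in>S. (z - x j) * (z - inverse (x j)))))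
       + (\<Sum>i\<in>S. t i (x i) + t i (inverse (x i))) = 1"
proof -
  have disj: "Z \<inter> nodes x S = {}" using Z(2) nodes_norm[OF g(2)] by blast
  let ?N = "Z \<union> nodes x S"
  let ?F = "\<lambda>s. (\<Prod>c\<leftarrow>cs. s - c) / (\<Prod>s'\<in>?N - {s}. s - s')"
  have "(\<Sum>s\<in>?N. ?F s) = 1"
    by (rule lagrange_leading_coeff) (use S Z card disj card_nodes[OF g S] in \<open>auto simp: card_Un_disjoint\<close>)
  moreover have "(\<Sum>s\<in>?N. ?F s) = (\<Sum>s\<in>Z. ?F s) + (\<Sum>s\<in>nodes x S. ?F s)"
    using disj S Z by (intro sum.union_disjoint) auto
  moreover have "?F z = (\<Prod>c\<leftarrow>cs. z - c) / ((\<Prod>s\<in>Z - {z}. z - s) * (\<Prod>j\<in>S. (z - x j) * (z - inverse (x j))))"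
    if z: "z \<in> Z" for z
  proof -
    have "?N - {z} = (Z - {z}) \<union> nodes x S" using disj z by auto
    hence "(\<Prod>s'\<in>?N - {z}. z - s') = (\<Prod>s'\<in>Z - {z}. z - s') * (\<Prod>s'\<in>nodes x S. z - s')"
      using disj S Z by (simp add: prod.union_disjoint Diff_Int_distrib2)
    thus ?thesis by (simp add: prod_nodes[OF g S])
  qed
  moreover have "?F (x i) = t i (x i)" "?F (inverse (x i)) = t i (inverse (x i))" if i: "i \<in> S" for i
  proof -
    have S': "finite (S - {i})" and g': "torus_generic (S - {i}) x" "unimodular (S - {i}) x"
      using S g torus_generic_mono[OF g(1), of "S - {i}"] unimodular_mono[OF g(2), of "S - {i}"] by auto
    note P = prod_nodes[OF g' S']
    note ni = nodes_notin[OF g i]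
    have xi: "x i \<in> nodes x S" "inverse (x i) \<in> nodes x S" using i by (auto simp: nodes_def)
    have disj': "Z \<inter> insert y (nodes x (S - {i})) = {}" if "y \<in> nodes x S" for y
      using disj that by (auto simp: nodes_def)
    have "?N - {x i} = Z \<union> insert (inverse (x i)) (nodes x (S - {i}))"
      unfolding nodes_remove[OF g i, symmetric] using disj xi by auto
    hence "(\<Prod>s'\<in>?N - {x i}. x i - s') = (\<Prod>s'\<in>Z. x i - s') * ((x i - inverse (x i)) * (\<Prod>s'\<in>nodes x (S - {i}). x i - s'))"
      using disj' xi S' Z ni by (simp add: prod.union_disjoint)
    thus "?F (x i) = t i (x i)" by (simp add: P t_def mult_ac)
    have "?N - {inverse (x i)} = Z \<union> insert (x i) (nodes x (S - {i}))"
      unfolding nodes_remove'[OF g i, symmetric] using disj xi by auto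
    hence "(\<Prod>s'\<in>?N - {inverse (x i)}. inverse (x i) - s') =
        (\<Prod>s'\<in>Z. inverse (x i) - s') * ((inverse (x i) - x i) * (\<Prod>s'\<in>nodes x (S - {i}). inverse (x i) - s'))"
      using disj' xi S' Z ni by (simp add: prod.union_disjoint)
    thus "?F (inverse (x i)) = t i (inverse (x i))" by (simp add: P t_def mult_ac)
  qed
  ultimately show ?thesis
    by (simp add: sum_nodes[OF g S])
qed

section \<open>Products over pairs\<close>

text \<open>The order of the two indices matters: the factors of \<open>Delta_CC_plus\<close> are
  not symmetric in their arguments.\<close>

definition pprod :: "nat set \<Rightarrow> (complex \<Rightarrow> complex \<Rightarrow> complex) \<Rightarrow> (nat \<Rightarrow> complex) \<Rightarrow> complex" where
  "pprod S s x = (\<Prod>(i, j)\<in>{(i, j). i \<in> S \<and> j \<in> S \<and> i < j}. s (x i) (x j))"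

lemma finite_pairs: "finite S \<Longrightarrow> finite {(i, j). i \<in> S \<and> j \<in> S \<and> i < (j :: nat)}"
  by (rule finite_subset[of _ "S \<times> S"]) auto

lemma pprod_empty [simp]: "pprod {} s x = 1"
  by (simp add: pprod_def)

lemma pprod_insert:
  assumes "finite S" "i \<notin> S" "\<And>j. j \<in> S \<Longrightarrow> s (x i) (x j) = s (x j) (x i)"
  shows "pprod (insert i S) s x = (\<Prod>j\<in>S. s (x i) (x j)) * pprod S s x"
proof -
  let ?P = "\<lambda>S. {(i, j). i \<in> S \<and> j \<in> S \<and> i < (j :: nat)}"
  let ?m = "\<lambda>j. (min i j, max i j)"
  have eq: "?P (insert i S) = ?m ` S \<union> ?P S"
  proof (intro equalityI subsetI)
    fix p assume "p \<in> ?P (insert i S)"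
    then obtain a b where p: "p = (a, b)" "a < b" "a \<in> insert i S" "b \<in> insert i S" by auto
    consider "a = i" "b \<in> S" | "b = i" "a \<in> S" | "a \<in> S" "b \<in> S" using p by auto
    thus "p \<in> ?m ` S \<union> ?P S"
    proof cases
      case 1 hence "p = ?m b" using p by simp
      thus ?thesis using 1 by blast
    next
      case 2 hence "p = ?m a" using p by simp
      thus ?thesis using 2 by blast
    qed (use p in auto)
  next
    fix p assume "p \<in> ?m ` S \<union> ?P S"
    moreover have "?m j \<in> ?P (insert i S)" if "j \<in> S" for j
      using assms(2) that by (cases "i < j") (auto simp: min_def max_def)
    ultimately show "p \<in> ?P (insert i S)" by auto
  qed
  have "pprod (insert i S) s x = (\<Prod>(i, j)\<in>?m ` S. s (x i) (x j)) * pprod S s x"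
    unfolding pprod_def eq
    by (rule prod.union_disjoint) (use assms finite_pairs in \<open>auto simp: min_def max_def split: if_splits\<close>)
  also have "(\<Prod>(i, j)\<in>?m ` S. s (x i) (x j)) = (\<Prod>j\<in>S. s (x i) (x j))"
    by (subst prod.reindex) (use assms in \<open>auto simp: inj_on_def min_def max_def split: if_splits intro!: prod.cong\<close>)
  finally show ?thesis .
qed

lemma pprod_remove:
  assumes "finite S" "i \<in> S" "\<And>j. j \<in> S \<Longrightarrow> s (x i) (x j) = s (x j) (x i)"
  shows "pprod S s x = (\<Prod>j\<in>S - {i}. s (x i) (x j)) * pprod (S - {i}) s x"
  using pprod_insert[of "S - {i}" i s x] assms by (simp add: insert_absorb)

lemma pprod_cong:
  "(\<And>i j. i \<in> S \<Longrightarrow> j \<in> S \<Longrightarrow> i < j \<Longrightarrow> s (x i) (x j) = s' (y i) (y j)) \<Longrightarrow> pprod S s x = pprod S s' y"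
  unfolding pprod_def by (intro prod.cong) auto

lemma pprod_mult: "pprod S (\<lambda>u v. s u v * s' u v) x = pprod S s x * pprod S s' x"
  by (simp add: pprod_def prod.distrib case_prod_unfold)

lemma pprod_inverse: "pprod S (\<lambda>u v. inverse (s u v)) x = inverse (pprod S s x)"
  by (simp add: pprod_def prod_inversef[symmetric] case_prod_unfold)

lemma bdd_meas_pprod:
  "(\<And>i j. i \<in> S \<Longrightarrow> j \<in> S \<Longrightarrow> i < j \<Longrightarrow> bdd_meas M (\<lambda>p. s (f p i) (f p j))) \<Longrightarrow> bdd_meas M (\<lambda>p. pprod S s (f p))"
  unfolding pprod_def by (auto simp: case_prod_unfold intro!: bdd_meas_prod)

section \<open>Integrals of type I\<close>

lemma measurable_circ_continuous:
  "continuous_on (sphere 0 1) f \<Longrightarrow> f \<in> borel_measurable circ" for f :: "complex \<Rightarrow> complex"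
  using borel_measurable_continuous_on_restrict[of "sphere 0 1" f]
    measurable_cong_sets[OF sets_circ refl, of borel] by blast

lemma prod_list_tendsto:
  fixes f :: "'b \<Rightarrow> 'a \<Rightarrow> complex"
  assumes "\<And>a. a \<in> set as \<Longrightarrow> (f a \<longlongrightarrow> g a) F"
  shows "((\<lambda>N. \<Prod>a\<leftarrow>as. f a N) \<longlongrightarrow> (\<Prod>a\<leftarrow>as. g a)) F"
  using assms by (induction as) (auto intro!: tendsto_intros)

lemma prod_list_nonzero: "(\<And>a. a \<in> set as \<Longrightarrow> f a \<noteq> (0::complex)) \<Longrightarrow> (\<Prod>a\<leftarrow>as. f a) \<noteq> 0"
  by (induction as) auto

lemma prod_list_mult: "(\<Prod>a\<leftarrow>as. f a * g a) = (\<Prod>a\<leftarrow>as. f a) * (\<Prod>a\<leftarrow>as. g a :: complex)"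
  by (induction as) auto

lemma prod_list_mset: "mset as = mset bs \<Longrightarrow> (\<Prod>a\<leftarrow>as. f a) = (\<Prod>a\<leftarrow>bs. f a :: complex)"
  by (metis mset_map prod_mset_prod_list)

lemma prod_list_inverse: "inverse (\<Prod>a\<leftarrow>as. f a) = (\<Prod>a\<leftarrow>as. inverse (f a :: complex))"
  by (induction as) auto

lemma continuous_on_prod_list:
  fixes f :: "'b \<Rightarrow> 'a :: topological_space \<Rightarrow> complex"
  shows "(\<And>a. a \<in> set as \<Longrightarrow> continuous_on A (f a)) \<Longrightarrow> continuous_on A (\<lambda>z. \<Prod>a\<leftarrow>as. f a z)"
  by (induction as) (auto intro!: continuous_intros)

lemma holomorphic_on_prod_list:
  "(\<And>a. a \<in> set as \<Longrightarrow> f a holomorphic_on A) \<Longrightarrow> (\<lambda>z. \<Prod>a\<leftarrow>as. f a z) holomorphic_on A"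
  by (induction as) (auto intro!: holomorphic_intros)

context nome
begin

definition \<sigma> :: "complex \<Rightarrow> complex \<Rightarrow> complex" where
  "\<sigma> u v = qp (u * v) * qp (u * inverse v) * qp (inverse u * v) * qp (inverse u * inverse v)"

text \<open>For four parameters this is the Askey-Wilson weight. Multiplied by the factors
  \<open>\<sigma>\<close> and with \<open>2 * card S + 2\<close> parameters it gives Gustafson's
  integral of type I for the root system C.\<close>

definition \<tau> :: "complex list \<Rightarrow> complex \<Rightarrow> complex" where
  "\<tau> as u = qp (u\<^sup>2) * qp (inverse (u\<^sup>2)) * inverse (\<Prod>a\<leftarrow>as. qp (a * u) * qp (a * inverse u))"

definition dens_I :: "nat set \<Rightarrow> complex list \<Rightarrow> (nat \<Rightarrow> complex) \<Rightarrow> complex" where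
  "dens_I S as x = pprod S \<sigma> x * (\<Prod>i\<in>S. \<tau> as (x i))"

definition int_I :: "nat set \<Rightarrow> complex list \<Rightarrow> complex" where
  "int_I S as = (\<integral>x. dens_I S as x \<partial>torus S)"

lemma \<sigma>_sym: "\<sigma> u v = \<sigma> v u"
  by (simp add: \<sigma>_def mult_ac)

lemma \<sigma>_inverse [simp]: "\<sigma> (inverse u) v = \<sigma> u v"
  by (simp add: \<sigma>_def mult_ac)

lemma \<tau>_inverse [simp]: "\<tau> as (inverse u) = \<tau> as u"
  by (simp add: \<tau>_def mult_ac power_inverse)

lemma dens_I_mset: "mset as = mset bs \<Longrightarrow> dens_I S as = dens_I S bs"
  by (intro ext) (simp add: dens_I_def \<tau>_def prod_list_mset[of as bs])

lemma int_I_mset: "mset as = mset bs \<Longrightarrow> int_I S as = int_I S bs"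
  by (simp add: int_I_def dens_I_mset[of as bs])

lemma dens_I_cong: "(\<And>i. i \<in> S \<Longrightarrow> x i = y i) \<Longrightarrow> dens_I S as x = dens_I S as y"
  by (auto simp: dens_I_def intro!: arg_cong2[of _ _ _ _ "(*)"] pprod_cong prod.cong)

lemma dens_I_remove:
  assumes "finite S" "i \<in> S"
  shows "dens_I S as x = \<tau> as (x i) * (\<Prod>j\<in>S - {i}. \<sigma> (x i) (x j)) * dens_I (S - {i}) as x"
  unfolding dens_I_def using assms
  by (subst pprod_remove[of S i]) (auto simp: \<sigma>_sym prod.remove[of S i])

lemma bdd_meas_inverse_qp_coord:
  assumes "norm a < 1"
  shows "i \<in> S \<Longrightarrow> bdd_meas (torus S) (\<lambda>x. inverse (qp (a * x i)))"
    "i \<in> S \<Longrightarrow> bdd_meas (torus S) (\<lambda>x. inverse (qp (a * inverse (x i))))"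
  by (rule bdd_meas_inverse_qp[where r = "norm a"], auto intro!: bdd_meas_intros simp: norm_mult norm_inverse norm_coord assms)+

lemma bdd_meas_\<tau>:
  assumes "i \<in> S" "\<And>a. a \<in> set as \<Longrightarrow> norm a < 1"
  shows "bdd_meas (torus S) (\<lambda>x. \<tau> as (x i))"
proof -
  have "bdd_meas (torus S) (\<lambda>x. \<Prod>a\<leftarrow>as. inverse (qp (a * x i)) * inverse (qp (a * inverse (x i))))"
    by (intro bdd_meas_prod_list bdd_meas_mult bdd_meas_inverse_qp_coord assms)
  hence "bdd_meas (torus S) (\<lambda>x. inverse (\<Prod>a\<leftarrow>as. qp (a * x i) * qp (a * inverse (x i))))"
    by (simp add: prod_list_inverse)
  moreover have "bdd_meas (torus S) (\<lambda>x. qp ((x i)\<^sup>2) * qp (inverse ((x i)\<^sup>2)))"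
    unfolding power_inverse[symmetric] by (intro bdd_meas_intros assms)
  ultimately show ?thesis
    unfolding \<tau>_def by (rule bdd_meas_mult[rotated])
qed

lemma bdd_meas_\<sigma> [bdd_meas_intros]: "i \<in> S \<Longrightarrow> j \<in> S \<Longrightarrow> bdd_meas (torus S) (\<lambda>x. \<sigma> (x i) (x j))"
  unfolding \<sigma>_def by (intro bdd_meas_intros)

lemma bdd_meas_dens_I:
  assumes "\<And>a. a \<in> set as \<Longrightarrow> norm a < 1" "T \<subseteq> S"
  shows "bdd_meas (torus S) (dens_I T as)"
proof -
  have "bdd_meas (torus S) (\<lambda>x. pprod T \<sigma> x * (\<Prod>i\<in>T. \<tau> as (x i)))"
    by (intro bdd_meas_mult bdd_meas_pprod bdd_meas_\<sigma> bdd_meas_prod bdd_meas_\<tau>) (use assms in auto)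
  thus ?thesis by (simp add: dens_I_def[abs_def])
qed

text \<open>The function whose \<open>q\<close>-difference integrates to zero.\<close>

definition shift_kernel :: "complex list \<Rightarrow> (nat \<Rightarrow> complex) \<Rightarrow> nat set \<Rightarrow> complex \<Rightarrow> complex" where
  "shift_kernel as X T z = z * qp (z\<^sup>2) * qp (q * inverse (z\<^sup>2)) *
     (\<Prod>j\<in>T. qp (z * X j) * qp (z * inverse (X j)) * qp (q * inverse z * X j) * qp (q * inverse z * inverse (X j))) *
     inverse (\<Prod>a\<leftarrow>as. qp (a * z) * qp (q * a * inverse z))"

text \<open>The map \<open>w \<mapsto> q / w\<close> permutes the factors containing
  \<open>X\<close> and those containing the parameters. The remaining part is \<open>w\<close> times
  a theta function of \<open>w\<^sup>2\<close>, and it changes sign. So the sum of the kernel over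
  \<open>z\<close> and \<open>inverse z\<close> is a \<open>q\<close>-difference.\<close>

lemma shift_kernel_shift:
  assumes "norm z = 1"
  shows "shift_kernel as X T (q * z) = - shift_kernel as X T (inverse z)"
proof -
  have z: "z \<noteq> 0" using assms by auto
  have nz: "1 - q * z\<^sup>2 \<noteq> 0"
  proof
    assume "1 - q * z\<^sup>2 = 0"
    hence "norm (q * z\<^sup>2) = 1" by simp
    thus False using assms q1 by (simp add: norm_mult norm_power)
  qed
  have 1: "qp (q * z\<^sup>2) = (1 - q * z\<^sup>2) * qp ((q * z)\<^sup>2)"
    by (subst qp_Suc) (simp add: power2_eq_square mult_ac)
  have 2: "qp (q * inverse ((q * z)\<^sup>2)) = (1 - q * inverse ((q * z)\<^sup>2)) * qp ((inverse z)\<^sup>2)"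
    by (subst qp_Suc) (simp add: power2_eq_square field_simps)
  have 3: "q * z * (1 - q * inverse ((q * z)\<^sup>2)) = - (inverse z * (1 - q * z\<^sup>2))"
    using z by (simp add: field_simps power2_eq_square)
  have "q * z * qp ((q * z)\<^sup>2) * qp (q * inverse ((q * z)\<^sup>2)) =
        (q * z * (1 - q * inverse ((q * z)\<^sup>2))) * qp ((q * z)\<^sup>2) * qp ((inverse z)\<^sup>2)"
    unfolding 2 by (simp add: mult_ac)
  also have "\<dots> = - (inverse z * qp ((inverse z)\<^sup>2) * qp (q * z\<^sup>2))"
    unfolding 3 1 by (simp add: mult_ac)
  finally have A: "q * z * qp ((q * z)\<^sup>2) * qp (q * inverse ((q * z)\<^sup>2)) = - (inverse z * qp ((inverse z)\<^sup>2) * qp (q * inverse ((inverse z)\<^sup>2)))"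
    by (simp add: power_inverse)
  have qq: "q * (inverse q * w) = w" for w by (simp add: field_simps)
  have B: "qp (q * z * X j) * qp (q * z * inverse (X j)) * qp (q * inverse (q * z) * X j) * qp (q * inverse (q * z) * inverse (X j)) =
        qp (inverse z * X j) * qp (inverse z * inverse (X j)) * qp (q * inverse (inverse z) * X j) * qp (q * inverse (inverse z) * inverse (X j))" for j
    by (simp add: mult_ac qq)
  have C: "qp (a * (q * z)) * qp (q * a * inverse (q * z)) = qp (a * inverse z) * qp (q * a * inverse (inverse z))" for a
    by (simp add: mult_ac qq)
  show ?thesis
    unfolding shift_kernel_def A B C by simp
qed

lemma shift_kernel_holomorphic:
  assumes "\<And>a. a \<in> set as \<Longrightarrow> norm a < 1"
  shows "shift_kernel as X T holomorphic_on {z. z \<noteq> 0 \<and> (\<forall>a\<in>set as. norm (a * z) < 1 \<and> norm (q * a) < norm z)}"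
proof -
  have "qp (a * z) \<noteq> 0" "qp (q * a * inverse z) \<noteq> 0" if "norm (a * z) < 1" "norm (q * a) < norm z" "z \<noteq> 0" for a z
  proof -
    show "qp (a * z) \<noteq> 0" using that by (intro qp_nonzero)
    have "norm (q * a * inverse z) = norm (q * a) / norm z"
      by (simp add: norm_mult norm_inverse divide_inverse)
    thus "qp (q * a * inverse z) \<noteq> 0" using that by (intro qp_nonzero) simp
  qed
  thus ?thesis
    unfolding shift_kernel_def
    by (auto intro!: holomorphic_intros holomorphic_on_prod_list prod_list_nonzero)
qed

text \<open>The zeros of the denominator have norm greater than 1 or less than
  \<open>norm q\<close>, so the kernel is holomorphic on the annulus between the circles of radius
  \<open>norm q\<close> and 1, and the two parts of its \<open>q\<close>-difference have equal
  averages.\<close>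

lemma shift_kernel_integral:
  assumes "\<And>a. a \<in> set as \<Longrightarrow> norm a < 1"
  shows "(\<integral>z. shift_kernel as X T z + shift_kernel as X T (inverse z) \<partial>circ) = 0"
proof -
  let ?A = "{z. z \<noteq> 0 \<and> (\<forall>a\<in>set as. norm (a * z) < 1 \<and> norm (q * a) < norm z)}"
  note hol = shift_kernel_holomorphic[OF assms, of as X T]
  have "open (\<Inter>a\<in>set as. {z. norm (a * z) < 1} \<inter> {z. norm (q * a) < norm z})"
    by (intro open_INT ballI open_Int open_Collect_less continuous_intros finite_set)
  hence "open ((\<Inter>a\<in>set as. {z. norm (a * z) < 1} \<inter> {z. norm (q * a) < norm z}) \<inter> - {0})"
    by (intro open_Int) auto
  also have "(\<Inter>a\<in>set as. {z. norm (a * z) < 1} \<inter> {z. norm (q * a) < norm z}) \<inter> - {0} = ?A"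
    by auto
  finally have opn: "open ?A" .
  have mem: "z \<in> ?A" if "norm q \<le> norm z" "norm z \<le> 1" for z
  proof -
    have "norm (a * z) < 1 \<and> norm (q * a) < norm z" if a: "a \<in> set as" for a
    proof
      show "norm (a * z) < 1"
        using assms[OF a] \<open>norm z \<le> 1\<close> mult_left_le[of "norm z" "norm a"] by (simp add: norm_mult)
      have "norm (q * a) < norm q * 1"
        unfolding norm_mult using assms[OF a] q0 by (intro mult_strict_left_mono) auto
      thus "norm (q * a) < norm z" using that \<open>norm q \<le> norm z\<close> by simp
    qed
    thus ?thesis using that q0 by auto
  qed
  have cont: "continuous_on (sphere 0 1) (\<lambda>z. shift_kernel as X T (c * z))" if "norm q \<le> norm c" "norm c \<le> 1" for c
    by (rule continuous_on_compose2[OF holomorphic_on_imp_continuous_on[OF hol]])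
       (use that mem in \<open>auto intro!: continuous_intros simp: norm_mult\<close>)
  have m: "shift_kernel as X T \<in> borel_measurable circ" "(\<lambda>z. shift_kernel as X T (q * z)) \<in> borel_measurable circ"
    using cont[of 1] cont[of q] q1 by (auto intro!: measurable_circ_continuous)
  have bdd_measI': "bdd_meas circ f" if "continuous_on (sphere 0 1) f" for f
  proof -
    have "bounded (f ` sphere 0 1)"
      by (intro compact_imp_bounded compact_continuous_image that compact_sphere)
    thus ?thesis
      using measurable_circ_continuous[OF that] unfolding bdd_meas_def bounded_iff by auto
  qed
  have "(\<integral>z. shift_kernel as X T z + shift_kernel as X T (inverse z) \<partial>circ) = (\<integral>z. shift_kernel as X T z - shift_kernel as X T (q * z) \<partial>circ)"
    by (intro Bochner_Integration.integral_cong refl) (auto simp: shift_kernel_shift)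
  also have "\<dots> = (\<integral>z. shift_kernel as X T z \<partial>circ) - (\<integral>z. shift_kernel as X T (q * z) \<partial>circ)"
    by (intro Bochner_Integration.integral_diff bdd_meas_integrable prob_space_circ bdd_measI') (use cont[of 1] cont[of q] q1 in auto)
  also have "(\<integral>z. shift_kernel as X T (q * z) \<partial>circ) = (\<integral>z. shift_kernel as X T z \<partial>circ)"
    by (rule integral_circ_shift[OF hol opn]) (use mem q1 m in auto)
  finally show ?thesis by simp
qed

text \<open>The quotient of the densities with the parameter \<open>q * a\<close> and with the
  parameter \<open>a\<close>, see \<open>dens_I_q_shift\<close>.\<close>

definition shift_prod :: "complex \<Rightarrow> nat set \<Rightarrow> (nat \<Rightarrow> complex) \<Rightarrow> complex" where
  "shift_prod a S x = (\<Prod>j\<in>S. (1 - a * x j) * (1 - a * inverse (x j)))"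

text \<open>Up to the factor \<open>- a\<close>, the summand at the node \<open>z\<close> in the
  interpolation with the extra nodes 0 and \<open>inverse a\<close>.\<close>

definition residue_term :: "complex \<Rightarrow> complex list \<Rightarrow> (nat \<Rightarrow> complex) \<Rightarrow> nat set \<Rightarrow> complex \<Rightarrow> complex" where
  "residue_term a as X T z = (\<Prod>b\<leftarrow>as. z - b) / ((1 - a * z) * (z\<^sup>2 - 1) * (\<Prod>j\<in>T. (z - X j) * (z - inverse (X j))))"

text \<open>Each linear factor shifts one \<open>q\<close>-factorial: \<open>z - b\<close> turns
  \<open>qp (b / z)\<close> into \<open>qp (q * b / z)\<close> in the denominator, and division by
  \<open>z - X\<close> does the same in the numerator. The length of \<open>as\<close> makes the
  powers of \<open>z\<close> balance: \<open>2 * card T\<close> of them belong to the pairs and two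
  to \<open>z\<^sup>2 - 1\<close>, which leaves the single \<open>z\<close> of the kernel.\<close>

lemma residue_term_hh:
  assumes z: "norm z = 1" "z\<^sup>2 \<noteq> 1" and a: "norm a < 1" "\<And>b. b \<in> set as \<Longrightarrow> norm b < 1"
    and X: "\<And>j. j \<in> T \<Longrightarrow> norm (X j) = 1 \<and> z \<noteq> X j \<and> z * X j \<noteq> 1" and len: "length as = 2 * card T + 3"
  shows "\<tau> (a # as) z * (\<Prod>j\<in>T. \<sigma> z (X j)) * ((1 - a * z) * (1 - a * inverse z)) * residue_term a as X T z = shift_kernel (a # as) X T z"
proof -
  have z0: "z \<noteq> 0" using z by auto
  have nz1: "1 - b * w \<noteq> 0" if "norm b < 1" "norm w = 1" for b w :: complex
  proof
    assume "1 - b * w = 0"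
    hence "norm (b * w) = 1" by simp
    thus False using that by (simp add: norm_mult)
  qed
  have nzi: "norm (inverse z) = 1" using z by (simp add: norm_inverse)
  have A: "(\<Prod>b\<leftarrow>xs. z - b) = z ^ length xs * (\<Prod>b\<leftarrow>xs. 1 - b * inverse z)" for xs
    using z0 by (induction xs) (auto simp: field_simps)
  have B: "inverse (\<Prod>b\<leftarrow>xs. qp (b * z) * qp (b * inverse z)) * (\<Prod>b\<leftarrow>xs. 1 - b * inverse z) =
      inverse (\<Prod>b\<leftarrow>xs. qp (b * z) * qp (q * b * inverse z))" if "\<And>b. b \<in> set xs \<Longrightarrow> norm b < 1" for xs
    using that
  proof (induction xs)
    case (Cons b xs)
    have "qp (b * inverse z) = (1 - b * inverse z) * qp (q * b * inverse z)"
      by (subst qp_Suc) (simp add: mult_ac)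
    moreover have "1 - b * inverse z \<noteq> 0" using Cons.prems nzi by (intro nz1) auto
    ultimately have E': "inverse (qp (b * inverse z)) * (1 - b * inverse z) = inverse (qp (q * b * inverse z))"
      by simp
    define R R' P where "R = (\<Prod>b\<leftarrow>xs. qp (b * z) * qp (b * inverse z))"
      and "R' = (\<Prod>b\<leftarrow>xs. qp (b * z) * qp (q * b * inverse z))" and "P = (\<Prod>b\<leftarrow>xs. 1 - b * inverse z)"
    have IH: "inverse R * P = inverse R'"
      unfolding R_def R'_def P_def by (rule Cons.IH) (use Cons.prems in auto)
    have "inverse (qp (b * z) * qp (b * inverse z) * R) * ((1 - b * inverse z) * P) =
        inverse (qp (b * z)) * (inverse (qp (b * inverse z)) * (1 - b * inverse z)) * (inverse R * P)"
      unfolding inverse_mult_distrib by (simp only: mult_ac)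
    also have "\<dots> = inverse (qp (b * z) * qp (q * b * inverse z) * R')"
      unfolding E' IH inverse_mult_distrib by (simp only: mult_ac)
    finally show ?case unfolding R_def R'_def P_def list.map prod_list.Cons .
  qed auto
  have C: "(\<Prod>j\<in>T. \<sigma> z (X j)) / (\<Prod>j\<in>T. (z - X j) * (z - inverse (X j))) =
      (\<Prod>j\<in>T. qp (z * X j) * qp (z * inverse (X j)) * qp (q * inverse z * X j) * qp (q * inverse z * inverse (X j))) / z ^ (2 * card T)"
  proof -
    have "\<sigma> z (X j) / ((z - X j) * (z - inverse (X j))) =
      (qp (z * X j) * qp (z * inverse (X j)) * qp (q * inverse z * X j) * qp (q * inverse z * inverse (X j))) / z\<^sup>2" if j: "j \<in> T" for j
    proof -
      have Xj: "X j \<noteq> 0" using X[OF j] by auto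
      have "z - X j \<noteq> 0" using X[OF j] by auto
      moreover have "z - inverse (X j) \<noteq> 0" using X[OF j] Xj by (auto simp: field_simps)
      moreover have "qp (inverse z * X j) = (z - X j) * inverse z * qp (q * inverse z * X j)"
        by (subst qp_Suc) (use z0 in \<open>simp add: field_simps\<close>)
      moreover have "qp (inverse z * inverse (X j)) = (z - inverse (X j)) * inverse z * qp (q * inverse z * inverse (X j))"
        by (subst qp_Suc) (use z0 in \<open>simp add: field_simps\<close>)
      ultimately show ?thesis
        unfolding \<sigma>_def by (simp add: power2_eq_square divide_inverse mult_ac)
    qed
    hence "(\<Prod>j\<in>T. \<sigma> z (X j) / ((z - X j) * (z - inverse (X j)))) = (\<Prod>j\<in>T. (qp (z * X j) * qp (z * inverse (X j)) * qp (q * inverse z * X j) * qp (q * inverse z * inverse (X j))) / z\<^sup>2)"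
      by (intro prod.cong refl)
    thus ?thesis by (simp add: prod_dividef power_mult)
  qed
  have D: "qp (inverse (z\<^sup>2)) = (z\<^sup>2 - 1) * inverse (z\<^sup>2) * qp (q * inverse (z\<^sup>2))"
    by (subst qp_Suc) (use z0 in \<open>simp add: field_simps\<close>)
  have E: "inverse (qp (a * inverse z)) * (1 - a * inverse z) = inverse (qp (q * a * inverse z))"
  proof -
    have "qp (a * inverse z) = (1 - a * inverse z) * qp (q * a * inverse z)"
      by (subst qp_Suc) (simp add: mult_ac)
    moreover have "1 - a * inverse z \<noteq> 0" using a nzi by (intro nz1) auto
    ultimately show ?thesis by simp
  qed
  define R where "R = (\<Prod>j\<in>T. \<sigma> z (X j)) / (\<Prod>j\<in>T. (z - X j) * (z - inverse (X j)))"
  define Q where "Q = inverse (\<Prod>b\<leftarrow>as. qp (b * z) * qp (b * inverse z)) * (\<Prod>b\<leftarrow>as. 1 - b * inverse z)"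
  have "\<tau> (a # as) z * (\<Prod>j\<in>T. \<sigma> z (X j)) * ((1 - a * z) * (1 - a * inverse z)) * residue_term a as X T z =
      qp (z\<^sup>2) * (qp (inverse (z\<^sup>2)) / (z\<^sup>2 - 1)) * inverse (qp (a * z)) * (inverse (qp (a * inverse z)) * (1 - a * inverse z)) *
      ((1 - a * z) / (1 - a * z)) * R * Q * z ^ length as"
    unfolding \<tau>_def residue_term_def A R_def Q_def by (simp add: divide_inverse mult_ac)
  also have "(1 - a * z) / (1 - a * z) = 1" using nz1[OF a(1) z(1)] by simp
  also have "qp (inverse (z\<^sup>2)) / (z\<^sup>2 - 1) = inverse (z\<^sup>2) * qp (q * inverse (z\<^sup>2))"
    unfolding D using z(2) by simp
  also have "R = (\<Prod>j\<in>T. qp (z * X j) * qp (z * inverse (X j)) * qp (q * inverse z * X j) * qp (q * inverse z * inverse (X j))) / z ^ (2 * card T)"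
    unfolding R_def by (rule C)
  also have "Q = inverse (\<Prod>b\<leftarrow>as. qp (b * z) * qp (q * b * inverse z))"
    unfolding Q_def by (rule B) (use a in auto)
  also note E
  also have "z ^ length as = z * z\<^sup>2 * z ^ (2 * card T)"
    unfolding len by (simp add: power_add power3_eq_cube power2_eq_square)
  finally show ?thesis
    using z0 unfolding shift_kernel_def by (simp add: divide_inverse mult_ac)
qed


text \<open>The node 0 contributes \<open>a * prod_list as\<close> and the node
  \<open>inverse a\<close> contributes the product of all \<open>1 - a * b\<close>, the latter
  divided by \<open>shift_prod a S x\<close>. The other nodes give the terms that are going to
  integrate to zero.\<close>

lemma partial_fraction_typeI:
  assumes g: "torus_generic S x" "unimodular S x" and S: "finite S"
    and a: "norm a < 1" "a \<noteq> 0" and len: "length as = 2 * card S + 1"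
  shows "(1 - a * prod_list as) * shift_prod a S x - (\<Prod>b\<leftarrow>as. 1 - a * b) =
         shift_prod a S x * (\<Sum>i\<in>S. - a * (residue_term a as x (S - {i}) (x i) + residue_term a as x (S - {i}) (inverse (x i))))"
proof -
  let ?Z = "{0, inverse a}"
  have ne: "inverse a \<noteq> 0" using a by auto
  have nia: "norm (inverse a) > 1"
    using a by (simp add: norm_inverse one_less_inverse_iff)
  have nz: "x j \<noteq> 0" if "j \<in> S" for j using unimodular_nz[OF g(2) that] .
  define t where "t i z = (\<Prod>c\<leftarrow>as. z - c) / ((\<Prod>s\<in>?Z. z - s) * (z - inverse z) * (\<Prod>j\<in>S - {i}. (z - x j) * (z - inverse (x j))))" for i z
  define F where "F z = (\<Prod>c\<leftarrow>as. z - c) / ((\<Prod>s\<in>?Z - {z}. z - s) * (\<Prod>j\<in>S. (z - x j) * (z - inverse (x j))))" for z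
  have L: "(\<Sum>z\<in>?Z. F z) + (\<Sum>i\<in>S. t i (x i) + t i (inverse (x i))) = 1"
    unfolding F_def t_def
    by (rule lagrange_torus[OF g S]) (use ne nia len in \<open>auto simp: card_insert_if\<close>)
  have T: "(\<Prod>c\<leftarrow>as. z - c) / ((\<Prod>s\<in>?Z. z - s) * (z - inverse z) * P) = - a * ((\<Prod>b\<leftarrow>as. z - b) / ((1 - a * z) * (z\<^sup>2 - 1) * P))"
    if "z \<noteq> 0" for z P
  proof -
    have "(\<Prod>s\<in>?Z. z - s) * (z - inverse z) = (z - inverse a) * (z\<^sup>2 - 1)"
      using ne that by (simp add: field_simps power2_eq_square)
    also have "\<dots> = - inverse a * ((1 - a * z) * (z\<^sup>2 - 1))"
      using a by (simp add: field_simps)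
    finally have *: "(\<Prod>s\<in>?Z. z - s) * (z - inverse z) = - inverse a * ((1 - a * z) * (z\<^sup>2 - 1))" .
    show ?thesis unfolding * using a by (simp add: divide_inverse mult_ac)
  qed
  have T1: "t i z = - a * residue_term a as x (S - {i}) z" if "z \<noteq> 0" for i z
    unfolding residue_term_def t_def by (rule T[OF that])
  have A: "(\<Prod>c\<leftarrow>xs. inverse a - c) = inverse a ^ length xs * (\<Prod>b\<leftarrow>xs. 1 - a * b)" for xs
    using a by (induction xs) (simp_all add: field_simps)
  have A0: "(\<Prod>c\<leftarrow>xs. 0 - c) = (-1) ^ length xs * prod_list xs" for xs :: "complex list"
    by (induction xs) simp_all
  have B: "(\<Prod>j\<in>S. (inverse a - x j) * (inverse a - inverse (x j))) = inverse a ^ (2 * card S) * shift_prod a S x"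
  proof -
    have "(inverse a - x j) * (inverse a - inverse (x j)) = inverse a ^ 2 * ((1 - a * x j) * (1 - a * inverse (x j)))" for j
      using a by (simp add: field_simps power2_eq_square)
    thus ?thesis by (simp add: shift_prod_def prod.distrib power_mult)
  qed
  have B0: "(\<Prod>j\<in>S. (0 - x j) * (0 - inverse (x j))) = 1"
    by (rule prod.neutral) (use nz in auto)
  have PPnz: "shift_prod a S x \<noteq> 0"
  proof -
    have "1 - a * w \<noteq> 0" if "norm w = 1" for w
    proof
      assume "1 - a * w = 0"
      hence "norm (a * w) = 1" by simp
      thus False using that a by (simp add: norm_mult)
    qed
    thus ?thesis using g(2) S by (auto simp: shift_prod_def unimodular_def norm_inverse)
  qed
  have Z1: "?Z - {0} = {inverse a}" "?Z - {inverse a} = {0}" using ne by auto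
  have "F 0 = a * prod_list as"
    unfolding F_def Z1 B0 A0 len using a by (simp add: divide_inverse)
  moreover have "F (inverse a) = (\<Prod>b\<leftarrow>as. 1 - a * b) / shift_prod a S x"
    unfolding F_def Z1 B A len using a by (simp add: power_add)
  moreover have "(\<Sum>z\<in>?Z. F z) = F 0 + F (inverse a)"
    using ne by simp
  moreover have "(\<Sum>i\<in>S. t i (x i) + t i (inverse (x i))) = (\<Sum>i\<in>S. - a * (residue_term a as x (S - {i}) (x i) + residue_term a as x (S - {i}) (inverse (x i))))"
    by (intro sum.cong refl) (use nz in \<open>simp add: T1 distrib_left\<close>)
  ultimately have "a * prod_list as + (\<Prod>b\<leftarrow>as. 1 - a * b) / shift_prod a S x +
      (\<Sum>i\<in>S. - a * (residue_term a as x (S - {i}) (x i) + residue_term a as x (S - {i}) (inverse (x i)))) = 1"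
    using L by (simp only:)
  hence "(\<Sum>i\<in>S. - a * (residue_term a as x (S - {i}) (x i) + residue_term a as x (S - {i}) (inverse (x i)))) = 1 - a * prod_list as - (\<Prod>b\<leftarrow>as. 1 - a * b) / shift_prod a S x"
    by (simp add: algebra_simps)
  thus ?thesis using PPnz by (simp add: right_diff_distrib mult_ac)
qed

lemma dens_I_q_shift:
  assumes "norm a < 1" "unimodular S x"
  shows "dens_I S (a # as) x * shift_prod a S x = dens_I S (q * a # as) x"
proof -
  have "\<tau> (a # as) u * ((1 - a * u) * (1 - a * inverse u)) = \<tau> (q * a # as) u" if u: "norm u = 1" for u
  proof -
    have nz: "1 - a * w \<noteq> 0" if "norm w = 1" for w
    proof
      assume "1 - a * w = 0"
      hence "norm (a * w) = 1" by simp
      thus False using that assms by (simp add: norm_mult)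
    qed
    have "inverse (qp (a * w)) * (1 - a * w) = inverse (qp (q * a * w))" if "norm w = 1" for w
      by (subst qp_Suc) (use nz[OF that] in \<open>simp add: mult_ac\<close>)
    from this[of u] this[of "inverse u"] u have
      "inverse (qp (a * u)) * (1 - a * u) = inverse (qp (q * a * u))"
      "inverse (qp (a * inverse u)) * (1 - a * inverse u) = inverse (qp (q * a * inverse u))"
      by (simp_all add: norm_inverse)
    note e = this[symmetric]
    have "\<tau> (q * a # as) u = qp (u\<^sup>2) * qp (inverse (u\<^sup>2)) * (inverse (qp (q * a * u)) * inverse (qp (q * a * inverse u)) *
       inverse (\<Prod>b\<leftarrow>as. qp (b * u) * qp (b * inverse u)))"
      unfolding \<tau>_def by simp
    also have "\<dots> = \<tau> (a # as) u * ((1 - a * u) * (1 - a * inverse u))"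
      unfolding e unfolding \<tau>_def by (simp add: mult_ac)
    finally show ?thesis by simp
  qed
  hence "(\<Prod>i\<in>S. \<tau> (a # as) (x i) * ((1 - a * x i) * (1 - a * inverse (x i)))) = (\<Prod>i\<in>S. \<tau> (q * a # as) (x i))"
    using assms(2) by (intro prod.cong refl) (auto simp: unimodular_def)
  thus ?thesis by (simp add: dens_I_def shift_prod_def prod.distrib mult_ac)
qed

text \<open>Only the factors of the density that contain \<open>x i\<close> take part;
  \<open>residue_term_hh\<close> turns them into the kernel, once for \<open>x i\<close> and once
  for its inverse.\<close>

lemma dens_I_term_eq:
  assumes g: "torus_generic S x" "unimodular S x" and S: "finite S" and i: "i \<in> S"
    and a: "norm a < 1" "\<And>b. b \<in> set as \<Longrightarrow> norm b < 1" and len: "length as = 2 * card S + 1"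
  shows "dens_I S (a # as) x * shift_prod a S x * (residue_term a as x (S - {i}) (x i) + residue_term a as x (S - {i}) (inverse (x i))) =
     dens_I (S - {i}) (a # as) x * shift_prod a (S - {i}) x * (shift_kernel (a # as) x (S - {i}) (x i) + shift_kernel (a # as) x (S - {i}) (inverse (x i)))"
proof -
  have PPi: "shift_prod a S x = ((1 - a * x i) * (1 - a * inverse (x i))) * shift_prod a (S - {i}) x"
    unfolding shift_prod_def using S i by (simp add: prod.remove)
  have x0: "x j \<noteq> 0" "norm (x j) = 1" if "j \<in> S" for j
    using unimodular_nz[OF g(2) that] g(2) that by (auto simp: unimodular_def)
  have card: "2 * card (S - {i}) + 3 = 2 * card S + 1"
    using card.remove[OF S i] by simp
  have sq: "(x i)\<^sup>2 \<noteq> 1" "(inverse (x i))\<^sup>2 \<noteq> 1"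
    using g(1) i by (auto simp: torus_generic_def power_inverse)
  have X: "norm (x j) = 1 \<and> x i \<noteq> x j \<and> x i * x j \<noteq> 1" "norm (x j) = 1 \<and> inverse (x i) \<noteq> x j \<and> inverse (x i) * x j \<noteq> 1"
    if j: "j \<in> S - {i}" for j
  proof -
    have jS: "j \<in> S" using j by auto
    have ne: "x i \<noteq> x j" "x i * x j \<noteq> 1" using g(1) i j by (auto simp: torus_generic_def)
    have "inverse (x i) = x j \<longleftrightarrow> x i * x j = 1" "inverse (x i) * x j = 1 \<longleftrightarrow> x i = x j"
      using x0(1)[OF i] by (auto simp: field_simps)
    thus "norm (x j) = 1 \<and> x i \<noteq> x j \<and> x i * x j \<noteq> 1" "norm (x j) = 1 \<and> inverse (x i) \<noteq> x j \<and> inverse (x i) * x j \<noteq> 1"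
      using ne x0(2)[OF jS] by blast+
  qed
  define tu G u v D P t1 t2 where "tu = \<tau> (a # as) (x i)" and "G = (\<Prod>j\<in>S - {i}. \<sigma> (x i) (x j))"
    and "u = 1 - a * x i" and "v = 1 - a * inverse (x i)" and "D = dens_I (S - {i}) (a # as) x" and "P = shift_prod a (S - {i}) x"
    and "t1 = residue_term a as x (S - {i}) (x i)" and "t2 = residue_term a as x (S - {i}) (inverse (x i))"
  note defs = tu_def G_def u_def v_def D_def P_def t1_def t2_def
  have "\<tau> (a # as) (x i) * (\<Prod>j\<in>S - {i}. \<sigma> (x i) (x j)) * ((1 - a * x i) * (1 - a * inverse (x i))) * residue_term a as x (S - {i}) (x i) = shift_kernel (a # as) x (S - {i}) (x i)"
    by (rule residue_term_hh) (use x0[OF i] sq a X len card in auto)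
  moreover have "\<tau> (a # as) (inverse (x i)) * (\<Prod>j\<in>S - {i}. \<sigma> (inverse (x i)) (x j)) *
      ((1 - a * inverse (x i)) * (1 - a * inverse (inverse (x i)))) * residue_term a as x (S - {i}) (inverse (x i)) = shift_kernel (a # as) x (S - {i}) (inverse (x i))"
    by (rule residue_term_hh) (use x0[OF i] sq a X len card in \<open>auto simp: norm_inverse\<close>)
  ultimately have h: "tu * G * (u * v) * t1 = shift_kernel (a # as) x (S - {i}) (x i)" "tu * G * (v * u) * t2 = shift_kernel (a # as) x (S - {i}) (inverse (x i))"
    unfolding \<tau>_inverse \<sigma>_inverse inverse_inverse_eq defs by blast+
  show ?thesis
    unfolding dens_I_remove[OF S i, of "a # as" x] PPi h[symmetric] defs[symmetric] by (simp only: distrib_left mult_ac)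
qed

lemma dens_I_term_integral:
  assumes S: "finite S" and i: "i \<in> S"
    and a: "norm a < 1" "\<And>b. b \<in> set as \<Longrightarrow> norm b < 1"
  shows "(\<integral>x. dens_I (S - {i}) (a # as) x * shift_prod a (S - {i}) x * (shift_kernel (a # as) x (S - {i}) (x i) + shift_kernel (a # as) x (S - {i}) (inverse (x i))) \<partial>torus S) = 0"
    and "bdd_meas (torus S) (\<lambda>x. dens_I (S - {i}) (a # as) x * shift_prod a (S - {i}) x * (shift_kernel (a # as) x (S - {i}) (x i) + shift_kernel (a # as) x (S - {i}) (inverse (x i))))"
proof -
  let ?f = "\<lambda>x. dens_I (S - {i}) (a # as) x * shift_prod a (S - {i}) x * (shift_kernel (a # as) x (S - {i}) (x i) + shift_kernel (a # as) x (S - {i}) (inverse (x i)))"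
  have aq: "norm (q * b) < 1" if "norm b < 1" for b
    using that q1 mult_strict_mono'[of "norm q" 1 "norm b" 1] by (simp add: norm_mult)
  have inv1: "bdd_meas (torus S) (\<lambda>x. inverse (\<Prod>b\<leftarrow>a # as. qp (b * x i) * qp (q * b * inverse (x i))))"
    unfolding prod_list_inverse inverse_mult_distrib
    by (intro bdd_meas_prod_list bdd_meas_mult bdd_meas_inverse_qp_coord) (use a aq i in auto)
  have inv2: "bdd_meas (torus S) (\<lambda>x. inverse (\<Prod>b\<leftarrow>a # as. qp (b * inverse (x i)) * qp (q * b * inverse (inverse (x i)))))"
    unfolding prod_list_inverse inverse_mult_distrib inverse_inverse_eq
    by (intro bdd_meas_prod_list bdd_meas_mult bdd_meas_inverse_qp_coord) (use a aq i in auto)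
  have "bdd_meas (torus S) (dens_I (S - {i}) (a # as))"
    by (rule bdd_meas_dens_I) (use a in auto)
  thus f: "bdd_meas (torus S) ?f"
    unfolding shift_kernel_def shift_prod_def power_inverse[symmetric] inverse_inverse_eq
    by (intro bdd_meas_mult bdd_meas_add bdd_meas_prod bdd_meas_qp inv1 inv2[unfolded inverse_inverse_eq] bdd_meas_intros) (use i in auto)
  have SS: "S = insert i (S - {i})" using i by auto
  have "(\<integral>x. ?f x \<partial>torus (insert i (S - {i}))) = (\<integral>x. (\<integral>z. ?f (x(i := z)) \<partial>circ) \<partial>torus (S - {i}))"
    by (rule torus_integral_insert) (use S f SS in auto)
  also have "\<dots> = (\<integral>x. 0 \<partial>torus (S - {i}))"
  \<comment> \<open>Everything in front of the kernels is free of \<open>x i\<close>, hence constant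
    in the inner integral.\<close>
  proof (rule Bochner_Integration.integral_cong[OF refl])
    fix x :: "nat \<Rightarrow> complex"
    have 1: "dens_I (S - {i}) (a # as) (x(i := z)) = dens_I (S - {i}) (a # as) x" for z by (rule dens_I_cong) auto
    have 2: "shift_prod a (S - {i}) (x(i := z)) = shift_prod a (S - {i}) x" for z unfolding shift_prod_def by (rule prod.cong) auto
    have 3: "shift_kernel (a # as) (x(i := z)) (S - {i}) = shift_kernel (a # as) x (S - {i})" for z
      unfolding shift_kernel_def by (intro ext arg_cong2[of _ _ _ _ "(*)"] prod.cong) auto
    have "(\<integral>z. ?f (x(i := z)) \<partial>circ) =
        (\<integral>z. dens_I (S - {i}) (a # as) x * shift_prod a (S - {i}) x * (shift_kernel (a # as) x (S - {i}) z + shift_kernel (a # as) x (S - {i}) (inverse z)) \<partial>circ)"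
      unfolding 1 2 3 by simp
    also have "\<dots> = 0"
      by (subst integral_mult_right_zero) (use shift_kernel_integral[of "a # as" x "S - {i}"] a in auto)
    finally show "(\<integral>z. ?f (x(i := z)) \<partial>circ) = 0" .
  qed
  finally show "(\<integral>x. ?f x \<partial>torus S) = 0" using SS by simp
qed

text \<open>The partial fraction identity is multiplied by the density and integrated. Here
  \<open>a\<close> is nonzero because \<open>inverse a\<close> is one of the nodes.\<close>

lemma int_I_funeq:
  assumes S: "finite S" and a: "norm a < 1" "a \<noteq> 0" "\<And>b. b \<in> set as \<Longrightarrow> norm b < 1"
    and len: "length as = 2 * card S + 1"
  shows "(1 - a * prod_list as) * int_I S (q * a # as) = (\<Prod>b\<leftarrow>as. 1 - a * b) * int_I S (a # as)"
proof -
  have aq: "norm (q * a) < 1"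
    using a q1 mult_strict_mono'[of "norm q" 1 "norm a" 1] by (simp add: norm_mult)
  let ?H = "\<lambda>i x. dens_I (S - {i}) (a # as) x * shift_prod a (S - {i}) x * (shift_kernel (a # as) x (S - {i}) (x i) + shift_kernel (a # as) x (S - {i}) (inverse (x i)))"
  have bm1: "bdd_meas (torus S) (dens_I S (a # as))" "bdd_meas (torus S) (dens_I S (q * a # as))"
    by (rule bdd_meas_dens_I; use a aq in auto)+
  note int = bdd_meas_integrable[OF prob_space_torus]
  have "AE x in torus S. (1 - a * prod_list as) * dens_I S (q * a # as) x - (\<Prod>b\<leftarrow>as. 1 - a * b) * dens_I S (a # as) x = (\<Sum>i\<in>S. - a * ?H i x)"
    using AE_torus_generic[OF S] AE_space
  proof eventually_elim
    case (elim x)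
    hence u: "unimodular S x" by (intro unimodular_torus)
    have "(1 - a * prod_list as) * dens_I S (q * a # as) x - (\<Prod>b\<leftarrow>as. 1 - a * b) * dens_I S (a # as) x =
       dens_I S (a # as) x * ((1 - a * prod_list as) * shift_prod a S x - (\<Prod>b\<leftarrow>as. 1 - a * b))"
      unfolding dens_I_q_shift[OF a(1) u, symmetric] by (simp add: algebra_simps)
    also have "\<dots> = (\<Sum>i\<in>S. - a * (dens_I S (a # as) x * shift_prod a S x * (residue_term a as x (S - {i}) (x i) + residue_term a as x (S - {i}) (inverse (x i)))))"
      unfolding partial_fraction_typeI[OF elim(1) u S a(1,2) len] by (simp add: sum_distrib_left mult_ac)
    also have "\<dots> = (\<Sum>i\<in>S. - a * ?H i x)"
      by (intro sum.cong refl) (use dens_I_term_eq[OF elim(1) u S _ a(1) a(3) len] in auto)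
    finally show ?case .
  qed
  hence "(\<integral>x. (1 - a * prod_list as) * dens_I S (q * a # as) x - (\<Prod>b\<leftarrow>as. 1 - a * b) * dens_I S (a # as) x \<partial>torus S) = (\<integral>x. (\<Sum>i\<in>S. - a * ?H i x) \<partial>torus S)"
  proof (rule integral_cong_AE[rotated 2])
    show "(\<lambda>x. (1 - a * prod_list as) * dens_I S (q * a # as) x - (\<Prod>b\<leftarrow>as. 1 - a * b) * dens_I S (a # as) x) \<in> borel_measurable (torus S)"
      by (intro bdd_meas_measurable bdd_meas_diff bdd_meas_mult bdd_meas_const bm1)
    show "(\<lambda>x. \<Sum>i\<in>S. - a * ?H i x) \<in> borel_measurable (torus S)"
      by (intro bdd_meas_measurable bdd_meas_sum bdd_meas_mult[OF bdd_meas_const] dens_I_term_integral(2)[OF S _ a(1,3)])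
  qed
  also have "\<dots> = (\<Sum>i\<in>S. \<integral>x. - a * ?H i x \<partial>torus S)"
    by (rule Bochner_Integration.integral_sum) (intro int bdd_meas_mult[OF bdd_meas_const] dens_I_term_integral(2)[OF S _ a(1,3)])
  also have "\<dots> = 0"
    by (rule sum.neutral) (use dens_I_term_integral(1)[OF S _ a(1,3)] in auto)
  finally have "0 = (\<integral>x. (1 - a * prod_list as) * dens_I S (q * a # as) x - (\<Prod>b\<leftarrow>as. 1 - a * b) * dens_I S (a # as) x \<partial>torus S)" ..
  also have "\<dots> = (\<integral>x. (1 - a * prod_list as) * dens_I S (q * a # as) x \<partial>torus S) - (\<integral>x. (\<Prod>b\<leftarrow>as. 1 - a * b) * dens_I S (a # as) x \<partial>torus S)"
    by (intro Bochner_Integration.integral_diff int bdd_meas_mult bdd_meas_const bm1)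
  also have "\<dots> = (1 - a * prod_list as) * int_I S (q * a # as) - (\<Prod>b\<leftarrow>as. 1 - a * b) * int_I S (a # as)"
    unfolding int_I_def by simp
  finally show ?thesis by simp
qed

section \<open>Evaluation of the type I integral up to its value at zero parameters\<close>

lemma int_I_tendsto_0:
  assumes S: "finite S" and a: "norm a < 1" "\<And>b. b \<in> set as \<Longrightarrow> norm b < 1"
  shows "(\<lambda>N. int_I S (a * q ^ N # as)) \<longlonglongrightarrow> int_I S (0 # as)"
proof -
  obtain B where B: "\<And>z. norm z \<le> norm a \<Longrightarrow> norm (inverse (qp z)) \<le> B"
    using inverse_qp_bounded[OF a(1)] by auto
  have B0: "B \<ge> 0" using B[of 0] order_trans[OF norm_ge_zero] by auto
  have bm0: "bdd_meas (torus S) (dens_I S (c # as))" if "norm c < 1" for c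
    by (rule bdd_meas_dens_I) (use that a in auto)
  have bm1: "bdd_meas (torus S) (dens_I S as)"
    by (rule bdd_meas_dens_I) (use a in auto)
  from bm1 obtain C where C: "\<And>x. x \<in> space (torus S) \<Longrightarrow> norm (dens_I S as x) \<le> C"
    by (auto simp: bdd_meas_def)
  have split: "dens_I S (c # as) x = dens_I S as x * (\<Prod>i\<in>S. inverse (qp (c * x i)) * inverse (qp (c * inverse (x i))))" for c x
    unfolding dens_I_def by (simp add: \<tau>_def prod.distrib mult_ac)
  have nN: "norm (a * q ^ N) \<le> norm a" for N
    using q0 q1 by (simp add: norm_mult norm_power mult_left_le power_le_one)
  interpret prob_space "torus S" by (rule prob_space_torus)
  show ?thesis unfolding int_I_def
  proof (rule integral_dominated_convergence[where w = "\<lambda>_. C * (\<Prod>i\<in>S. B * B)"])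
    show "dens_I S (0 # as) \<in> borel_measurable (torus S)" by (rule bdd_meas_measurable[OF bm0]) simp
    show "dens_I S (a * q ^ N # as) \<in> borel_measurable (torus S)" for N
      by (rule bdd_meas_measurable[OF bm0]) (use nN[of N] a(1) in linarith)
    have "(\<lambda>N. a * q ^ N * w) \<longlonglongrightarrow> 0" for w
      using tendsto_mult[OF tendsto_mult[OF tendsto_const LIMSEQ_power_zero[OF q1]] tendsto_const, of a w] by simp
    hence lim: "(\<lambda>N. inverse (qp (a * q ^ N * w))) \<longlonglongrightarrow> inverse (qp (0 * w))" for w
      by (intro tendsto_inverse qp_tendsto_compose) auto
    show "AE x in torus S. (\<lambda>N. dens_I S (a * q ^ N # as) x) \<longlonglongrightarrow> dens_I S (0 # as) x"
      unfolding split by (intro always_eventually allI tendsto_mult tendsto_const tendsto_prod lim)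
    fix N
    show "AE x in torus S. norm (dens_I S (a * q ^ N # as) x) \<le> C * (\<Prod>i\<in>S. B * B)"
      using AE_space
    proof eventually_elim
      case (elim x)
      have "norm (inverse (qp (a * q ^ N * w))) \<le> B" if "norm w = 1" for w
        by (rule B) (use nN[of N] that in \<open>simp add: norm_mult\<close>)
      hence "(\<Prod>i\<in>S. norm (inverse (qp (a * q ^ N * x i)) * inverse (qp (a * q ^ N * inverse (x i))))) \<le> (\<Prod>i\<in>S. B * B)"
        unfolding norm_mult
        by (intro prod_mono conjI mult_mono mult_nonneg_nonneg norm_ge_zero B0) (auto simp: norm_coord[OF elim] norm_inverse)
      thus ?case
        unfolding split norm_mult prod_norm[symmetric]
        using C[OF elim] by (intro mult_mono) (auto intro: order_trans[OF norm_ge_zero] prod_nonneg)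
    qed
  qed auto
qed

text \<open>Iterating \<open>int_I_funeq\<close> along \<open>a * q ^ N\<close> builds up the
  \<open>q\<close>-factorials factor by factor while the parameter tends to 0. The factors stay on
  both sides as multipliers, so that a zero of \<open>1 - a * prod_list as * q ^ r\<close> does no
  harm.\<close>

lemma int_I_head:
  assumes S: "finite S" and a: "norm a < 1" "\<And>b. b \<in> set as \<Longrightarrow> norm b < 1"
    and len: "length as = 2 * card S + 1"
  shows "int_I S (a # as) * (\<Prod>b\<leftarrow>as. qp (a * b)) = qp (a * prod_list as) * int_I S (0 # as)"
proof (cases "a = 0")
  case True
  have "(\<Prod>b\<leftarrow>as. qp (0 * b)) = 1" by (induction as) auto
  thus ?thesis using True by simp
next
  case False
  have nN: "norm (a * q ^ N) < 1" for N
  proof -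
    have "norm (a * q ^ N) \<le> norm a"
      using q0 q1 by (simp add: norm_mult norm_power mult_left_le power_le_one)
    thus ?thesis using a(1) by linarith
  qed
  have step: "int_I S (a # as) * (\<Prod>b\<leftarrow>as. \<Prod>r<N. 1 - a * b * q ^ r) = (\<Prod>r<N. 1 - a * prod_list as * q ^ r) * int_I S (a * q ^ N # as)" for N
  proof (induction N)
    case 0
    have "(\<Prod>b\<leftarrow>as. 1 :: complex) = 1" by (induction as) auto
    thus ?case by simp
  next
    case (Suc N)
    have "(1 - a * q ^ N * prod_list as) * int_I S (q * (a * q ^ N) # as) = (\<Prod>b\<leftarrow>as. 1 - a * q ^ N * b) * int_I S (a * q ^ N # as)"
      by (rule int_I_funeq[OF S nN _ a(2) len]) (use False in auto)
    hence e: "(\<Prod>b\<leftarrow>as. 1 - a * b * q ^ N) * int_I S (a * q ^ N # as) = (1 - a * prod_list as * q ^ N) * int_I S (a * q ^ Suc N # as)"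
      by (simp add: mult_ac)
    have "int_I S (a # as) * (\<Prod>b\<leftarrow>as. \<Prod>r<Suc N. 1 - a * b * q ^ r) =
        (int_I S (a # as) * (\<Prod>b\<leftarrow>as. \<Prod>r<N. 1 - a * b * q ^ r)) * (\<Prod>b\<leftarrow>as. 1 - a * b * q ^ N)"
      by (simp add: prod_list_mult mult_ac)
    also have "\<dots> = (\<Prod>r<N. 1 - a * prod_list as * q ^ r) * ((\<Prod>b\<leftarrow>as. 1 - a * b * q ^ N) * int_I S (a * q ^ N # as))"
      unfolding Suc by (simp add: mult_ac)
    also have "\<dots> = (\<Prod>r<Suc N. 1 - a * prod_list as * q ^ r) * int_I S (a * q ^ Suc N # as)"
      unfolding e by (simp add: mult_ac)
    finally show ?case .
  qed
  have "(\<lambda>N. int_I S (a # as) * (\<Prod>b\<leftarrow>as. \<Prod>r<N. 1 - a * b * q ^ r)) \<longlonglongrightarrow> int_I S (a # as) * (\<Prod>b\<leftarrow>as. qp (a * b))"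
    by (intro tendsto_mult tendsto_const prod_list_tendsto qp_tendsto)
  moreover have "(\<lambda>N. (\<Prod>r<N. 1 - a * prod_list as * q ^ r) * int_I S (a * q ^ N # as)) \<longlonglongrightarrow> qp (a * prod_list as) * int_I S (0 # as)"
    by (intro tendsto_mult qp_tendsto int_I_tendsto_0 S a)
  ultimately show ?thesis
    unfolding step by (rule LIMSEQ_unique)
qed

fun pair_qp :: "complex list \<Rightarrow> complex" where
  "pair_qp [] = 1"
| "pair_qp (a # as) = (\<Prod>b\<leftarrow>as. qp (a * b)) * pair_qp as"

lemma prod_list_qp_zeros [simp]: "(\<Prod>b\<leftarrow>replicate m 0. qp (a * b)) = 1"
  by (induction m) auto

text \<open>As soon as one parameter is 0, the product of all of them vanishes and the numerator of
  \<open>int_I_head\<close> becomes \<open>qp 0 = 1\<close>. The other parameters can then be sent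
  to 0 one after the other, each leaving its pairs in \<open>pair_qp\<close>.\<close>

lemma int_I_zeros:
  assumes S: "finite S" and "\<And>b. b \<in> set as \<Longrightarrow> norm b < 1" "length as + m = 2 * card S + 2" "m \<ge> 1"
  shows "int_I S (as @ replicate m 0) * pair_qp as = int_I S (replicate (2 * card S + 2) 0)"
  using assms(2-)
proof (induction as arbitrary: m)
  case (Cons a as)
  have "int_I S ((a # as) @ replicate m 0) * pair_qp (a # as) =
      (int_I S (a # (as @ replicate m 0)) * (\<Prod>b\<leftarrow>as @ replicate m 0. qp (a * b))) * pair_qp as"
    by (simp add: mult_ac)
  also have "int_I S (a # (as @ replicate m 0)) * (\<Prod>b\<leftarrow>as @ replicate m 0. qp (a * b)) =
      qp (a * prod_list (as @ replicate m 0)) * int_I S (0 # (as @ replicate m 0))"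
    by (rule int_I_head[OF S]) (use Cons.prems in \<open>auto split: if_splits\<close>)
  also have "qp (a * prod_list (as @ replicate m 0)) = 1"
    using Cons.prems by (cases m) auto
  also have "int_I S (0 # (as @ replicate m 0)) = int_I S (as @ replicate (Suc m) 0)"
    by (rule int_I_mset) simp
  finally have "int_I S ((a # as) @ replicate m 0) * pair_qp (a # as) = int_I S (as @ replicate (Suc m) 0) * pair_qp as"
    by simp
  also have "\<dots> = int_I S (replicate (2 * card S + 2) 0)"
    by (rule Cons.IH) (use Cons.prems in auto)
  finally show ?case .
qed auto

text \<open>Sending the first parameter to 0 produces \<open>qp (prod_list as)\<close> and the zero
  parameter that \<open>int_I_zeros\<close> asks for.\<close>

theorem type_I_integral:
  assumes S: "finite S" and "\<And>b. b \<in> set as \<Longrightarrow> norm b < 1" "length as = 2 * card S + 2"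
  shows "int_I S as * pair_qp as = qp (prod_list as) * int_I S (replicate (2 * card S + 2) 0)"
proof (cases as)
  case (Cons a bs)
  have "int_I S as * pair_qp as = (int_I S (a # bs) * (\<Prod>b\<leftarrow>bs. qp (a * b))) * pair_qp bs"
    using Cons by (simp add: mult_ac)
  also have "int_I S (a # bs) * (\<Prod>b\<leftarrow>bs. qp (a * b)) = qp (a * prod_list bs) * int_I S (0 # bs)"
    by (rule int_I_head[OF S]) (use assms Cons in auto)
  also have "int_I S (0 # bs) = int_I S (bs @ replicate 1 0)"
    by (rule int_I_mset) simp
  also have "qp (a * prod_list bs) * int_I S (bs @ replicate 1 0) * pair_qp bs = qp (a * prod_list bs) * (int_I S (bs @ replicate 1 0) * pair_qp bs)"
    by (simp add: mult_ac)
  also have "int_I S (bs @ replicate 1 0) * pair_qp bs = int_I S (replicate (2 * card S + 2) 0)"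
    by (rule int_I_zeros[OF S]) (use assms Cons in auto)
  finally show ?thesis using Cons by simp
qed (use assms in auto)

end

section \<open>Integrals of type II\<close>

context nome
begin

definition \<sigma>t :: "complex \<Rightarrow> complex \<Rightarrow> complex \<Rightarrow> complex" where
  "\<sigma>t t u v = qp (t * u * v) * qp (t * u * inverse v) * qp (t * inverse u * v) * qp (t * inverse u * inverse v)"

text \<open>For four parameters, the Koornwinder weight; it is the reciprocal of
  \<open>Nabla_CC\<close>, see \<open>inverse_Nabla\<close>.\<close>

definition dens_II :: "complex \<Rightarrow> complex list \<Rightarrow> nat set \<Rightarrow> (nat \<Rightarrow> complex) \<Rightarrow> complex" where
  "dens_II t ps S x = pprod S \<sigma> x * inverse (pprod S (\<sigma>t t) x) * (\<Prod>i\<in>S. \<tau> ps (x i))"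

definition int_II :: "complex \<Rightarrow> complex list \<Rightarrow> nat set \<Rightarrow> complex" where
  "int_II t ps S = (\<integral>x. dens_II t ps S x \<partial>torus S)"

text \<open>The variables of one group, rescaled by \<open>s\<close>, in the role of parameters for
  the other group.\<close>

fun param_list :: "complex \<Rightarrow> (nat \<Rightarrow> complex) \<Rightarrow> nat list \<Rightarrow> complex list" where
  "param_list s x [] = []"
| "param_list s x (i # L) = s * x i # s * inverse (x i) # param_list s x L"

lemma \<sigma>t_sym: "\<sigma>t t u v = \<sigma>t t v u"
  by (simp add: \<sigma>t_def mult_ac)

lemma \<sigma>t_inverse [simp]: "\<sigma>t t (inverse u) v = \<sigma>t t u v"
  by (simp add: \<sigma>t_def mult_ac)

lemma length_plist [simp]: "length (param_list s x L) = 2 * length L"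
  by (induction L) auto

lemma norm_plist: "unimodular (set L) x \<Longrightarrow> b \<in> set (param_list s x L) \<Longrightarrow> norm b = norm s"
  by (induction L) (auto simp: unimodular_def norm_mult norm_inverse)

lemma prod_list_plist: "unimodular (set L) x \<Longrightarrow> prod_list (param_list s x L) = s ^ (2 * length L)"
proof (induction L)
  case (Cons i L)
  have "x i \<noteq> 0" "unimodular (set L) x" using Cons.prems by (auto simp: unimodular_def)
  thus ?case using Cons.IH by (simp add: power2_eq_square field_simps)
qed auto

lemma prod_plist_map: "(\<Prod>b\<leftarrow>param_list s x L. f b) = (\<Prod>i\<leftarrow>L. f (s * x i) * f (s * inverse (x i)) :: complex)"
  by (induction L) (simp_all add: mult_ac)

lemma prod_list_distinct: "distinct L \<Longrightarrow> (\<Prod>i\<leftarrow>L. f i) = (\<Prod>i\<in>set L. f i :: complex)"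
  by (simp add: prod.distinct_set_conv_list)

lemma pair_qp_append: "pair_qp (as @ bs) = pair_qp as * (\<Prod>a\<leftarrow>as. \<Prod>b\<leftarrow>bs. qp (a * b)) * pair_qp bs"
  by (induction as) (simp_all add: mult_ac)

text \<open>The two entries of one index multiply to \<open>s\<^sup>2\<close>, while entries of two
  different indices give the four arguments of \<open>\<sigma>t (s\<^sup>2)\<close>. This is how the
  cross terms with \<open>t = s\<^sup>2\<close> arise from a kernel that contains only
  \<open>s\<close>.\<close>

lemma pair_qp_plist:
  assumes "distinct L" "unimodular (set L) x"
  shows "pair_qp (param_list s x L) = qp (s\<^sup>2) ^ length L * pprod (set L) (\<sigma>t (s\<^sup>2)) x"
  using assms
proof (induction L)
  case (Cons i L)
  have xi: "x i \<noteq> 0" and u: "unimodular (set L) x" using Cons.prems by (auto simp: unimodular_def)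
  have d: "distinct L" "i \<notin> set L" using Cons.prems by auto
  have e: "s * x i * (s * inverse (x i)) = s\<^sup>2" using xi by (simp add: power2_eq_square)
  have p: "(\<Prod>j\<in>set L. \<sigma>t (s\<^sup>2) (x i) (x j)) = (\<Prod>b\<leftarrow>param_list s x L. qp (s * x i * b)) * (\<Prod>b\<leftarrow>param_list s x L. qp (s * inverse (x i) * b))"
    unfolding prod_plist_map prod_list_distinct[OF d(1)] prod.distrib[symmetric]
    by (intro prod.cong refl) (simp add: \<sigma>t_def power2_eq_square mult_ac)
  have "pprod (insert i (set L)) (\<sigma>t (s\<^sup>2)) x = (\<Prod>j\<in>set L. \<sigma>t (s\<^sup>2) (x i) (x j)) * pprod (set L) (\<sigma>t (s\<^sup>2)) x"
    by (rule pprod_insert) (use d \<sigma>t_sym in auto)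
  thus ?case
    unfolding param_list.simps pair_qp.simps list.map prod_list.Cons e using Cons.IH[OF d(1) u] by (simp add: p mult_ac)
qed auto

lemma \<tau>_append: "\<tau> (as @ bs) u = \<tau> as u * inverse (\<Prod>b\<leftarrow>bs. qp (b * u) * qp (b * inverse u))"
  by (simp add: \<tau>_def mult_ac)

lemma \<tau>_plist:
  assumes "distinct L"
  shows "inverse (\<Prod>b\<leftarrow>param_list s x L. qp (b * u) * qp (b * inverse u)) = (\<Prod>i\<in>set L. inverse (\<sigma>t s (x i) u))"
  unfolding prod_plist_map prod_list_distinct[OF assms] prod_inversef[symmetric]
  by (intro prod.cong refl) (simp add: \<sigma>t_def mult_ac o_def)

lemma dens_I_append_plist:
  assumes "distinct L"
  shows "dens_I T (as @ param_list s x L) y = dens_I T as y * (\<Prod>k\<in>T. \<Prod>i\<in>set L. inverse (\<sigma>t s (x i) (y k)))"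
  unfolding dens_I_def \<tau>_append \<tau>_plist[OF assms] by (simp add: prod.distrib mult_ac)

lemma qp_times_nonzero: "norm a < 1 \<Longrightarrow> norm w = 1 \<Longrightarrow> qp (a * w) \<noteq> 0"
  by (intro qp_nonzero) (simp add: norm_mult)

lemma \<sigma>t_nonzero: "norm t < 1 \<Longrightarrow> norm u = 1 \<Longrightarrow> norm v = 1 \<Longrightarrow> \<sigma>t t u v \<noteq> 0"
  by (simp add: \<sigma>t_def mult.assoc norm_mult norm_inverse qp_times_nonzero)

lemma pprod_nonzero:
  assumes "finite S" "\<And>i j. i \<in> S \<Longrightarrow> j \<in> S \<Longrightarrow> s (x i) (x j) \<noteq> 0"
  shows "pprod S s x \<noteq> 0"
  using assms finite_pairs[OF assms(1)] by (auto simp: pprod_def)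

lemma pair_qp_nonzero: "(\<And>a. a \<in> set as \<Longrightarrow> norm a < 1) \<Longrightarrow> pair_qp as \<noteq> 0"
proof (induction as)
  case (Cons a as)
  have "qp (a * b) \<noteq> 0" if "b \<in> set as" for b
    using Cons.prems[of a] Cons.prems[of b] that mult_strict_mono'[of "norm a" 1 "norm b" 1]
    by (intro qp_nonzero) (simp add: norm_mult)
  hence "(\<Prod>b\<leftarrow>as. qp (a * b)) \<noteq> 0" by (rule prod_list_nonzero)
  thus ?case using Cons by auto
qed auto

lemma bdd_meas_inverse_\<sigma>t:
  assumes "bdd_meas M u" "bdd_meas M v" "bdd_meas M (\<lambda>p. inverse (u p))" "bdd_meas M (\<lambda>p. inverse (v p))"
    and "\<And>p. p \<in> space M \<Longrightarrow> norm (u p) = 1" "\<And>p. p \<in> space M \<Longrightarrow> norm (v p) = 1" "norm s < 1"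
  shows "bdd_meas M (\<lambda>p. inverse (\<sigma>t s (u p) (v p)))"
  unfolding \<sigma>t_def inverse_mult_distrib
  by (intro bdd_meas_mult; rule bdd_meas_inverse_qp[where r = "norm s"])
     (auto intro!: bdd_meas_mult bdd_meas_const assms simp: norm_mult norm_inverse assms)

lemma bdd_meas_dens_II:
  assumes "norm t < 1" "\<And>a. a \<in> set ps \<Longrightarrow> norm a < 1"
  shows "bdd_meas (torus S) (dens_II t ps S)"
proof -
  have "bdd_meas (torus S) (\<lambda>x. pprod S \<sigma> x * pprod S (\<lambda>u v. inverse (\<sigma>t t u v)) x * (\<Prod>i\<in>S. \<tau> ps (x i)))"
    by (intro bdd_meas_mult bdd_meas_pprod bdd_meas_\<sigma> bdd_meas_prod bdd_meas_\<tau> bdd_meas_inverse_\<sigma>t bdd_meas_coord bdd_meas_inverse_coord) (use assms in \<open>auto simp: norm_coord\<close>)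
  thus ?thesis by (simp add: dens_II_def[abs_def] pprod_inverse)
qed

abbreviation int_I_zero :: "nat set \<Rightarrow> complex" where
  "int_I_zero S \<equiv> int_I S (replicate (2 * card S + 2) 0)"

text \<open>Integrating one kernel over either group of variables with the type I formula.\<close>

lemma type_II_recursion:
  assumes S: "finite S" "finite T" "card S = Suc (card T)"
    and s: "norm s < 1" and ps: "\<And>a. a \<in> set ps \<Longrightarrow> norm a < 1" "length ps = 4"
  shows "qp (s ^ (2 * card S)) * int_I_zero T * int_II (s\<^sup>2) ps S * pair_qp ps =
    qp (s ^ (2 * card T) * prod_list ps) * int_I_zero S * qp (s\<^sup>2) * int_II (s\<^sup>2) (map ((*) s) ps) T"
proof -
  define LS LT where "LS = sorted_list_of_set S" and "LT = sorted_list_of_set T"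
  have LS: "distinct LS" "set LS = S" "length LS = card S" and LT: "distinct LT" "set LT = T" "length LT = card T"
    using S by (auto simp: LS_def LT_def)
  define t where "t = s\<^sup>2"
  have t: "norm t < 1" using s by (simp add: t_def norm_power power_less_one_iff)
  have qt: "qp t \<noteq> 0" by (rule qp_nonzero[OF t])
  \<comment> \<open>The \<open>y\<close> density has no parameters of its own: the entries of
    \<open>x\<close> already are \<open>2 * card T + 2\<close> in number. The \<open>x\<close>
    density has the four in \<open>ps\<close>, which the \<open>2 * card T\<close> entries of
    \<open>y\<close> complete to \<open>2 * card S + 2\<close>.\<close>
  define \<Phi> where "\<Phi> x y = dens_I S ps x * dens_I T [] y * (\<Prod>k\<in>T. \<Prod>i\<in>S. inverse (\<sigma>t s (x i) (y k)))" for x y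
  have "bdd_meas (torus S \<Otimes>\<^sub>M torus T) (\<lambda>p. \<Phi> (fst p) (snd p))"
    unfolding \<Phi>_def
  proof (intro bdd_meas_mult bdd_meas_prod bdd_meas_inverse_\<sigma>t)
    show "bdd_meas (torus S \<Otimes>\<^sub>M torus T) (\<lambda>p. dens_I S ps (fst p))" by (intro bdd_meas_fst bdd_meas_dens_I ps) auto
    show "bdd_meas (torus S \<Otimes>\<^sub>M torus T) (\<lambda>p. dens_I T [] (snd p))" by (intro bdd_meas_snd bdd_meas_dens_I) auto
  qed (auto intro!: bdd_meas_coord_pair s simp: space_pair_measure norm_coord)
  hence Fub: "(\<integral>y. (\<integral>x. \<Phi> x y \<partial>torus S) \<partial>torus T) = (\<integral>x. (\<integral>y. \<Phi> x y \<partial>torus T) \<partial>torus S)"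
    by (rule torus_Fubini)
  have inner_y: "(\<integral>y. \<Phi> x y \<partial>torus T) = (qp (s ^ (2 * card S)) * int_I_zero T * inverse (qp t ^ card S)) * dens_II t ps S x"
    if x: "x \<in> space (torus S)" for x
  proof -
    have u: "unimodular (set LS) x" using unimodular_torus[OF x] LS by simp
    have nz: "pprod S (\<sigma>t t) x \<noteq> 0"
      by (intro pprod_nonzero S \<sigma>t_nonzero t norm_coord[OF x])
    have "(\<integral>y. \<Phi> x y \<partial>torus T) = (\<integral>y. dens_I S ps x * dens_I T ([] @ param_list s x LS) y \<partial>torus T)"
      unfolding \<Phi>_def dens_I_append_plist[OF LS(1)] LS(2) by (simp only: mult_ac)
    also have "\<dots> = dens_I S ps x * int_I T (param_list s x LS)"
      by (simp add: int_I_def)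
    also have "int_I T (param_list s x LS) * pair_qp (param_list s x LS) = qp (prod_list (param_list s x LS)) * int_I_zero T"
      by (rule type_I_integral) (use S norm_plist[OF u] s LS in auto)
    hence "int_I T (param_list s x LS) = qp (s ^ (2 * card S)) * int_I_zero T * inverse (qp t ^ card S * pprod S (\<sigma>t t) x)"
      using nz qt unfolding pair_qp_plist[OF LS(1) u] prod_list_plist[OF u] LS t_def[symmetric] by (simp add: field_simps)
    finally show ?thesis
      by (simp add: dens_II_def dens_I_def mult_ac)
  qed
  have inner_x: "(\<integral>x. \<Phi> x y \<partial>torus S) = (qp (s ^ (2 * card T) * prod_list ps) * int_I_zero S * inverse (pair_qp ps * qp t ^ card T)) * dens_II t (map ((*) s) ps) T y"
    if y: "y \<in> space (torus T)" for y
  proof -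
    have u: "unimodular (set LT) y" using unimodular_torus[OF y] LT by simp
    have nz: "pprod T (\<sigma>t t) y \<noteq> 0"
      by (intro pprod_nonzero S \<sigma>t_nonzero t norm_coord[OF y])
    have sym: "(\<Prod>k\<in>T. \<Prod>i\<in>S. inverse (\<sigma>t s (x i) (y k))) = (\<Prod>i\<in>S. \<Prod>k\<in>T. inverse (\<sigma>t s (y k) (x i)))" for x
      by (subst prod.swap) (simp add: \<sigma>t_sym)
    \<comment> \<open>The mixed pairs of a parameter and an entry \<open>s * y k\<close> form the
      denominator of a density in \<open>y\<close> whose four parameters have been multiplied by
      \<open>s\<close>.\<close>
    define Q where "Q = (\<Prod>a\<leftarrow>ps. \<Prod>b\<leftarrow>param_list s y LT. qp (a * b))"
    have Qeq: "Q = (\<Prod>k\<in>T. \<Prod>a\<leftarrow>ps. qp (s * a * y k) * qp (s * a * inverse (y k)))"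
      unfolding Q_def prod_plist_map prod_list_distinct[OF LT(1)] LT(2)
      by (induction ps) (simp_all add: prod.distrib mult_ac)
    have Qnz: "Q \<noteq> 0"
      unfolding Q_def
    proof (intro prod_list_nonzero)
      fix a b assume "a \<in> set ps" "b \<in> set (param_list s y LT)"
      hence "norm a < 1" "norm b < 1" using ps norm_plist[OF u] s by auto
      thus "qp (a * b) \<noteq> 0" using mult_strict_mono'[of "norm a" 1 "norm b" 1]
        by (intro qp_nonzero) (simp add: norm_mult)
    qed
    have D2eq: "dens_II t (map ((*) s) ps) T y = dens_I T [] y * inverse (pprod T (\<sigma>t t) y) * inverse Q"
      unfolding dens_II_def dens_I_def \<tau>_def Qeq by (simp add: prod.distrib prod_inversef[symmetric] o_def mult_ac)
    have "(\<integral>x. \<Phi> x y \<partial>torus S) = (\<integral>x. dens_I T [] y * dens_I S (ps @ param_list s y LT) x \<partial>torus S)"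
      unfolding \<Phi>_def dens_I_append_plist[OF LT(1)] LT(2) sym by (simp only: mult_ac)
    also have "\<dots> = dens_I T [] y * int_I S (ps @ param_list s y LT)"
      by (simp add: int_I_def)
    also have "int_I S (ps @ param_list s y LT) * pair_qp (ps @ param_list s y LT) = qp (prod_list (ps @ param_list s y LT)) * int_I_zero S"
      by (rule type_I_integral) (use S norm_plist[OF u] s LT ps in auto)
    hence "int_I S (ps @ param_list s y LT) * (pair_qp ps * Q * (qp t ^ card T * pprod T (\<sigma>t t) y)) = qp (s ^ (2 * card T) * prod_list ps) * int_I_zero S"
      unfolding pair_qp_append pair_qp_plist[OF LT(1) u] prod_list.append prod_list_plist[OF u] LT t_def[symmetric] Q_def by (simp only: mult_ac)
    hence "int_I S (ps @ param_list s y LT) = qp (s ^ (2 * card T) * prod_list ps) * int_I_zero S * inverse (pair_qp ps * Q * (qp t ^ card T * pprod T (\<sigma>t t) y))"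
      using nz qt Qnz pair_qp_nonzero[OF ps(1)] by (simp add: field_simps)
    finally show ?thesis
      unfolding D2eq by (simp add: mult_ac)
  qed
  have "(\<integral>x. (\<integral>y. \<Phi> x y \<partial>torus T) \<partial>torus S) = (\<integral>x. (qp (s ^ (2 * card S)) * int_I_zero T * inverse (qp t ^ card S)) * dens_II t ps S x \<partial>torus S)"
    by (rule Bochner_Integration.integral_cong[OF refl inner_y])
  also have "\<dots> = (qp (s ^ (2 * card S)) * int_I_zero T * inverse (qp t ^ card S)) * int_II t ps S"
    unfolding int_II_def by simp
  finally have 1: "(\<integral>x. (\<integral>y. \<Phi> x y \<partial>torus T) \<partial>torus S) = (qp (s ^ (2 * card S)) * int_I_zero T * inverse (qp t ^ card S)) * int_II t ps S" .
  have "(\<integral>y. (\<integral>x. \<Phi> x y \<partial>torus S) \<partial>torus T) = (\<integral>y. (qp (s ^ (2 * card T) * prod_list ps) * int_I_zero S * inverse (pair_qp ps * qp t ^ card T)) * dens_II t (map ((*) s) ps) T y \<partial>torus T)"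
    by (rule Bochner_Integration.integral_cong[OF refl inner_x])
  also have "\<dots> = (qp (s ^ (2 * card T) * prod_list ps) * int_I_zero S * inverse (pair_qp ps * qp t ^ card T)) * int_II t (map ((*) s) ps) T"
    unfolding int_II_def by simp
  finally have "(qp (s ^ (2 * card S)) * int_I_zero T * inverse (qp t ^ card S)) * int_II t ps S = (qp (s ^ (2 * card T) * prod_list ps) * int_I_zero S * inverse (pair_qp ps * qp t ^ card T)) * int_II t (map ((*) s) ps) T"
    using 1 Fub by simp
  thus ?thesis
    using qt pair_qp_nonzero[OF ps(1)] unfolding t_def[symmetric] S(3) by (simp add: field_simps)
qed

text \<open>The constant which the functional equation in the parameters leaves
  undetermined.\<close>

definition norm_const :: "nat \<Rightarrow> complex" where "norm_const n = int_I_zero {1..n}"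

lemma norm_const_0 [simp]: "norm_const 0 = 1"
proof -
  interpret prob_space "torus ({} :: nat set)" by (rule prob_space_torus)
  show ?thesis using prob_space by (simp add: norm_const_def int_I_def dens_I_def)
qed

text \<open>Each use of the recursion removes one variable and rescales the parameters by
  \<open>s\<close>, so the product of the four gains \<open>s ^ 4\<close>, that is
  \<open>t\<^sup>2\<close>. The recursion also divides by the constant for one variable fewer,
  whence the assumption on \<open>norm_const\<close>; it is supplied by the strong induction in
  \<open>norm_const_eq\<close>.\<close>

lemma int_II_product:
  assumes s: "norm s < 1" and ps: "\<And>a. a \<in> set ps \<Longrightarrow> norm a < 1" "length ps = 4" and norm_const: "\<And>m. m < n \<Longrightarrow> norm_const m \<noteq> 0"
  shows "int_II (s\<^sup>2) ps {1..n} = norm_const n * (\<Prod>m<n. qp (s\<^sup>2) * qp ((s\<^sup>2) ^ (n - 1 + m) * prod_list ps) / (qp ((s\<^sup>2) ^ Suc m) * pair_qp (map ((*) (s ^ m)) ps)))"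
  using ps norm_const
proof (induction n arbitrary: ps)
  case 0
  interpret prob_space "torus ({} :: nat set)" by (rule prob_space_torus)
  show ?case using prob_space by (simp add: int_II_def dens_II_def)
next
  case (Suc n)
  define t where "t = s\<^sup>2"
  have t: "norm t < 1" using s by (simp add: t_def norm_power power_less_one_iff)
  have nqt: "qp (t ^ Suc m) \<noteq> 0" for m
    by (rule qp_nonzero) (use t in \<open>simp add: norm_power power_less_one_iff del: power_Suc\<close>)
  have sps: "norm a < 1" if "a \<in> set (map ((*) s) ps)" for a
    using that Suc.prems(1) s mult_strict_mono'[of "norm s" 1 "norm b" 1 for b] by (force simp: norm_mult)
  obtain p1 p2 p3 p4 where ps4: "ps = [p1, p2, p3, p4]"
    using Suc.prems(2) by (auto simp: numeral_eq_Suc length_Suc_conv)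
  have pl: "prod_list (map ((*) s) ps) = t\<^sup>2 * prod_list ps"
    by (simp add: ps4 t_def power2_eq_square mult_ac)
  have IH: "int_II t (map ((*) s) ps) {1..n} = norm_const n * (\<Prod>m<n. qp t * qp (t ^ (n - 1 + m) * prod_list (map ((*) s) ps)) / (qp (t ^ Suc m) * pair_qp (map ((*) (s ^ m)) (map ((*) s) ps))))"
    unfolding t_def by (rule Suc.IH) (use sps Suc.prems in auto)
  have m: "map ((*) (s ^ m)) (map ((*) s) ps) = map ((*) (s ^ Suc m)) ps" for m
    by (simp add: ps4 mult_ac)
  \<comment> \<open>The condition \<open>m < n\<close> excludes \<open>n = 0\<close>, where the
    subtraction \<open>n - 1\<close> would be truncated.\<close>
  have e: "t ^ (n - 1 + m) * prod_list (map ((*) s) ps) = t ^ (n + Suc m) * prod_list ps" if "m < n" for m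
  proof -
    have "t ^ (n - 1 + m) * t\<^sup>2 = t ^ (n + Suc m)" unfolding power_add[symmetric] using that by (intro arg_cong[of _ _ "power t"]) auto
    thus ?thesis unfolding pl by (simp add: mult.assoc[symmetric])
  qed
  let ?N = "\<lambda>m. qp (t ^ (n + m) * prod_list ps)" and ?P = "\<lambda>m. pair_qp (map ((*) (s ^ m)) ps)"
  have "int_II t (map ((*) s) ps) {1..n} = norm_const n * (\<Prod>m<n. qp t * ?N (Suc m) / (qp (t ^ Suc m) * ?P (Suc m)))"
    unfolding IH m by (intro arg_cong2[of _ _ _ _ "(*)"] refl prod.cong) (use e in auto)
  also have "\<dots> = norm_const n * ((\<Prod>m<n. qp t) * (\<Prod>m<n. ?N (Suc m)) / ((\<Prod>m<n. qp (t ^ Suc m)) * (\<Prod>m<n. ?P (Suc m))))"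
    by (simp only: prod_dividef prod.distrib)
  finally have I: "int_II t (map ((*) s) ps) {1..n} = norm_const n * ((\<Prod>m<n. qp t) * (\<Prod>m<n. ?N (Suc m)) / ((\<Prod>m<n. qp (t ^ Suc m)) * (\<Prod>m<n. ?P (Suc m))))" .
  have rec: "qp (t ^ Suc n) * norm_const n * int_II t ps {1..Suc n} * pair_qp ps = qp (t ^ n * prod_list ps) * norm_const (Suc n) * qp t * int_II t (map ((*) s) ps) {1..n}"
    using type_II_recursion[of "{1..Suc n}" "{1..n}" s ps] s Suc.prems(1,2)
    unfolding norm_const_def t_def power_mult by simp
  have cnn: "norm_const n \<noteq> 0" using Suc.prems by auto
  have ppn: "pair_qp ps \<noteq> 0" by (rule pair_qp_nonzero[OF Suc.prems(1)])
  have "int_II t ps {1..Suc n} = norm_const (Suc n) * (qp t * (\<Prod>m<n. qp t)) * (qp (t ^ n * prod_list ps) * (\<Prod>m<n. ?N (Suc m))) /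
     ((qp (t ^ Suc n) * (\<Prod>m<n. qp (t ^ Suc m))) * (pair_qp ps * (\<Prod>m<n. ?P (Suc m))))"
  proof -
    have "int_II t ps {1..Suc n} = qp (t ^ n * prod_list ps) * norm_const (Suc n) * qp t * int_II t (map ((*) s) ps) {1..n} / (qp (t ^ Suc n) * norm_const n * pair_qp ps)"
      using rec cnn ppn nqt[of n] by (simp add: eq_divide_eq mult_ac)
    also have "\<dots> = (norm_const n / norm_const n) * (norm_const (Suc n) * (qp t * (\<Prod>m<n. qp t)) * (qp (t ^ n * prod_list ps) * (\<Prod>m<n. ?N (Suc m))) /
     ((qp (t ^ Suc n) * (\<Prod>m<n. qp (t ^ Suc m))) * (pair_qp ps * (\<Prod>m<n. ?P (Suc m)))))"
      unfolding I by (simp add: divide_inverse mult_ac)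
    finally show ?thesis using cnn by simp
  qed
  also have "qp t * (\<Prod>m<n. qp t) = (\<Prod>m<Suc n. qp t)" by simp
  also have "qp (t ^ n * prod_list ps) * (\<Prod>m<n. ?N (Suc m)) = (\<Prod>m<Suc n. ?N m)"
    by (simp only: prod.lessThan_Suc_shift) simp
  also have "qp (t ^ Suc n) * (\<Prod>m<n. qp (t ^ Suc m)) = (\<Prod>m<Suc n. qp (t ^ Suc m))"
    by (simp add: mult_ac)
  also have "pair_qp ps * (\<Prod>m<n. ?P (Suc m)) = (\<Prod>m<Suc n. ?P m)"
    by (simp only: prod.lessThan_Suc_shift) (simp add: ps4)
  finally show ?case
    unfolding t_def[symmetric] by (simp only: prod_dividef prod.distrib times_divide_eq_right diff_Suc_1 mult.assoc)
qed

end

section \<open>The normalising constants\<close>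

lemma bdd_meas_circ_continuous:
  assumes "continuous_on (sphere 0 1) f" shows "bdd_meas circ f"
proof -
  have "bounded (f ` sphere 0 1)"
    by (intro compact_imp_bounded compact_continuous_image assms compact_sphere)
  thus ?thesis
    using measurable_circ_continuous[OF assms] unfolding bdd_meas_def bounded_iff by auto
qed

lemma norm_pprod_le:
  assumes "finite S" "\<And>i j. i \<in> S \<Longrightarrow> j \<in> S \<Longrightarrow> i \<noteq> j \<Longrightarrow> norm (s (x i) (x j)) \<le> B"
  shows "norm (pprod S s x) \<le> B ^ card {(i, j). i \<in> S \<and> j \<in> S \<and> i < j}"
proof -
  have "(\<Prod>p\<in>{(i, j). i \<in> S \<and> j \<in> S \<and> i < j}. norm (case p of (i, j) \<Rightarrow> s (x i) (x j))) \<le> (\<Prod>p\<in>{(i, j). i \<in> S \<and> j \<in> S \<and> i < j}. B)"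
    by (rule prod_mono) (use assms in auto)
  thus ?thesis unfolding pprod_def prod_norm[symmetric] by simp
qed

lemma pprod_tendsto:
  assumes "\<And>i j. i \<in> S \<Longrightarrow> j \<in> S \<Longrightarrow> i \<noteq> j \<Longrightarrow> ((\<lambda>k. f k (x i) (x j)) \<longlongrightarrow> g (x i) (x j)) F"
  shows "((\<lambda>k. pprod S (f k) x) \<longlongrightarrow> pprod S g x) F"
  unfolding pprod_def by (rule tendsto_prod) (use assms in auto)

context nome
begin

lemma bdd_meas_circ_\<tau>:
  assumes "\<And>a. a \<in> set as \<Longrightarrow> norm a < 1"
  shows "bdd_meas circ (\<tau> as)"
proof (rule bdd_meas_circ_continuous)
  have "qp (a * z) \<noteq> 0" "qp (a * inverse z) \<noteq> 0" if "a \<in> set as" "norm z = 1" for a z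
    using that assms by (simp_all add: qp_times_nonzero norm_inverse)
  thus "continuous_on (sphere 0 1) (\<tau> as)"
    unfolding \<tau>_def[abs_def]
    by (auto intro!: continuous_intros continuous_on_prod_list prod_list_nonzero)
qed

lemma norm_const_1_eq: "length as = 4 \<Longrightarrow> (\<And>a. a \<in> set as \<Longrightarrow> norm a < 1) \<Longrightarrow> int_I {1..1} as = (\<integral>z. \<tau> as z \<partial>circ)"
proof -
  assume as: "length as = 4" "\<And>a. a \<in> set as \<Longrightarrow> norm a < 1"
  have "dens_I {1..1} as = (\<lambda>x. \<Prod>i\<in>{1..1}. \<tau> as (x i))"
    using pprod_insert[of "{}" 1 \<sigma>] by (intro ext) (simp add: dens_I_def)
  thus ?thesis
    using torus_integral_prod[of "{1..1::nat}" "\<tau> as"] bdd_meas_circ_\<tau>[OF as(2)] by (simp add: int_I_def)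
qed

text \<open>For the parameters \<open>r, - r, q, - q\<close> with \<open>r * r = q\<close> the
  denominator at \<open>z\<close> is \<open>qp (q * z\<^sup>2)\<close>, up to the same at
  \<open>inverse z\<close>. The weight collapses to
  \<open>(1 - z\<^sup>2) * (1 - inverse z ^ 2)\<close>, whose average is 2, and the type I formula
  is then solved for the constant.\<close>

lemma norm_const_1: "norm_const 1 = 2 / qp q"
proof -
  define r where "r = csqrt q"
  have r2: "r * r = q" by (simp add: r_def power2_eq_square[symmetric])
  have nr: "norm r < 1"
  proof -
    have "norm r ^ 2 < 1" using q1 unfolding power2_eq_square norm_mult[symmetric] r2 .
    thus ?thesis by (simp add: power_less_one_iff)
  qed
  let ?as = "[r, - r, q, - q]"
  have as: "norm a < 1" if "a \<in> set ?as" for a using that nr q1 by auto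
  interpret sq: nome "q\<^sup>2" by (rule nome_square)
  have split: "qp (q * z\<^sup>2) = (qp (r * z) * qp (- (r * z))) * (qp (q * z) * qp (- (q * z)))" for z
  proof -
    have "(r * z)\<^sup>2 = (r * r) * z\<^sup>2" "(q * z)\<^sup>2 = q * z\<^sup>2 * q" by (simp_all add: power2_eq_square mult_ac)
    thus ?thesis
      by (simp only: r2 qp_even_odd[of "q * z\<^sup>2"] qp_mult_minus)
  qed
  have "\<tau> ?as z = 2 - z powi 2 - z powi (-2)" if z: "norm z = 1" for z
  proof -
    have z0: "z \<noteq> 0" using z by auto
    have w: "norm (q * w) < 1" if "norm w = 1" for w using that q1 by (simp add: norm_mult)
    have nz: "qp (q * z\<^sup>2) \<noteq> 0" "qp (q * (inverse z)\<^sup>2) \<noteq> 0"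
      by (intro qp_nonzero w; simp add: norm_power z norm_inverse)+
    have "\<tau> ?as z = (1 - z\<^sup>2) * qp (q * z\<^sup>2) * ((1 - (inverse z)\<^sup>2) * qp (q * (inverse z)\<^sup>2)) * inverse (qp (q * z\<^sup>2) * qp (q * (inverse z)\<^sup>2))"
      unfolding \<tau>_def split power_inverse[symmetric] by (subst qp_Suc, subst (2) qp_Suc) (simp add: split mult_ac)
    also have "\<dots> = (1 - z\<^sup>2) * (1 - (inverse z)\<^sup>2)"
    proof -
      have "A * P * (B * Q) * inverse (P * Q) = A * B" if "P \<noteq> 0" "Q \<noteq> 0" for A B P Q :: complex
        using that by (simp add: field_simps)
      from this[OF nz] show ?thesis .
    qed
    also have "\<dots> = 2 - z powi 2 - z powi (-2)"
      using z0 by (simp add: power_int_minus field_simps)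
    finally show ?thesis .
  qed
  hence "(\<integral>z. \<tau> ?as z \<partial>circ) = (\<integral>z. 2 - z powi 2 - z powi (-2) \<partial>circ)"
    by (intro Bochner_Integration.integral_cong) auto
  also have "\<dots> = 2"
  proof -
    have int: "integrable circ (\<lambda>z. z powi k)" for k :: int
      by (intro bdd_meas_integrable prob_space_circ bdd_meas_circ_continuous continuous_intros) auto
    have c: "integrable circ (\<lambda>_. 2 :: complex)" by (intro bdd_meas_integrable prob_space_circ bdd_meas_const)
    show ?thesis
      using prob_space.prob_space[OF prob_space_circ]
      by (simp only: Bochner_Integration.integral_diff[OF Bochner_Integration.integrable_diff[OF c int] int] Bochner_Integration.integral_diff[OF c int] integral_circ_power) simp
  qed
  finally have I: "int_I {1..1} ?as = 2" using norm_const_1_eq[of ?as] as by simp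
  have e: "2 * pair_qp ?as = qp (prod_list ?as) * norm_const 1"
    using type_I_integral[of "{1..1}" ?as] as I unfolding norm_const_def by simp
  have pl: "prod_list ?as = q ^ 3"
    using r2 by (simp add: power3_eq_cube)
  have "pair_qp ?as = qp (- q) * (qp (r * q) * qp (- (r * q))) * (qp (r * q) * qp (- (r * q))) * qp (- q\<^sup>2)"
    by (simp add: r2 power2_eq_square mult_ac)
  \<comment> \<open>The extra factor \<open>qp q\<close> makes the six pair factors combine, by
    \<open>qp_mult_minus\<close>, into factorials of base \<open>q\<^sup>2\<close>; these reassemble
    to \<open>qp (q ^ 3)\<close>, which is also the numerator, since the parameters multiply to
    \<open>q ^ 3\<close>.\<close>
  hence "pair_qp ?as * qp q = (qp q * qp (- q)) * (qp (r * q) * qp (- (r * q))) * (qp (r * q) * qp (- (r * q))) * qp (- q\<^sup>2)"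
    by (simp add: mult_ac)
  also have "qp q * qp (- q) = qpoch_inf (q\<^sup>2) (q\<^sup>2)" by (rule qp_mult_minus)
  also have "qp (r * q) * qp (- (r * q)) = qpoch_inf (q ^ 3) (q\<^sup>2)"
  proof -
    have "(r * q)\<^sup>2 = (r * r) * q * q" by (simp add: power2_eq_square mult_ac)
    thus ?thesis unfolding qp_mult_minus by (simp only: r2 power3_eq_cube)
  qed
  also have "qpoch_inf (q\<^sup>2) (q\<^sup>2) * qpoch_inf (q ^ 3) (q\<^sup>2) * qpoch_inf (q ^ 3) (q\<^sup>2) * qp (- q\<^sup>2) =
     (qp (q\<^sup>2) * qp (- q\<^sup>2)) * qpoch_inf (q ^ 3) (q\<^sup>2)"
    unfolding qp_even_odd[of "q\<^sup>2"] by (simp add: power2_eq_square power3_eq_cube mult_ac)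
  also have "qp (q\<^sup>2) * qp (- q\<^sup>2) = qpoch_inf (q ^ 3 * q) (q\<^sup>2)"
    unfolding qp_mult_minus by (simp add: eval_nat_numeral mult_ac)
  also have "qpoch_inf (q ^ 3 * q) (q\<^sup>2) * qpoch_inf (q ^ 3) (q\<^sup>2) = qp (q ^ 3)"
    unfolding qp_even_odd[of "q ^ 3"] by simp
  finally have f: "pair_qp ?as * qp q = qp (q ^ 3)" .
  have "norm (q ^ 3) < 1" using q1 by (simp add: norm_power power_less_one_iff)
  hence nz: "qp (q ^ 3) \<noteq> 0" by (rule qp_nonzero)
  have "qp (q ^ 3) * norm_const 1 * qp q = 2 * qp (q ^ 3)"
    using e unfolding pl f[symmetric] by (simp add: mult_ac)
  thus ?thesis using nz qp_nonzero[OF q1] by (simp add: field_simps)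
qed

lemma qp_unit_nonzero:
  assumes "norm w = 1" "w \<noteq> 1" shows "qp w \<noteq> 0"
proof -
  have "norm (q * w) < 1" using assms q1 by (simp add: norm_mult)
  from qp_nonzero[OF this] assms(2) show ?thesis
    by (subst qp_Suc) simp
qed

text \<open>As \<open>t\<close> tends to 1 the cross terms disappear, which determines the normalisation.\<close>

lemma qp_ratio_bound:
  "\<exists>C. \<forall>r w. 0 \<le> r \<longrightarrow> r < 1 \<longrightarrow> norm w = 1 \<longrightarrow> norm (qp w * inverse (qp (of_real r * w))) \<le> C"
proof -
  obtain A where A: "\<And>z. norm z \<le> 1 \<Longrightarrow> norm (qp z) \<le> A" using qp_bounded[of 1] by blast
  obtain B where B: "\<And>z. norm z \<le> norm q \<Longrightarrow> norm (inverse (qp z)) \<le> B" using inverse_qp_bounded[OF q1] by blast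
  have "norm (qp 0) \<le> A" by (rule A) simp
  hence A0: "A \<ge> 0" by simp
  have "norm (qp w * inverse (qp (of_real r * w))) \<le> 2 * A * B" if r: "0 \<le> r" "r < 1" and w: "norm w = 1" for r w
  proof -
    let ?t = "of_real r :: complex"
    have n1: "norm (1 - ?t * w) \<ge> 1 - r"
      using norm_triangle_ineq2[of 1 "?t * w"] r w by (simp add: norm_mult)
    \<comment> \<open>The correction has norm \<open>1 - r\<close>, a lower bound for the norm of
      \<open>1 - r * w\<close>. So the quotient of the two first factors is at most 2, even where
      both are close to 0; the remaining factors have arguments of norm at most
      \<open>norm q\<close>.\<close>
    have "1 - w = (1 - ?t * w) - (1 - ?t) * w" by (simp add: algebra_simps)
    hence "norm (1 - w) \<le> norm (1 - ?t * w) + norm ((1 - ?t) * w)" by (metis norm_triangle_ineq4)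
    moreover have "norm ((1 - ?t) * w) = 1 - r"
    proof -
      have "1 - ?t = of_real (1 - r)" by simp
      thus ?thesis using r w by (simp only: norm_mult norm_of_real) simp
    qed
    ultimately have n2: "norm (1 - w) \<le> 2 * norm (1 - ?t * w)" using n1 by linarith
    have pos: "norm (1 - ?t * w) > 0" using n1 r by linarith
    have "norm (1 - w) * norm (inverse (1 - ?t * w)) = norm (1 - w) / norm (1 - ?t * w)"
      by (simp only: norm_inverse divide_inverse)
    also have "\<dots> \<le> 2" using n2 pos by (simp only: pos_divide_le_eq)
    finally have q: "norm (1 - w) * norm (inverse (1 - ?t * w)) \<le> 2" .
    have "norm (qp w * inverse (qp (?t * w))) = (norm (1 - w) * norm (inverse (1 - ?t * w))) * (norm (qp (q * w)) * norm (inverse (qp (q * (?t * w)))))"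
      unfolding qp_Suc[of w] qp_Suc[of "?t * w"] norm_mult inverse_mult_distrib by (simp only: mult_ac)
    also have "\<dots> \<le> 2 * (A * B)"
      by (intro mult_mono q A B mult_nonneg_nonneg norm_ge_zero A0) (use w q1 r in \<open>auto simp: norm_mult mult_left_le\<close>)
    finally show ?thesis by simp
  qed
  thus ?thesis by blast
qed

text \<open>At a generic point each cross term tends to 1, as its limit has a nonzero denominator
  there. Near the coincidences the denominators do become small, and the bound of
  \<open>qp_ratio_bound\<close>, uniform in \<open>r\<close>, provides the dominating
  constant.\<close>

lemma int_II_limit:
  assumes r: "\<And>k. 0 \<le> r k" "\<And>k. r k < 1" "r \<longlonglongrightarrow> 1" and S: "finite S" and ps: "\<And>a. a \<in> set ps \<Longrightarrow> norm a < 1"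
  shows "(\<lambda>k. int_II (of_real (r k)) ps S) \<longlonglongrightarrow> (\<integral>z. \<tau> ps z \<partial>circ) ^ card S"
proof -
  obtain C where C: "\<And>r w. 0 \<le> r \<Longrightarrow> r < 1 \<Longrightarrow> norm w = 1 \<Longrightarrow> norm (qp w * inverse (qp (of_real r * w))) \<le> C"
    using qp_ratio_bound by blast
  have C0: "C \<ge> 0" using C[of 0 1] by simp
  have "bdd_meas (torus S) (\<lambda>x. \<Prod>i\<in>S. \<tau> ps (x i))" by (intro bdd_meas_prod bdd_meas_\<tau> ps)
  then obtain B where B: "\<And>x. x \<in> space (torus S) \<Longrightarrow> norm (\<Prod>i\<in>S. \<tau> ps (x i)) \<le> B"
    and m: "(\<lambda>x. \<Prod>i\<in>S. \<tau> ps (x i)) \<in> borel_measurable (torus S)"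
    by (auto simp: bdd_meas_def)
  define \<rho> where "\<rho> t u v = \<sigma> u v * inverse (\<sigma>t t u v)" for t u v
  have dens_II: "dens_II t ps S x = pprod S (\<rho> t) x * (\<Prod>i\<in>S. \<tau> ps (x i))" for t x
    unfolding dens_II_def \<rho>_def pprod_mult pprod_inverse by simp
  interpret prob_space "torus S" by (rule prob_space_torus)
  let ?K = "((C * C) * (C * C)) ^ card {(i, j). i \<in> S \<and> j \<in> S \<and> i < j} * B"
  have "(\<lambda>k. int_II (of_real (r k)) ps S) \<longlonglongrightarrow> (\<integral>x. (\<Prod>i\<in>S. \<tau> ps (x i)) \<partial>torus S)"
    unfolding int_II_def
  proof (rule integral_dominated_convergence[where w = "\<lambda>_. ?K"])
    show "dens_II (of_real (r k)) ps S \<in> borel_measurable (torus S)" for k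
      by (rule bdd_meas_measurable[OF bdd_meas_dens_II]) (use r ps in auto)
    show "AE x in torus S. (\<lambda>k. dens_II (of_real (r k)) ps S x) \<longlonglongrightarrow> (\<Prod>i\<in>S. \<tau> ps (x i))"
      using AE_torus_generic[OF S] AE_space
    proof eventually_elim
      case (elim x)
      have "(\<lambda>k. \<rho> (of_real (r k)) (x i) (x j)) \<longlonglongrightarrow> 1" if ij: "i \<in> S" "j \<in> S" "i \<noteq> j" for i j
      proof -
        have n: "norm (x i) = 1" "norm (x j) = 1" using norm_coord[OF elim(2)] ij by auto
        have x0: "x i \<noteq> 0" "x j \<noteq> 0" using n by auto
        have g: "x i \<noteq> x j" "x i * x j \<noteq> 1" using elim(1) ij by (auto simp: torus_generic_def)
        have nz: "\<sigma> (x i) (x j) \<noteq> 0"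
        proof -
          have "qp (x i * x j) \<noteq> 0" "qp (x i * inverse (x j)) \<noteq> 0" "qp (inverse (x i) * x j) \<noteq> 0" "qp (inverse (x i) * inverse (x j)) \<noteq> 0"
            by (rule qp_unit_nonzero; use g x0 n in \<open>simp add: norm_mult norm_inverse norm_divide field_simps\<close>)+
          thus ?thesis by (simp add: \<sigma>_def)
        qed
        have "(\<lambda>k. \<sigma>t (of_real (r k)) (x i) (x j)) \<longlonglongrightarrow> \<sigma>t (of_real 1) (x i) (x j)"
          unfolding \<sigma>t_def by (intro tendsto_mult qp_tendsto_compose tendsto_of_real tendsto_const r)
        hence "(\<lambda>k. \<sigma>t (of_real (r k)) (x i) (x j)) \<longlonglongrightarrow> \<sigma> (x i) (x j)"
          by (simp add: \<sigma>t_def \<sigma>_def)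
        hence "(\<lambda>k. \<rho> (of_real (r k)) (x i) (x j)) \<longlonglongrightarrow> \<sigma> (x i) (x j) * inverse (\<sigma> (x i) (x j))"
          unfolding \<rho>_def using nz by (intro tendsto_mult tendsto_const tendsto_inverse)
        thus ?thesis using nz by simp
      qed
      hence "(\<lambda>k. pprod S (\<rho> (of_real (r k))) x) \<longlonglongrightarrow> pprod S (\<lambda>u v. 1) x"
        by (intro pprod_tendsto)
      from tendsto_mult[OF this tendsto_const[of "\<Prod>i\<in>S. \<tau> ps (x i)"]] show ?case
        unfolding dens_II by (simp add: pprod_def case_prod_unfold)
    qed
    show "AE x in torus S. norm (dens_II (of_real (r k)) ps S x) \<le> ?K" for k
      using AE_space
    proof eventually_elim
      case (elim x)
      have "norm (\<rho> (of_real (r k)) (x i) (x j)) \<le> (C * C) * (C * C)" if ij: "i \<in> S" "j \<in> S" for i j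
      proof -
        have n: "norm (x i) = 1" "norm (x j) = 1" using norm_coord[OF elim] ij by auto
        let ?h = "\<lambda>w. qp w * inverse (qp (of_real (r k) * w))"
        have "\<rho> (of_real (r k)) (x i) (x j) = (?h (x i * x j) * ?h (x i * inverse (x j))) * (?h (inverse (x i) * x j) * ?h (inverse (x i) * inverse (x j)))"
          by (simp add: \<rho>_def \<sigma>_def \<sigma>t_def mult_ac)
        also have "norm \<dots> \<le> (C * C) * (C * C)"
          unfolding norm_mult[of "?h _ * ?h _"] norm_mult[of "?h _" "?h _"]
          by (intro mult_mono mult_nonneg_nonneg C C0 norm_ge_zero r) (use n in \<open>auto simp: norm_mult norm_inverse\<close>)
        finally show ?thesis .
      qed
      hence "norm (pprod S (\<rho> (of_real (r k))) x) \<le> ((C * C) * (C * C)) ^ card {(i, j). i \<in> S \<and> j \<in> S \<and> i < j}"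
        by (intro norm_pprod_le S)
      thus ?case
        unfolding dens_II norm_mult[of "pprod S _ x"] by (intro mult_mono B[OF elim]) (use C0 in auto)
    qed
  qed (use m in auto)
  also have "(\<integral>x. (\<Prod>i\<in>S. \<tau> ps (x i)) \<partial>torus S) = (\<integral>z. \<tau> ps z \<partial>circ) ^ card S"
    by (rule torus_integral_prod[OF S bdd_meas_circ_\<tau>[OF ps]])
  finally show ?thesis .
qed

text \<open>Both \<open>q\<close>-factorials have a first factor divisible by \<open>1 - t\<close>;
  after cancellation the geometric sum of \<open>Suc m\<close> terms remains.\<close>

lemma qp_quotient_limit:
  assumes r: "\<And>k. 0 \<le> r k" "\<And>k. r k < 1" "r \<longlonglongrightarrow> 1"
  shows "(\<lambda>k. qp (of_real (r k)) / qp (of_real (r k) ^ Suc m)) \<longlonglongrightarrow> 1 / of_nat (Suc m)"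
proof -
  have eq: "qp (of_real (r k)) / qp (of_real (r k) ^ Suc m) = qp (q * of_real (r k)) / ((\<Sum>i<Suc m. of_real (r k) ^ i) * qp (q * of_real (r k) ^ Suc m))" for k
  proof -
    let ?t = "of_real (r k) :: complex"
    have t1: "1 - ?t \<noteq> 0" using r(2)[of k] by (metis eq_iff_diff_eq_0 of_real_eq_1_iff order_less_irrefl)
    have "qp ?t = (1 - ?t) * qp (q * ?t)" by (rule qp_Suc)
    moreover have "qp (?t ^ Suc m) = (1 - ?t) * (\<Sum>i<Suc m. ?t ^ i) * qp (q * ?t ^ Suc m)"
      by (subst qp_Suc) (simp only: one_diff_power_eq)
    ultimately show ?thesis using t1 by (simp only: mult.assoc mult_divide_mult_cancel_left[OF t1])
  qed
  have nq: "qp q \<noteq> 0" by (rule qp_nonzero[OF q1])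
  have "(\<lambda>k. qp (q * of_real (r k)) / ((\<Sum>i<Suc m. of_real (r k) ^ i) * qp (q * of_real (r k) ^ Suc m)))
      \<longlonglongrightarrow> qp (q * of_real 1) / ((\<Sum>i<Suc m. of_real 1 ^ i) * qp (q * of_real 1 ^ Suc m))"
  proof (intro tendsto_divide tendsto_mult tendsto_sum qp_tendsto_compose tendsto_const tendsto_power tendsto_of_real r)
    show "(\<Sum>i<Suc m. of_real 1 ^ i) * qp (q * of_real 1 ^ Suc m) \<noteq> 0"
      using nq by (simp del: of_nat_Suc add: of_nat_Suc[symmetric])
  qed
  thus ?thesis unfolding eq using nq by simp
qed

text \<open>The type II integral at zero parameters is computed in two ways as \<open>t\<close>
  tends to 1: the product formula gives \<open>norm_const n / fact n\<close>, decoupling gives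
  \<open>norm_const 1 ^ n\<close>. The induction is strong because the product formula needs all
  smaller constants to be nonzero.\<close>

lemma norm_const_eq: "norm_const n = fact n * (2 / qp q) ^ n"
proof (induction n rule: less_induct)
  case (less n)
  have nz: "norm_const m \<noteq> 0" if "m < n" for m
    using less[OF that] qp_nonzero[OF q1] by simp
  \<comment> \<open>Any sequence in \<open>[0, 1)\<close> with limit 1 would serve. It is chosen for
    the square root \<open>s\<close> of \<open>t\<close>, in terms of which
    \<open>int_II_product\<close> is stated, and \<open>r\<close> is its square.\<close>
  define s where "s k = 1 - 1 / real (k + 2)" for k
  define r where "r k = (s k)\<^sup>2" for k
  have s: "0 \<le> s k" "s k < 1" for k by (auto simp: s_def field_simps)
  have "s \<longlonglongrightarrow> 1 - 0"
    unfolding s_def by (intro tendsto_diff tendsto_const LIMSEQ_ignore_initial_segment[OF lim_1_over_n])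
  hence "r \<longlonglongrightarrow> 1\<^sup>2" unfolding r_def by (intro tendsto_power) simp
  hence r: "0 \<le> r k" "r k < 1" "r \<longlonglongrightarrow> 1" for k
    using s[of k] by (auto simp: r_def power_less_one_iff)
  let ?ps = "replicate 4 0 :: complex list"
  have J: "int_II (of_real (r k)) ?ps {1..n} = norm_const n * (\<Prod>m<n. qp (of_real (r k)) / qp (of_real (r k) ^ Suc m))" for k
  proof -
    have "int_II ((of_real (s k))\<^sup>2) ?ps {1..n} = norm_const n * (\<Prod>m<n. qp ((of_real (s k))\<^sup>2) * qp (((of_real (s k))\<^sup>2) ^ (n - 1 + m) * prod_list ?ps) / (qp (((of_real (s k))\<^sup>2) ^ Suc m) * pair_qp (map ((*) (of_real (s k) ^ m)) ?ps)))"
      by (rule int_II_product) (use s[of k] nz in auto)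
    thus ?thesis by (simp add: r_def numeral_eq_Suc del: power_Suc)
  qed
  have "(\<lambda>k. int_II (of_real (r k)) ?ps {1..n}) \<longlonglongrightarrow> norm_const n * (\<Prod>m<n. 1 / of_nat (Suc m))"
    unfolding J by (intro tendsto_mult tendsto_const tendsto_prod qp_quotient_limit r)
  moreover have "(\<lambda>k. int_II (of_real (r k)) ?ps {1..n}) \<longlonglongrightarrow> (\<integral>z. \<tau> ?ps z \<partial>circ) ^ card {1..n}"
    by (rule int_II_limit) (use r in auto)
  ultimately have "norm_const n * (\<Prod>m<n. 1 / of_nat (Suc m)) = (\<integral>z. \<tau> ?ps z \<partial>circ) ^ card {1..n}"
    by (rule LIMSEQ_unique)
  also have "(\<integral>z. \<tau> ?ps z \<partial>circ) = norm_const 1"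
    unfolding norm_const_def by (subst norm_const_1_eq[symmetric]) auto
  also have "(\<Prod>m<n. 1 / of_nat (Suc m)) = 1 / (fact n :: complex)"
    by (induction n) (simp_all add: mult_ac)
  finally show ?case unfolding norm_const_1 by (simp add: field_simps)
qed

theorem type_II_integral:
  assumes "norm s < 1" "\<And>a. a \<in> set ps \<Longrightarrow> norm a < 1" "length ps = 4"
  shows "int_II (s\<^sup>2) ps {1..n} = fact n * (2 / qp q) ^ n *
    (\<Prod>m<n. qp (s\<^sup>2) * qp ((s\<^sup>2) ^ (n - 1 + m) * prod_list ps) / (qp ((s\<^sup>2) ^ Suc m) * pair_qp (map ((*) (s ^ m)) ps)))"
  unfolding norm_const_eq[symmetric]
  by (rule int_II_product) (use assms qp_nonzero[OF q1] in \<open>auto simp: norm_const_eq\<close>)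

end

section \<open>Symmetrisation over the hyperoctahedral group\<close>

text \<open>A version of \<open>pprod_insert\<close> for factors without symmetry: when the new
  index is the largest, it is the second one in each new pair.\<close>

lemma pprod_insert_max:
  assumes "finite A" "\<And>i. i \<in> A \<Longrightarrow> i < k"
  shows "pprod (insert k A) s x = (\<Prod>i\<in>A. s (x i) (x k)) * pprod A s x"
proof -
  have eq: "{(i, j). i \<in> insert k A \<and> j \<in> insert k A \<and> i < j} = (\<lambda>i. (i, k)) ` A \<union> {(i, j). i \<in> A \<and> j \<in> A \<and> i < j}"
    using assms(2) by (auto dest: less_asym)
  have "pprod (insert k A) s x = (\<Prod>(i, j)\<in>(\<lambda>i. (i, k)) ` A. s (x i) (x j)) * pprod A s x"
    unfolding pprod_def eq by (rule prod.union_disjoint) (use assms finite_pairs in auto)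
  also have "(\<Prod>(i, j)\<in>(\<lambda>i. (i, k)) ` A. s (x i) (x j)) = (\<Prod>i\<in>A. s (x i) (x k))"
    by (subst prod.reindex) (auto simp: inj_on_def)
  finally show ?thesis .
qed

lemma pprod_swap:
  assumes "finite B" "k \<in> B" "l \<in> B" "\<And>u v. s u v = s v u"
    and y: "\<And>j. j \<in> B \<Longrightarrow> y j = x (Transposition.transpose k l j)"
  shows "pprod B s y = pprod B s x"
proof (cases "k = l")
  case True
  thus ?thesis using y by (intro pprod_cong) auto
next
  case False
  have *: "pprod B s z = s (z k) (z l) * (\<Prod>j\<in>B - {k} - {l}. s (z k) (z j) * s (z l) (z j)) * pprod (B - {k} - {l}) s z" for z
  proof -
    have "pprod B s z = (\<Prod>j\<in>B - {k}. s (z k) (z j)) * pprod (B - {k}) s z"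
      by (rule pprod_remove) (use assms in auto)
    also have "pprod (B - {k}) s z = (\<Prod>j\<in>B - {k} - {l}. s (z l) (z j)) * pprod (B - {k} - {l}) s z"
      by (rule pprod_remove) (use assms False in auto)
    also have "(\<Prod>j\<in>B - {k}. s (z k) (z j)) = s (z k) (z l) * (\<Prod>j\<in>B - {k} - {l}. s (z k) (z j))"
      by (rule prod.remove) (use assms False in auto)
    finally show ?thesis by (simp add: prod.distrib mult_ac)
  qed
  have yk: "y k = x l" "y l = x k" using y assms(2,3) by auto
  have yj: "y j = x j" if "j \<in> B - {k} - {l}" for j using y[of j] that by auto
  have "(\<Prod>j\<in>B - {k} - {l}. s (y k) (y j) * s (y l) (y j)) = (\<Prod>j\<in>B - {k} - {l}. s (x k) (x j) * s (x l) (x j))"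
    by (rule prod.cong[OF refl]) (simp add: yk yj mult_ac)
  moreover have "pprod (B - {k} - {l}) s y = pprod (B - {k} - {l}) s x"
    by (rule pprod_cong) (use yj in auto)
  ultimately show ?thesis unfolding * yk by (simp add: assms(4)[of "x l" "x k"])
qed

context nome
begin

text \<open>\<open>\<delta>\<close> and \<open>\<omega>\<close> are the factors of the inverse of \<open>Delta_CC_plus\<close>; they differ from the
  factors of the inverse of \<open>Nabla_CC\<close> by the rational functions \<open>\<phi>\<close> and \<open>\<psi>\<close>.\<close>

definition \<delta> :: "complex \<Rightarrow> complex \<Rightarrow> complex \<Rightarrow> complex" where
  "\<delta> t u v = qp (u * inverse v) * qp (u * v) * qp (q * inverse u * v) * qp (q * inverse u * inverse v) *
    inverse (qp (t * u * inverse v) * qp (t * u * v) * qp (t * q * inverse u * v) * qp (t * q * inverse u * inverse v))"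

definition \<omega> :: "complex \<Rightarrow> complex \<Rightarrow> complex \<Rightarrow> complex \<Rightarrow> complex \<Rightarrow> complex" where
  "\<omega> a b c d u = qp (u\<^sup>2) * qp (q * inverse (u\<^sup>2)) *
     inverse (qp (c * u) * qp (q * c * inverse u) * qp (d * u) * qp (q * d * inverse u) *
       qp (a * u) * qp (a * inverse u) * qp (b * u) * qp (b * inverse u))"

definition \<rho> :: "complex \<Rightarrow> complex \<Rightarrow> complex \<Rightarrow> complex" where
  "\<rho> t u v = \<sigma> u v * inverse (\<sigma>t t u v)"

definition \<phi> :: "complex \<Rightarrow> complex \<Rightarrow> complex \<Rightarrow> complex" where
  "\<phi> t u v = (u - t * v) * (u - t * inverse v) / ((u - v) * (u - inverse v))"

definition \<psi> :: "complex \<Rightarrow> complex \<Rightarrow> complex \<Rightarrow> complex" where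
  "\<psi> c d u = (u - c) * (u - d) / (u\<^sup>2 - 1)"

lemma one_minus_nonzero: "norm t < 1 \<Longrightarrow> norm w = 1 \<Longrightarrow> 1 - t * w \<noteq> (0 :: complex)"
proof
  assume "norm t < 1" "norm w = 1" "1 - t * w = 0"
  hence "norm (t * w) = 1" by simp
  thus False using \<open>norm t < 1\<close> \<open>norm w = 1\<close> by (simp add: norm_mult)
qed

lemma inverse_qp_shift: "norm t < 1 \<Longrightarrow> norm w = 1 \<Longrightarrow> inverse (qp (q * t * w)) = inverse (qp (t * w)) * (1 - t * w)"
  unfolding qp_Suc[of "t * w"] using one_minus_nonzero[of t w] by (simp add: mult_ac)

text \<open>Two of the four factorials, above as well as below, differ from those of
  \<open>\<rho>\<close> by a shift by \<open>q\<close>, and the factors split off form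
  \<open>\<phi>\<close>. Genericity keeps the denominator of \<open>\<phi>\<close> away from
  0.\<close>

lemma \<delta>_eq:
  assumes t: "norm t < 1" and n: "norm u = 1" "norm v = 1" and g: "u \<noteq> v" "u * v \<noteq> 1"
  shows "\<delta> t u v = \<rho> t u v * \<phi> t u v"
proof -
  have nz: "u \<noteq> 0" "v \<noteq> 0" using n by auto
  have g': "1 - inverse u * v \<noteq> 0" "1 - inverse u * inverse v \<noteq> 0"
    using g nz by (auto simp: field_simps)
  have i: "norm (inverse u * v) = 1" "norm (inverse u * inverse v) = 1" using n by (auto simp: norm_mult norm_inverse)
  have s: "qp (inverse u * v) = (1 - inverse u * v) * qp (q * inverse u * v)"
    "qp (inverse u * inverse v) = (1 - inverse u * inverse v) * qp (q * inverse u * inverse v)"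
    by (subst qp_Suc, simp add: mult_ac)+
  have ti: "inverse (qp (t * q * inverse u * v)) = inverse (qp (t * inverse u * v)) * (1 - t * (inverse u * v))"
     "inverse (qp (t * q * inverse u * inverse v)) = inverse (qp (t * inverse u * inverse v)) * (1 - t * (inverse u * inverse v))"
    using inverse_qp_shift[OF t i(1)] inverse_qp_shift[OF t i(2)] by (simp_all add: mult_ac)
  have \<phi>: "\<phi> t u v = ((1 - t * (inverse u * v)) * (1 - t * (inverse u * inverse v))) / ((1 - inverse u * v) * (1 - inverse u * inverse v))"
  proof -
    have "(u - t * v) * (u - t * inverse v) = u\<^sup>2 * ((1 - t * (inverse u * v)) * (1 - t * (inverse u * inverse v)))"
      "(u - v) * (u - inverse v) = u\<^sup>2 * ((1 - inverse u * v) * (1 - inverse u * inverse v))"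
      using nz by (simp_all add: field_simps power2_eq_square)
    thus ?thesis using nz unfolding \<phi>_def by simp
  qed
  define A B where "A = 1 - inverse u * v" and "B = 1 - inverse u * inverse v"
  have "A \<noteq> 0" "B \<noteq> 0" using g' by (auto simp: A_def B_def)
  hence "A * (B * (inverse A * inverse B)) = 1" by (simp add: field_simps)
  show ?thesis
    unfolding \<delta>_def \<rho>_def \<sigma>_def \<sigma>t_def inverse_mult_distrib ti s \<phi> A_def[symmetric] B_def[symmetric]
    using \<open>A * (B * (inverse A * inverse B)) = 1\<close> by (simp add: divide_inverse mult_ac)
qed

lemma \<omega>_eq:
  assumes cd: "norm c < 1" "norm d < 1" and n: "norm u = 1" and g: "u\<^sup>2 \<noteq> 1"
  shows "\<omega> a b c d u = \<tau> [a, b, c, d] u * \<psi> c d u"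
proof -
  have nz: "u \<noteq> 0" using n by auto
  have g': "1 - inverse (u\<^sup>2) \<noteq> 0" using g nz by (auto simp: field_simps)
  have i: "norm (inverse u) = 1" using n by (auto simp: norm_inverse)
  have s: "qp (inverse (u\<^sup>2)) = (1 - inverse (u\<^sup>2)) * qp (q * inverse (u\<^sup>2))"
    by (rule qp_Suc)
  note ti = inverse_qp_shift[OF cd(1) i] inverse_qp_shift[OF cd(2) i]
  have \<psi>: "\<psi> c d u = ((1 - c * inverse u) * (1 - d * inverse u)) / (1 - inverse (u\<^sup>2))"
  proof -
    have "(u - c) * (u - d) = u\<^sup>2 * ((1 - c * inverse u) * (1 - d * inverse u))" "u\<^sup>2 - 1 = u\<^sup>2 * (1 - inverse (u\<^sup>2))"
      using nz by (simp_all add: field_simps power2_eq_square)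
    thus ?thesis using nz unfolding \<psi>_def by simp
  qed
  define A where "A = 1 - inverse (u\<^sup>2)"
  have A: "A \<noteq> 0" using g' by (simp add: A_def)
  show ?thesis
    unfolding \<omega>_def \<tau>_def list.map prod_list.Cons prod_list.Nil inverse_mult_distrib ti s \<psi> A_def[symmetric]
    using A by (simp add: divide_inverse mult_ac)
qed

lemma \<delta>_inverse [simp]: "\<delta> t u (inverse v) = \<delta> t u v"
  by (simp add: \<delta>_def mult_ac)

lemma \<rho>_sym: "\<rho> t u v = \<rho> t v u"
  by (simp add: \<rho>_def \<sigma>_sym \<sigma>t_sym)

lemma \<rho>_inverse [simp]: "\<rho> t (inverse u) v = \<rho> t u v"
  by (simp add: \<rho>_def)

lemma \<rho>_inverse2 [simp]: "\<rho> t u (inverse v) = \<rho> t u v"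
  by (subst (1 2) \<rho>_sym) simp

lemma \<phi>_inverse [simp]: "\<phi> t u (inverse v) = \<phi> t u v"
  by (simp add: \<phi>_def mult_ac)

lemma dens_II_\<rho>: "dens_II t ps S x = pprod S (\<rho> t) x * (\<Prod>i\<in>S. \<tau> ps (x i))"
  unfolding dens_II_def \<rho>_def pprod_mult pprod_inverse by simp

lemma dens_II_remove:
  assumes "finite S" "i \<in> S"
  shows "dens_II t ps S x = \<tau> ps (x i) * (\<Prod>j\<in>S - {i}. \<rho> t (x i) (x j)) * dens_II t ps (S - {i}) x"
  unfolding dens_II_\<rho> using assms
  by (subst pprod_remove[of S i]) (auto simp: \<rho>_sym prod.remove[of S i])

text \<open>Interpolates between the two weights: \<open>A = {}\<close> gives the reciprocal of
  \<open>Nabla_CC\<close>, \<open>B = {}\<close> that of \<open>Delta_CC_plus\<close>. The variables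
  in \<open>B\<close> are not yet ordered, and the weight keeps the hyperoctahedral symmetry in
  them.\<close>

definition hybrid :: "complex \<Rightarrow> complex \<Rightarrow> complex \<Rightarrow> complex \<Rightarrow> complex \<Rightarrow> nat set \<Rightarrow> nat set \<Rightarrow> (nat \<Rightarrow> complex) \<Rightarrow> complex" where
  "hybrid t a b c d A B x = pprod A (\<delta> t) x * (\<Prod>i\<in>A. \<omega> a b c d (x i)) * (\<Prod>i\<in>A. \<Prod>j\<in>B. \<delta> t (x i) (x j)) * dens_II t [a, b, c, d] B x"

text \<open>The factor by which \<open>hybrid\<close> changes when a variable with value
  \<open>z\<close> leaves the symmetric block, \<open>B\<close> being what remains there.\<close>

definition weyl_term :: "complex \<Rightarrow> complex \<Rightarrow> complex \<Rightarrow> (nat \<Rightarrow> complex) \<Rightarrow> nat set \<Rightarrow> complex \<Rightarrow> complex" where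
  "weyl_term t c d x B z = \<psi> c d z * (\<Prod>j\<in>B. \<phi> t z (x j))"

text \<open>The factors between \<open>A\<close> and \<open>k\<close> only move from the double
  product into \<open>pprod\<close>, as \<open>k\<close> exceeds all of \<open>A\<close>. Within
  \<open>B\<close> each \<open>\<rho>\<close> containing \<open>x k\<close> gains a
  \<open>\<phi>\<close>, and its \<open>\<tau>\<close> gains the \<open>\<psi>\<close>.\<close>

lemma hybrid_step:
  assumes fin: "finite A" "finite B" and k: "k \<in> B" "\<And>i. i \<in> A \<Longrightarrow> i < k"
    and p: "norm t < 1" "norm c < 1" "norm d < 1"
    and x: "unimodular (A \<union> B) x" "torus_generic B x"
  shows "hybrid t a b c d (insert k A) (B - {k}) x = hybrid t a b c d A B x * weyl_term t c d x (B - {k}) (x k)"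
proof -
  have kA: "k \<notin> A" using k by auto
  have n: "norm (x j) = 1" if "j \<in> B" for j using x(1) that by (auto simp: unimodular_def)
  have sq: "(x k)\<^sup>2 \<noteq> 1" using x(2) k by (auto simp: torus_generic_def)
  have ne: "x k \<noteq> x j" "x k * x j \<noteq> 1" if "j \<in> B - {k}" for j
    using x(2) k that by (auto simp: torus_generic_def)
  have 1: "\<omega> a b c d (x k) = \<tau> [a, b, c, d] (x k) * \<psi> c d (x k)"
    by (rule \<omega>_eq[OF p(2,3) n[OF k(1)] sq])
  have 2: "(\<Prod>j\<in>B - {k}. \<delta> t (x k) (x j)) = (\<Prod>j\<in>B - {k}. \<rho> t (x k) (x j)) * (\<Prod>j\<in>B - {k}. \<phi> t (x k) (x j))"
    unfolding prod.distrib[symmetric] by (rule prod.cong[OF refl], rule \<delta>_eq) (use p n k ne in auto)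
  have 3: "(\<Prod>i\<in>A. \<Prod>j\<in>B. \<delta> t (x i) (x j)) = (\<Prod>i\<in>A. \<delta> t (x i) (x k)) * (\<Prod>i\<in>A. \<Prod>j\<in>B - {k}. \<delta> t (x i) (x j))"
    unfolding prod.distrib[symmetric] by (rule prod.cong[OF refl], rule prod.remove) (use fin k in auto)
  have 4: "pprod (insert k A) (\<delta> t) x = (\<Prod>i\<in>A. \<delta> t (x i) (x k)) * pprod A (\<delta> t) x"
    by (rule pprod_insert_max[OF fin(1) k(2)])
  have 5: "dens_II t [a, b, c, d] B x = \<tau> [a, b, c, d] (x k) * (\<Prod>j\<in>B - {k}. \<rho> t (x k) (x j)) * dens_II t [a, b, c, d] (B - {k}) x"
    by (rule dens_II_remove[OF fin(2) k(1)])
  show ?thesis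
    unfolding hybrid_def weyl_term_def 3 4 5 prod.insert[OF fin(1) kA] 1 2 by (simp only: mult_ac)
qed

lemma hybrid_swap:
  assumes "finite B" "k \<in> B" "l \<in> B" "A \<inter> B = {}"
    and y: "\<And>j. j \<in> A \<union> B \<Longrightarrow> y j = x (Transposition.transpose k l j)"
  shows "hybrid t a b c d A B y = hybrid t a b c d A B x"
proof -
  have perm: "Transposition.transpose k l permutes B" using assms by (intro permutes_swap_id)
  have re: "(\<Prod>j\<in>B. f (y j)) = (\<Prod>j\<in>B. f (x j))" for f :: "complex \<Rightarrow> complex"
  proof -
    have "(\<Prod>j\<in>B. f (y j)) = (\<Prod>j\<in>B. f (x (Transposition.transpose k l j)))"
      by (rule prod.cong[OF refl]) (simp add: y)
    also have "\<dots> = (\<Prod>j\<in>B. f (x j))"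
      using prod.permute[OF perm, of "\<lambda>j. f (x j)"] by (simp add: o_def)
    finally show ?thesis .
  qed
  have yA: "y i = x i" if "i \<in> A" for i
    using y[of i] that assms by (auto simp: Transposition.transpose_def)
  have 1: "pprod A (\<delta> t) y = pprod A (\<delta> t) x" by (rule pprod_cong) (simp add: yA)
  have 2: "(\<Prod>i\<in>A. \<omega> a b c d (y i)) = (\<Prod>i\<in>A. \<omega> a b c d (x i))" by (rule prod.cong) (simp_all add: yA)
  have 3: "(\<Prod>i\<in>A. \<Prod>j\<in>B. \<delta> t (y i) (y j)) = (\<Prod>i\<in>A. \<Prod>j\<in>B. \<delta> t (x i) (x j))"
    by (rule prod.cong[OF refl]) (simp add: yA re)
  have 4: "pprod B (\<rho> t) y = pprod B (\<rho> t) x"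
    by (rule pprod_swap[OF assms(1-3) \<rho>_sym]) (use y in auto)
  show ?thesis unfolding hybrid_def dens_II_\<rho> 1 2 3 4 unfolding re ..
qed

text \<open>Variables of \<open>B\<close> enter the mixed factors as second arguments only, and
  \<open>\<delta>\<close> is invariant under inversion of the second argument.\<close>

lemma hybrid_coord_inverse:
  assumes "finite B" "l \<in> B" "A \<inter> B = {}"
  shows "hybrid t a b c d A B (x(l := inverse (x l))) = hybrid t a b c d A B x"
proof -
  let ?y = "x(l := inverse (x l))"
  have yA: "?y i = x i" if "i \<in> A" for i using that assms by auto
  have 1: "pprod A (\<delta> t) ?y = pprod A (\<delta> t) x" by (rule pprod_cong) (simp add: yA del: fun_upd_apply)
  have 2: "(\<Prod>i\<in>A. \<omega> a b c d (?y i)) = (\<Prod>i\<in>A. \<omega> a b c d (x i))" by (rule prod.cong) (simp_all add: yA del: fun_upd_apply)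
  have 3: "(\<Prod>i\<in>A. \<Prod>j\<in>B. \<delta> t (?y i) (?y j)) = (\<Prod>i\<in>A. \<Prod>j\<in>B. \<delta> t (x i) (x j))"
    by (intro prod.cong refl) (use assms in auto)
  have 4: "pprod B (\<rho> t) ?y = pprod B (\<rho> t) x"
    unfolding pprod_remove[of B l "\<rho> t", OF assms(1,2) \<rho>_sym]
    by (intro arg_cong2[of _ _ _ _ "(*)"] prod.cong pprod_cong) auto
  have 5: "(\<Prod>j\<in>B. \<tau> [a, b, c, d] (?y j)) = (\<Prod>j\<in>B. \<tau> [a, b, c, d] (x j))"
    by (intro prod.cong refl) auto
  show ?thesis unfolding hybrid_def dens_II_\<rho> 1 2 3 4 5 ..
qed

text \<open>Interpolation with the roots \<open>c\<close>, \<open>d\<close>, \<open>t * x j\<close>,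
  \<open>t / x j\<close> at the \<open>2 * m\<close> points and the extra nodes
  \<open>0, s, - s\<close>. At \<open>z = x i\<close> or its inverse the numerator contains
  \<open>(z - t * x i) * (z - t / x i) = (1 - t) * (z\<^sup>2 - t)\<close>, whose second factor
  cancels against the nodes \<open>s\<close> and \<open>- s\<close>; what is left is
  \<open>1 - t\<close> times a Weyl term.\<close>

lemma partial_fraction_W:
  assumes B: "finite B" "unimodular B x" "torus_generic B x" and s: "norm s < 1" "s \<noteq> 0" and t: "t = s\<^sup>2" and m: "m = card B" "m \<ge> 1"
  shows "(1 - t) * (\<Sum>l\<in>B. weyl_term t c d x (B - {l}) (x l) + weyl_term t c d x (B - {l}) (inverse (x l))) = (1 - t ^ m) * (1 - c * d * t ^ (m - 1))"
proof -
  define L where "L = sorted_list_of_set B"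
  have L: "distinct L" "set L = B" "length L = m" using B m by (auto simp: L_def)
  let ?cs = "[c, d] @ param_list t x L" and ?Z = "{0, s, - s}"
  have s0: "s \<noteq> - s" using s by auto
  have t0: "t \<noteq> 0" using s t by auto
  have nz: "x j \<noteq> 0" if "j \<in> B" for j using unimodular_nz[OF B(2) that] .
  have P: "(\<Prod>b\<leftarrow>?cs. z - b) = (z - c) * (z - d) * (\<Prod>j\<in>B. (z - t * x j) * (z - t * inverse (x j)))" for z
    unfolding map_append prod_list.append prod_plist_map prod_list_distinct[OF L(1)] L(2) by simp
  define F where "F z = (\<Prod>b\<leftarrow>?cs. z - b) / ((\<Prod>s\<in>?Z - {z}. z - s) * (\<Prod>j\<in>B. (z - x j) * (z - inverse (x j))))" for z
  define T where "T i z = (\<Prod>b\<leftarrow>?cs. z - b) / ((\<Prod>s\<in>?Z. z - s) * (z - inverse z) * (\<Prod>j\<in>B - {i}. (z - x j) * (z - inverse (x j))))" for i z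
  have "(\<Sum>z\<in>?Z. F z) + (\<Sum>i\<in>B. T i (x i) + T i (inverse (x i))) = 1"
    unfolding F_def T_def
    by (rule lagrange_torus[OF B(3,2,1)]) (use s s0 L m in auto)
  moreover have "(\<Sum>z\<in>?Z. F z) = F 0 + (F s + F (- s))"
    using s s0 by simp
  moreover have "F 0 = - (c * d * t ^ (2 * m) / t)"
  proof -
    have "(\<Prod>j\<in>B. (0 - t * x j) * (0 - t * inverse (x j))) = (\<Prod>j\<in>B. t\<^sup>2)"
      by (rule prod.cong[OF refl]) (use nz in \<open>simp add: power2_eq_square field_simps\<close>)
    moreover have "(\<Prod>j\<in>B. (0 - x j) * (0 - inverse (x j))) = 1"
      by (rule prod.neutral) (use nz in auto)
    moreover have "(\<Prod>s\<in>?Z - {0}. 0 - s) = - t"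
    proof -
      have "?Z - {0} = {s, - s}" using s by auto
      thus ?thesis using s0 by (simp add: t power2_eq_square)
    qed
    ultimately show ?thesis unfolding F_def P by (simp add: m power_mult)
  qed
  \<comment> \<open>For \<open>r * r = t\<close> the identity
    \<open>(r - t * x) * (r - t / x) = t * ((r - x) * (r - 1 / x))\<close> removes the variables.
    The residue at 0 is free of them as well, so the sum of the Weyl terms is a constant.\<close>
  moreover have Fr: "F r = (r - c) * (r - d) * t ^ m / (2 * t)" if r: "r = s \<or> r = - s" for r
  proof -
    have r2: "r * r = t" and r0: "r \<noteq> 0" "norm r < 1" using r s t by (auto simp: power2_eq_square)
    have Z: "?Z - {r} = {0, - r}" "0 \<noteq> - r" using r s s0 by auto
    have zZ: "(\<Prod>s\<in>?Z - {r}. r - s) = 2 * t"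
      unfolding Z(1) using Z(2) by (simp add: r2[symmetric])
    have ne: "r - x j \<noteq> 0" "r - inverse (x j) \<noteq> 0" if "j \<in> B" for j
      using r0 B(2) that by (auto simp: unimodular_def norm_inverse)
    have "(\<Prod>j\<in>B. (r - t * x j) * (r - t * inverse (x j))) = (\<Prod>j\<in>B. t * ((r - x j) * (r - inverse (x j))))"
      by (rule prod.cong[OF refl]) (use nz in \<open>simp add: field_simps r2[symmetric]\<close>)
    hence h: "(\<Prod>j\<in>B. (r - t * x j) * (r - t * inverse (x j))) = t ^ m * (\<Prod>j\<in>B. (r - x j) * (r - inverse (x j)))"
      by (simp add: prod.distrib m)
    define Q where "Q = (\<Prod>j\<in>B. (r - x j) * (r - inverse (x j)))"
    have "Q \<noteq> 0" using ne B(1) by (auto simp: Q_def)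
    moreover have "F r = (r - c) * (r - d) * (t ^ m * Q) / (2 * t * Q)"
      unfolding F_def P zZ h Q_def ..
    ultimately show ?thesis by simp
  qed
  moreover have "T i z = (1 - t) * weyl_term t c d x (B - {i}) z" if i: "i \<in> B" and z: "z = x i \<or> z = inverse (x i)" for i z
  proof -
    have xi: "x i \<noteq> 0" using nz i by auto
    have z0: "z \<noteq> 0" and nzz: "norm z = 1" using z xi B(2) i by (auto simp: unimodular_def norm_inverse)
    have zt: "z\<^sup>2 - t \<noteq> 0"
    proof
      assume "z\<^sup>2 - t = 0"
      hence "norm (z\<^sup>2) = norm t" by simp
      thus False using nzz s power_less_one_iff[of "norm s" 2] by (simp add: t norm_power)
    qed
    have zZ: "(\<Prod>s\<in>?Z. z - s) = z * (z\<^sup>2 - t)"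
      using s s0 by (simp add: t power2_eq_square algebra_simps)
    have "(\<Prod>j\<in>B. (z - t * x j) * (z - t * inverse (x j))) = (z - t * x i) * (z - t * inverse (x i)) * (\<Prod>j\<in>B - {i}. (z - t * x j) * (z - t * inverse (x j)))"
      by (rule prod.remove[OF B(1) i])
    also have "(z - t * x i) * (z - t * inverse (x i)) = (1 - t) * (z\<^sup>2 - t)"
      using z xi by (auto simp: field_simps power2_eq_square)
    finally have R: "(\<Prod>j\<in>B. (z - t * x j) * (z - t * inverse (x j))) = (1 - t) * (z\<^sup>2 - t) * (\<Prod>j\<in>B - {i}. (z - t * x j) * (z - t * inverse (x j)))" .
    have "z * (z\<^sup>2 - t) * (z - inverse z) = (z\<^sup>2 - t) * (z\<^sup>2 - 1)"
      using z0 by (simp add: field_simps power2_eq_square)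
    hence "T i z = ((z\<^sup>2 - t) / (z\<^sup>2 - t)) * (1 - t) * weyl_term t c d x (B - {i}) z"
      unfolding T_def P R zZ \<open>z * (z\<^sup>2 - t) * (z - inverse z) = (z\<^sup>2 - t) * (z\<^sup>2 - 1)\<close> weyl_term_def \<psi>_def \<phi>_def prod_dividef by (simp add: divide_inverse mult_ac)
    thus ?thesis using zt by simp
  qed
  hence "(\<Sum>i\<in>B. T i (x i) + T i (inverse (x i))) = (1 - t) * (\<Sum>l\<in>B. weyl_term t c d x (B - {l}) (x l) + weyl_term t c d x (B - {l}) (inverse (x l)))"
    unfolding sum_distrib_left by (intro sum.cong refl) (simp add: distrib_left)
  ultimately have "(1 - t) * (\<Sum>l\<in>B. weyl_term t c d x (B - {l}) (x l) + weyl_term t c d x (B - {l}) (inverse (x l))) =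
      1 + c * d * t ^ (2 * m) / t - (F s + F (- s))"
    by (simp add: algebra_simps)
  also have "F s + F (- s) = (t + c * d) * t ^ m / t"
    using t0 by (simp add: Fr field_simps t power2_eq_square)
  also have "1 + c * d * t ^ (2 * m) / t - (t + c * d) * t ^ m / t = (1 - t ^ m) * (1 - c * d * t ^ (m - 1))"
  proof -
    obtain m' where m': "m = Suc m'" using m(2) by (cases m) auto
    show ?thesis using t0 by (simp add: m' field_simps power_add[symmetric] mult_2 mult_2_right)
  qed
  finally show ?thesis .
qed

lemma bdd_meas_hybrid:
  assumes p: "norm t < 1" "norm a < 1" "norm b < 1" "norm c < 1" "norm d < 1" and S: "A \<union> B \<subseteq> S"
  shows "bdd_meas (torus S) (hybrid t a b c d A B)"
proof -
  have q': "norm (e * q) < 1" "norm (q * e) < 1" if "norm e < 1" for e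
    using that q1 mult_strict_mono'[of "norm q" 1 "norm e" 1] by (auto simp: norm_mult mult.commute)
  have iq: "bdd_meas (torus S) (\<lambda>x. inverse (qp (e * f x * g x)))"
    if "norm e < 1" "bdd_meas (torus S) f" "bdd_meas (torus S) g" "\<And>x. x \<in> space (torus S) \<Longrightarrow> norm (f x) = 1" "\<And>x. x \<in> space (torus S) \<Longrightarrow> norm (g x) = 1" for e f g
    by (rule bdd_meas_inverse_qp[where r = "norm e"]) (use that in \<open>auto intro!: bdd_meas_mult bdd_meas_const simp: norm_mult\<close>)
  have d: "bdd_meas (torus S) (\<lambda>x. \<delta> t (x i) (x j))" if "i \<in> S" "j \<in> S" for i j
    unfolding \<delta>_def inverse_mult_distrib
    by (intro bdd_meas_mult bdd_meas_qp iq bdd_meas_const bdd_meas_coord bdd_meas_inverse_coord that p q') (auto simp: norm_coord norm_inverse that)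
  have w: "bdd_meas (torus S) (\<lambda>x. \<omega> a b c d (x i))" if "i \<in> S" for i
    unfolding \<omega>_def inverse_mult_distrib power_inverse[symmetric]
    by (intro bdd_meas_mult bdd_meas_qp bdd_meas_inverse_qp_coord bdd_meas_power bdd_meas_const bdd_meas_coord bdd_meas_inverse_coord that p q')
  have D: "bdd_meas (torus S) (dens_II t [a, b, c, d] B)"
  proof -
    have "bdd_meas (torus S) (\<lambda>x. pprod B \<sigma> x * pprod B (\<lambda>u v. inverse (\<sigma>t t u v)) x * (\<Prod>i\<in>B. \<tau> [a, b, c, d] (x i)))"
      by (intro bdd_meas_mult bdd_meas_pprod bdd_meas_\<sigma> bdd_meas_prod bdd_meas_\<tau> bdd_meas_inverse_\<sigma>t bdd_meas_coord bdd_meas_inverse_coord) (use p S in \<open>auto simp: norm_coord\<close>)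
    thus ?thesis by (simp add: dens_II_def[abs_def] pprod_inverse)
  qed
  have "bdd_meas (torus S) (\<lambda>x. pprod A (\<delta> t) x * (\<Prod>i\<in>A. \<omega> a b c d (x i)) * (\<Prod>i\<in>A. \<Prod>j\<in>B. \<delta> t (x i) (x j)) * dens_II t [a, b, c, d] B x)"
    by (intro bdd_meas_mult bdd_meas_pprod bdd_meas_prod d w D) (use S in auto)
  thus ?thesis by (simp add: hybrid_def[abs_def])
qed

text \<open>Any of the \<open>m\<close> variables of \<open>B\<close>, or its inverse, may be
  brought to position \<open>k\<close>; the torus integral is the same for all \<open>2 * m\<close>
  choices. On adding them up, the Weyl terms sum to a constant times the more symmetric
  weight.\<close>

lemma hybrid_integral_step:
  assumes fin: "finite A" "finite B" "A \<inter> B = {}" and k: "k \<in> B" "\<And>i. i \<in> A \<Longrightarrow> i < k"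
    and p: "norm a < 1" "norm b < 1" "norm c < 1" "norm d < 1" and s: "norm s < 1" "s \<noteq> 0"
  defines "t \<equiv> s\<^sup>2" and "m \<equiv> card B"
  shows "(1 - t) * (2 * of_nat m) * (\<integral>x. hybrid t a b c d (insert k A) (B - {k}) x \<partial>torus (A \<union> B)) =
    (1 - t ^ m) * (1 - c * d * t ^ (m - 1)) * (\<integral>x. hybrid t a b c d A B x \<partial>torus (A \<union> B))"
proof -
  let ?S = "A \<union> B" and ?H' = "hybrid t a b c d (insert k A) (B - {k})" and ?H = "hybrid t a b c d A B"
  have t: "norm t < 1" using s by (simp add: t_def norm_power power_less_one_iff)
  have S: "finite ?S" using fin by auto
  \<comment> \<open>The maps \<open>\<theta> l\<close>, with and without the inversion
    \<open>\<iota> l\<close>, represent the \<open>2 * m\<close> cosets of the hyperoctahedral group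
    on \<open>m - 1\<close> letters in the one on \<open>m\<close> letters.\<close>
  define \<theta> where "\<theta> l x = (\<lambda>j\<in>?S. x (Transposition.transpose k l j))" for l and x :: "nat \<Rightarrow> complex"
  define \<iota> where "\<iota> l x = x(l := inverse (x l))" for l and x :: "nat \<Rightarrow> complex"
  have bmH: "bdd_meas (torus ?S) ?H" by (rule bdd_meas_hybrid[OF t p]) auto
  have bmH': "bdd_meas (torus ?S) ?H'" by (rule bdd_meas_hybrid[OF t p]) (use k in auto)
  have perm: "Transposition.transpose k l permutes ?S" if "l \<in> B" for l
    using that k by (intro permutes_swap_id) auto
  have m\<theta>: "\<theta> l \<in> torus ?S \<rightarrow>\<^sub>M torus ?S" if l: "l \<in> B" for l
    unfolding \<theta>_def using permutes_in_image[OF perm[OF l]] by (intro measurable_restrict measurable_component_singleton) auto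
  have bdd_meas\<theta>: "bdd_meas (torus ?S) (\<lambda>x. ?H' (\<theta> l x))" if "l \<in> B" for l
    by (rule bdd_meas_compose[OF bmH' m\<theta>[OF that]])
  have int1: "(\<integral>x. ?H' (\<theta> l x) \<partial>torus ?S) = (\<integral>x. ?H' x \<partial>torus ?S)" if l: "l \<in> B" for l
    unfolding \<theta>_def by (rule torus_integral_permute[OF perm[OF l] bmH'])
  have int2: "(\<integral>x. ?H' (\<theta> l (\<iota> l x)) \<partial>torus ?S) = (\<integral>x. ?H' x \<partial>torus ?S)" if l: "l \<in> B" for l
    unfolding \<iota>_def using torus_integral_coord_inverse[OF S _ bdd_meas\<theta>[OF l], of l] l int1[OF l] by auto
  have \<theta>1: "?H' (\<theta> l x) = ?H x * weyl_term t c d x (B - {l}) (x l)" if l: "l \<in> B" and u: "unimodular ?S x" and g: "torus_generic ?S x" for l x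
  proof -
    have \<theta>x: "\<theta> l x j = x (Transposition.transpose k l j)" if "j \<in> ?S" for j using that by (simp add: \<theta>_def)
    have im: "Transposition.transpose k l j \<in> ?S" if "j \<in> ?S" for j using permutes_in_image[OF perm[OF l]] that by blast
    have inj: "Transposition.transpose k l i \<noteq> Transposition.transpose k l j" if "i \<noteq> j" for i j using that by (metis transpose_involutory)
    have u': "unimodular ?S (\<theta> l x)" using u im by (auto simp: unimodular_def \<theta>x)
    have "torus_generic ?S (\<theta> l x)"
      unfolding torus_generic_def
    proof (intro ballI conjI)
      fix i assume i: "i \<in> ?S"
      show "(\<theta> l x i)\<^sup>2 \<noteq> 1" using g im[OF i] i by (auto simp: torus_generic_def \<theta>x)
      fix j assume j: "j \<in> ?S - {i}"
      hence "Transposition.transpose k l j \<in> ?S - {Transposition.transpose k l i}" using im[of j] inj[of i j] by auto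
      thus "\<theta> l x i \<noteq> \<theta> l x j" "\<theta> l x i * \<theta> l x j \<noteq> 1"
        using g im[OF i] i j by (auto simp: torus_generic_def \<theta>x)
    qed
    hence g': "torus_generic B (\<theta> l x)" by (rule torus_generic_mono) auto
    have "?H' (\<theta> l x) = ?H (\<theta> l x) * weyl_term t c d (\<theta> l x) (B - {k}) (\<theta> l x k)"
      by (rule hybrid_step[OF fin(1,2) k t p(3,4) u' g'])
    also have "?H (\<theta> l x) = ?H x"
      by (rule hybrid_swap[OF fin(2) k(1) l fin(3)]) (simp add: \<theta>x)
    also have "\<theta> l x k = x l" using k by (simp add: \<theta>x)
    also have "weyl_term t c d (\<theta> l x) (B - {k}) (x l) = weyl_term t c d x (B - {l}) (x l)"
    proof -
      have "(\<Prod>j\<in>B - {k}. \<phi> t (x l) (\<theta> l x j)) = (\<Prod>j\<in>B - {k}. \<phi> t (x l) (x (Transposition.transpose k l j)))"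
        by (rule prod.cong) (auto simp: \<theta>x)
      also have "\<dots> = (\<Prod>j\<in>B - {l}. \<phi> t (x l) (x j))"
        by (rule prod.reindex_bij_witness[of _ "Transposition.transpose k l" "Transposition.transpose k l"])
           (use k l in \<open>auto simp: Transposition.transpose_def split: if_splits\<close>)
      finally show ?thesis by (simp add: weyl_term_def)
    qed
    finally show ?thesis .
  qed
  have \<theta>2: "?H' (\<theta> l (\<iota> l x)) = ?H x * weyl_term t c d x (B - {l}) (inverse (x l))" if l: "l \<in> B" and u: "unimodular ?S x" and g: "torus_generic ?S x" for l x
  proof -
    have nz: "x j \<noteq> 0" if "j \<in> ?S" for j using unimodular_nz[OF u that] .
    have u': "unimodular ?S (\<iota> l x)" using u by (auto simp: unimodular_def \<iota>_def norm_inverse)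
    have sq: "(x i)\<^sup>2 \<noteq> 1" "x i \<noteq> x j" "x i * x j \<noteq> 1" if "i \<in> ?S" "j \<in> ?S - {i}" for i j
      using g that by (auto simp: torus_generic_def)
    have "torus_generic ?S (\<iota> l x)"
      unfolding torus_generic_def
    proof (intro ballI conjI)
      fix i assume i: "i \<in> ?S"
      show "(\<iota> l x i)\<^sup>2 \<noteq> 1" using g i l by (auto simp: torus_generic_def \<iota>_def power_inverse)
      fix j assume j: "j \<in> ?S - {i}"
      have "x i \<noteq> x j" "x i * x j \<noteq> 1" "x i \<noteq> 0" "x j \<noteq> 0" using sq[OF i j] nz i j by auto
      thus "\<iota> l x i \<noteq> \<iota> l x j" "\<iota> l x i * \<iota> l x j \<noteq> 1"
        using j by (auto simp: \<iota>_def field_simps)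
    qed
    from \<theta>1[OF l u' this] show ?thesis
      using hybrid_coord_inverse[OF fin(2) l fin(3)] by (simp add: \<iota>_def weyl_term_def)
  qed
  have "AE x in torus ?S. (1 - t) * (\<Sum>l\<in>B. ?H' (\<theta> l x) + ?H' (\<theta> l (\<iota> l x))) = (1 - t ^ m) * (1 - c * d * t ^ (m - 1)) * ?H x"
    using AE_torus_generic[OF S] AE_space
  proof eventually_elim
    case (elim x)
    have u: "unimodular ?S x" by (rule unimodular_torus[OF elim(2)])
    have "(1 - t) * (\<Sum>l\<in>B. ?H' (\<theta> l x) + ?H' (\<theta> l (\<iota> l x))) = ?H x * ((1 - t) * (\<Sum>l\<in>B. weyl_term t c d x (B - {l}) (x l) + weyl_term t c d x (B - {l}) (inverse (x l))))"
      unfolding sum_distrib_left by (intro sum.cong refl) (simp add: \<theta>1[OF _ u elim(1)] \<theta>2[OF _ u elim(1)] algebra_simps)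
    also have "(1 - t) * (\<Sum>l\<in>B. weyl_term t c d x (B - {l}) (x l) + weyl_term t c d x (B - {l}) (inverse (x l))) = (1 - t ^ m) * (1 - c * d * t ^ (m - 1))"
      by (rule partial_fraction_W[OF fin(2) unimodular_mono[OF u] torus_generic_mono[OF elim(1)] s])
         (use k fin in \<open>auto simp: t_def m_def Suc_le_eq card_gt_0_iff\<close>)
    finally show ?case by (simp add: mult_ac)
  qed
  moreover have bdd_meas\<iota>: "bdd_meas (torus ?S) (\<lambda>x. ?H' (\<theta> l (\<iota> l x)))" if l: "l \<in> B" for l
  proof -
    have "\<iota> l \<in> torus ?S \<rightarrow>\<^sub>M torus ?S"
      unfolding \<iota>_def by (rule measurable_coord_inverse) (use l in auto)
    from bdd_meas_compose[OF bdd_meas\<theta>[OF l] this] show ?thesis .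
  qed
  ultimately have "(\<integral>x. (1 - t) * (\<Sum>l\<in>B. ?H' (\<theta> l x) + ?H' (\<theta> l (\<iota> l x))) \<partial>torus ?S) = (\<integral>x. (1 - t ^ m) * (1 - c * d * t ^ (m - 1)) * ?H x \<partial>torus ?S)"
    by (intro integral_cong_AE bdd_meas_measurable bdd_meas_mult bdd_meas_const bdd_meas_sum bdd_meas_add bdd_meas\<theta> bmH)
  also have "(\<integral>x. (1 - t) * (\<Sum>l\<in>B. ?H' (\<theta> l x) + ?H' (\<theta> l (\<iota> l x))) \<partial>torus ?S) = (1 - t) * (\<Sum>l\<in>B. (\<integral>x. ?H' (\<theta> l x) \<partial>torus ?S) + (\<integral>x. ?H' (\<theta> l (\<iota> l x)) \<partial>torus ?S))"
    by (simp add: Bochner_Integration.integral_sum Bochner_Integration.integral_add bdd_meas_integrable[OF prob_space_torus] bdd_meas\<theta> bdd_meas\<iota> bdd_meas_add)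
  also have "\<dots> = (1 - t) * (2 * of_nat m) * (\<integral>x. ?H' x \<partial>torus ?S)"
    by (simp add: int1 int2 m_def)
  finally show ?thesis by simp
qed

text \<open>The index \<open>m\<close> is the size of the symmetric block before each step, so it
  runs down from \<open>n\<close>.\<close>

lemma hybrid_integral:
  assumes p: "norm a < 1" "norm b < 1" "norm c < 1" "norm d < 1" and s: "norm s < 1" "s \<noteq> 0"
  shows "k \<le> n \<Longrightarrow> (\<integral>x. hybrid (s\<^sup>2) a b c d {1..k} {Suc k..n} x \<partial>torus {1..n}) =
    (\<Prod>m\<in>{n - k<..n}. (1 - (s\<^sup>2) ^ m) * (1 - c * d * (s\<^sup>2) ^ (m - 1)) / ((1 - s\<^sup>2) * (2 * of_nat m))) *
    int_II (s\<^sup>2) [a, b, c, d] {1..n}"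
proof (induction k)
  case 0
  show ?case by (simp add: hybrid_def int_II_def)
next
  case (Suc k)
  let ?t = "s\<^sup>2"
  have t1: "1 - ?t \<noteq> 0"
  proof
    assume "1 - ?t = 0"
    hence "norm ?t = 1" by simp
    thus False using s power_less_one_iff[of "norm s" 2] by (simp add: norm_power)
  qed
  have gen: "Y = X / D * H" if "D * Y = X * H" "D \<noteq> 0" for D Y X H :: complex
    using that by (simp add: field_simps)
  have D: "(1 - ?t) * (2 * of_nat (n - k)) \<noteq> 0" using t1 Suc.prems by simp
  have sets: "{1..k} \<union> {Suc k..n} = {1..n}" "insert (Suc k) {1..k} = {1..Suc k}" "{Suc k..n} - {Suc k} = {Suc (Suc k)..n}"
    using Suc.prems by auto
  have card: "card {Suc k..n} = n - k" by simp
  have "(1 - ?t) * (2 * of_nat (n - k)) * (\<integral>x. hybrid ?t a b c d {1..Suc k} {Suc (Suc k)..n} x \<partial>torus {1..n}) =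
      (1 - ?t ^ (n - k)) * (1 - c * d * ?t ^ (n - k - 1)) * (\<integral>x. hybrid ?t a b c d {1..k} {Suc k..n} x \<partial>torus {1..n})"
    using hybrid_integral_step[of "{1..k}" "{Suc k..n}" "Suc k" a b c d s] p s Suc.prems
    unfolding sets card by auto
  hence "(\<integral>x. hybrid ?t a b c d {1..Suc k} {Suc (Suc k)..n} x \<partial>torus {1..n}) =
      (1 - ?t ^ (n - k)) * (1 - c * d * ?t ^ (n - k - 1)) / ((1 - ?t) * (2 * of_nat (n - k))) * (\<integral>x. hybrid ?t a b c d {1..k} {Suc k..n} x \<partial>torus {1..n})"
    by (rule gen[OF _ D])
  also have "(\<integral>x. hybrid ?t a b c d {1..k} {Suc k..n} x \<partial>torus {1..n}) =
    (\<Prod>m\<in>{n - k<..n}. (1 - ?t ^ m) * (1 - c * d * ?t ^ (m - 1)) / ((1 - ?t) * (2 * of_nat m))) * int_II ?t [a, b, c, d] {1..n}"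
    by (rule Suc.IH) (use Suc.prems in auto)
  also have "{n - Suc k<..n} = insert (n - k) {n - k<..n}" using Suc.prems by auto
  ultimately show ?case by (simp add: mult_ac)
qed

end

section \<open>Laurent expansions\<close>

definition expts :: "nat \<Rightarrow> (nat \<Rightarrow> int) set" where
  "expts n = {k. \<forall>i. i \<notin> {1..n} \<longrightarrow> k i = 0}"

definition xmono :: "nat \<Rightarrow> (nat \<Rightarrow> int) \<Rightarrow> (nat \<Rightarrow> complex) \<Rightarrow> complex" where
  "xmono n k x = (\<Prod>i=1..n. x i powi k i)"

definition annulus :: "nat \<Rightarrow> real \<Rightarrow> (nat \<Rightarrow> complex) set" where
  "annulus n r = {x. \<forall>i\<in>{1..n}. 1 / r < norm (x i) \<and> norm (x i) < r}"

lemma laurent_expansion_iff: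
  "Defs.laurent_expansion n f coef \<longleftrightarrow> (\<exists>r>1. \<forall>x\<in>annulus n r. ((\<lambda>k. coef k * xmono n k x) has_sum f x) (expts n))"
  unfolding Defs.laurent_expansion_def annulus_def xmono_def expts_def by blast

lemma annulus_mono: "r \<le> r' \<Longrightarrow> 1 < r \<Longrightarrow> annulus n r \<subseteq> annulus n r'"
  unfolding annulus_def by (auto intro: order.strict_trans1[OF divide_left_mono] order.strict_trans2)

lemma torus_annulus: "unimodular {1..n} x \<Longrightarrow> 1 < r \<Longrightarrow> x \<in> annulus n r"
  by (auto simp: unimodular_def annulus_def)

lemma annulus_nz: "x \<in> annulus n r \<Longrightarrow> 1 < r \<Longrightarrow> i \<in> {1..n} \<Longrightarrow> x i \<noteq> 0"
proof
  assume "x \<in> annulus n r" "1 < r" "i \<in> {1..n}" "x i = 0"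
  hence "1 / r < 0" by (force simp: annulus_def)
  thus False using \<open>1 < r\<close> by simp
qed

lemma norm_xmono: "unimodular {1..n} x \<Longrightarrow> norm (xmono n k x) = 1"
  unfolding xmono_def prod_norm[symmetric]
  by (rule prod.neutral) (auto simp: norm_power_int unimodular_def)

lemma xmono_0 [simp]: "xmono n (\<lambda>_. 0) x = 1"
  by (simp add: xmono_def)

lemma xmono_add: "(\<And>i. i \<in> {1..n} \<Longrightarrow> x i \<noteq> 0) \<Longrightarrow> xmono n (\<lambda>i. k i + l i) x = xmono n k x * xmono n l x"
  unfolding xmono_def prod.distrib[symmetric] by (rule prod.cong) (auto simp: power_int_add)

lemma xmono_power: "xmono n (\<lambda>i. int p * m i) x = xmono n m x ^ p"
  unfolding xmono_def prod_power_distrib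
  by (rule prod.cong) (simp_all add: power_int_mult mult.commute[of "int p"])

lemma bdd_meas_powi: "bdd_meas circ (\<lambda>z. z powi k)"
  by (intro bdd_meas_circ_continuous continuous_intros) auto

lemma integral_xmono:
  assumes "k \<in> expts n"
  shows "bdd_meas (torus {1..n}) (xmono n k)"
    and "(\<integral>x. xmono n k x \<partial>torus {1..n}) = (if k = (\<lambda>_. 0) then 1 else 0)"
proof -
  have "bdd_meas (torus {1..n}) (\<lambda>x. x i powi k i)" if "i \<in> {1..n}" for i
    by (rule bdd_meas_compose[OF bdd_meas_powi measurable_component_singleton[OF that]])
  thus "bdd_meas (torus {1..n}) (xmono n k)"
    unfolding xmono_def[abs_def] by (intro bdd_meas_prod)
  have "(\<integral>x. xmono n k x \<partial>torus {1..n}) = (\<Prod>i=1..n. \<integral>z. z powi k i \<partial>circ)"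
    unfolding xmono_def
    by (rule product_sigma_finite.product_integral_prod[OF product_sigma_finite_circ])
       (auto intro!: bdd_meas_integrable prob_space_circ bdd_meas_powi)
  also have "\<dots> = (\<Prod>i=1..n. if k i = 0 then 1 else 0)"
    by (simp add: integral_circ_power)
  also have "\<dots> = (if k = (\<lambda>_. 0) then 1 else 0)"
  proof (cases "k = (\<lambda>_. 0)")
    case False
    then obtain i where "k i \<noteq> 0" by auto
    hence "i \<in> {1..n}" using assms by (auto simp: expts_def)
    hence "(\<Prod>i=1..n. if k i = 0 then 1 else 0 :: complex) = 0"
      using \<open>k i \<noteq> 0\<close> by (intro prod_zero) auto
    thus ?thesis using False by simp
  qed simp
  finally show "(\<integral>x. xmono n k x \<partial>torus {1..n}) = (if k = (\<lambda>_. 0) then 1 else 0)" .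
qed

text \<open>At the point with all coordinates 1 every monomial is 1, so the coefficients are
  absolutely summable. Hence finite partial sums approximate \<open>f\<close> uniformly on the
  torus, and the average of a partial sum is its constant coefficient.\<close>

lemma laurent_coefficient_0:
  assumes "Defs.laurent_expansion n f coef" and bdd_meas: "bdd_meas (torus {1..n}) f"
  shows "coef (\<lambda>_. 0) = (\<integral>x. f x \<partial>torus {1..n})"
proof -
  from assms(1) obtain r where r: "r > 1" and hs: "\<And>x. x \<in> annulus n r \<Longrightarrow> ((\<lambda>k. coef k * xmono n k x) has_sum f x) (expts n)"
    unfolding laurent_expansion_iff by auto
  interpret prob_space "torus {1..n}" by (rule prob_space_torus)
  have one: "unimodular {1..n} (\<lambda>_. 1)" by (simp add: unimodular_def)
  have "coef summable_on expts n"
    using hs[OF torus_annulus[OF one r]] has_sum_imp_summable by (force simp: xmono_def)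
  hence abs: "(\<lambda>k. norm (coef k)) summable_on expts n"
    by (simp add: summable_on_iff_abs_summable_on_complex)
  have "norm (coef (\<lambda>_. 0) - (\<integral>x. f x \<partial>torus {1..n})) \<le> e" if e: "e > 0" for e
  proof -
    let ?A = "\<lambda>k. norm (coef k)"
    obtain F where F: "finite F" "F \<subseteq> expts n" "dist (sum ?A F) (infsum ?A (expts n)) \<le> e"
      using infsum_finite_approximation[OF abs e] by auto
    \<comment> \<open>The exponent 0 has to be among the retained ones; enlarging the finite set
      only makes the tail smaller.\<close>
    define F' where "F' = insert (\<lambda>_. 0) F"
    have F': "finite F'" "F' \<subseteq> expts n" "(\<lambda>_. 0) \<in> F'"
      using F by (auto simp: F'_def expts_def)
    have sumF: "sum ?A F \<le> sum ?A F'" using F F' by (intro sum_mono2) (auto simp: F'_def)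
    have rest: "infsum ?A (expts n - F') = infsum ?A (expts n) - sum ?A F'"
      using infsum_Diff[of ?A "expts n" F'] abs F' by simp
    hence tail: "infsum ?A (expts n - F') \<le> e"
      using F(3) sumF by (simp add: dist_real_def)
    have approx: "norm (f x - (\<Sum>k\<in>F'. coef k * xmono n k x)) \<le> e" if x: "x \<in> space (torus {1..n})" for x
    proof -
      have u: "unimodular {1..n} x" using unimodular_torus[OF x] .
      have h: "((\<lambda>k. coef k * xmono n k x) has_sum f x) (expts n)"
        by (rule hs[OF torus_annulus[OF u r]])
      have "((\<lambda>k. coef k * xmono n k x) has_sum (f x - (\<Sum>k\<in>F'. coef k * xmono n k x))) (expts n - F')"
        by (rule has_sum_Diff[OF h has_sum_finite[OF F'(1)] F'(2)])
      hence "f x - (\<Sum>k\<in>F'. coef k * xmono n k x) = infsum (\<lambda>k. coef k * xmono n k x) (expts n - F')"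
        by (simp add: infsumI)
      also have "norm \<dots> \<le> infsum (\<lambda>k. norm (coef k * xmono n k x)) (expts n - F')"
        by (rule norm_infsum_bound) (use summable_on_subset_banach[OF abs, of "expts n - F'"] in \<open>simp add: norm_mult norm_xmono[OF u]\<close>)
      also have "\<dots> = infsum ?A (expts n - F')"
        by (simp add: norm_mult norm_xmono[OF u])
      finally show ?thesis using tail by simp
    qed
    have ints: "(\<integral>x. (\<Sum>k\<in>F'. coef k * xmono n k x) \<partial>torus {1..n}) = coef (\<lambda>_. 0)"
    proof -
      have "(\<integral>x. (\<Sum>k\<in>F'. coef k * xmono n k x) \<partial>torus {1..n}) = (\<Sum>k\<in>F'. (\<integral>x. coef k * xmono n k x \<partial>torus {1..n}))"
        by (rule Bochner_Integration.integral_sum, intro bdd_meas_integrable prob_space_torus bdd_meas_mult bdd_meas_const integral_xmono(1)) (use F' in blast)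
      also have "\<dots> = (\<Sum>k\<in>F'. if k = (\<lambda>_. 0) then coef (\<lambda>_. 0) else 0)"
      proof (rule sum.cong[OF refl])
        fix k assume "k \<in> F'"
        hence k: "k \<in> expts n" using F' by blast
        show "(\<integral>x. coef k * xmono n k x \<partial>torus {1..n}) = (if k = (\<lambda>_. 0) then coef (\<lambda>_. 0) else 0)"
          unfolding integral_mult_right_zero integral_xmono(2)[OF k] by simp
      qed
      also have "\<dots> = coef (\<lambda>_. 0)" using F' by simp
      finally show ?thesis .
    qed
    have bmS: "bdd_meas (torus {1..n}) (\<lambda>x. \<Sum>k\<in>F'. coef k * xmono n k x)"
      using F' by (intro bdd_meas_sum bdd_meas_mult bdd_meas_const integral_xmono(1)) auto
    have "(\<integral>x. f x \<partial>torus {1..n}) - coef (\<lambda>_. 0) = (\<integral>x. f x - (\<Sum>k\<in>F'. coef k * xmono n k x) \<partial>torus {1..n})"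
      unfolding ints[symmetric]
      by (rule Bochner_Integration.integral_diff[symmetric]) (intro bdd_meas_integrable prob_space_torus bdd_meas bmS)+
    also have "norm \<dots> \<le> (\<integral>x. norm (f x - (\<Sum>k\<in>F'. coef k * xmono n k x)) \<partial>torus {1..n})"
      by (rule integral_norm_bound)
    also have "\<dots> \<le> (\<integral>x. e \<partial>torus {1..n})"
    proof (rule Bochner_Integration.integral_mono)
      show "integrable (torus {1..n}) (\<lambda>x. norm (f x - (\<Sum>k\<in>F'. coef k * xmono n k x)))"
        by (intro integrable_norm bdd_meas_integrable prob_space_torus bdd_meas_diff bdd_meas bmS)
      show "integrable (torus {1..n}) (\<lambda>x. e)" by (rule integrable_const)
    qed (rule approx)
    also have "\<dots> = e" using prob_space by simp
    finally show ?thesis by (simp add: norm_minus_commute)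
  qed
  hence "norm (coef (\<lambda>_. 0) - (\<integral>x. f x \<partial>torus {1..n})) \<le> 0"
    by (rule field_le_epsilon) simp
  thus ?thesis by simp
qed

text \<open>All expansions of \<open>f\<close> have the average as constant coefficient, so the
  description in \<open>ct\<close> is that of a unique value.\<close>

lemma ct_eq_integral:
  assumes "\<exists>coef. Defs.laurent_expansion n f coef" "bdd_meas (torus {1..n}) f"
  shows "ct n f = (\<integral>x. f x \<partial>torus {1..n})"
  unfolding ct_def
  by (rule the_equality) (use assms laurent_coefficient_0[OF _ assms(2)] in metis)+

lemma laurent_cong:
  assumes "\<And>x. f x = g x" "\<exists>coef. Defs.laurent_expansion n g coef"
  shows "\<exists>coef. Defs.laurent_expansion n f coef"
  using assms by (simp add: Defs.laurent_expansion_def)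

lemma laurent_one: "\<exists>coef. Defs.laurent_expansion n (\<lambda>_. 1) coef"
proof -
  have "((\<lambda>k. (if k = (\<lambda>_. 0) then 1 else 0) * xmono n k x) has_sum 1) (expts n)" for x
  proof -
    have "((\<lambda>k. (if k = (\<lambda>_. 0) then 1 else 0) * xmono n k x) has_sum 1) {\<lambda>_. 0}"
      using has_sum_finite[of "{\<lambda>_. 0 :: int}" "\<lambda>k. (if k = (\<lambda>_. 0) then 1 else 0) * xmono n k x"] by simp
    thus ?thesis
      by (rule has_sum_cong_neutral[THEN iffD1, rotated 3]) (auto simp: expts_def)
  qed
  hence "Defs.laurent_expansion n (\<lambda>_. 1) (\<lambda>k. if k = (\<lambda>_. 0) then 1 else 0)"
    unfolding laurent_expansion_iff by (intro exI[of _ 2]) auto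
  thus ?thesis by blast
qed

lemma has_sum_product:
  fixes a :: "'a \<Rightarrow> complex" and b :: "'b \<Rightarrow> complex"
  assumes "(a has_sum s) A" "(b has_sum t) B"
  shows "((\<lambda>(k, l). a k * b l) has_sum (s * t)) (A \<times> B)"
proof -
  have a: "(\<lambda>k. norm (a k)) summable_on A" and b: "(\<lambda>k. norm (b k)) summable_on B"
    using assms by (auto dest: has_sum_imp_summable simp: summable_on_iff_abs_summable_on_complex)
  have "(\<lambda>p. norm (case p of (k, l) \<Rightarrow> a k * b l)) summable_on A \<times> B"
    unfolding Infinite_Sum.abs_summable_on_Sigma_iff
  proof (intro conjI ballI)
    show "(\<lambda>l. norm (case (k, l) of (k, l) \<Rightarrow> a k * b l)) summable_on B" for k
      using summable_on_cmult_right[OF b, of "norm (a k)"] by (simp add: norm_mult)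
    show "(\<lambda>k. norm (infsum (\<lambda>l. norm (case (k, l) of (k, l) \<Rightarrow> a k * b l)) B)) summable_on A"
    proof -
      have "infsum (\<lambda>l. norm (case (k, l) of (k, l) \<Rightarrow> a k * b l)) B = norm (a k) * infsum (\<lambda>l. norm (b l)) B" for k
        by (simp add: norm_mult infsum_cmult_right')
      moreover have "infsum (\<lambda>l. norm (b l)) B \<ge> 0" by (rule infsum_nonneg) simp
      ultimately show ?thesis using summable_on_cmult_left[OF a] by simp
    qed
  qed
  hence "(\<lambda>(k, l). a k * b l) summable_on A \<times> B"
    by (simp add: summable_on_iff_abs_summable_on_complex)
  then obtain S where S: "((\<lambda>(k, l). a k * b l) has_sum S) (A \<times> B)"
    by (auto simp: summable_on_def)
  have "((\<lambda>k. a k * t) has_sum S) A"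
    by (rule has_sum_SigmaD[OF S]) (use has_sum_cmult_right[OF assms(2)] in simp)
  moreover have "((\<lambda>k. a k * t) has_sum (s * t)) A"
    by (rule has_sum_cmult_left[OF assms(1)])
  ultimately have "S = s * t" by (rule has_sum_unique)
  with S show ?thesis by simp
qed

text \<open>The Cauchy product on the smaller polyannulus: the double series converges absolutely
  there and may be regrouped by the sum of the two exponents. The sum over one group is the new
  coefficient and does not depend on the point.\<close>

lemma laurent_mult:
  assumes "\<exists>coef. Defs.laurent_expansion n f coef" "\<exists>coef. Defs.laurent_expansion n g coef"
  shows "\<exists>coef. Defs.laurent_expansion n (\<lambda>x. f x * g x) coef"
proof -
  from assms obtain C D r1 r2 where r: "r1 > 1" "r2 > 1"
    and C: "\<And>x. x \<in> annulus n r1 \<Longrightarrow> ((\<lambda>k. C k * xmono n k x) has_sum f x) (expts n)"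
    and D: "\<And>x. x \<in> annulus n r2 \<Longrightarrow> ((\<lambda>k. D k * xmono n k x) has_sum g x) (expts n)"
    unfolding laurent_expansion_iff by blast
  let ?r = "min r1 r2"
  let ?E = "expts n"
  define coef where "coef m = infsum (\<lambda>k. C k * D (\<lambda>i. m i - k i)) ?E" for m
  have "((\<lambda>m. coef m * xmono n m x) has_sum (f x * g x)) ?E" if x: "x \<in> annulus n ?r" for x
  proof -
    have x12: "x \<in> annulus n r1" "x \<in> annulus n r2"
      using x annulus_mono[of ?r r1 n] annulus_mono[of ?r r2 n] r by auto
    have nz: "x i \<noteq> 0" if "i \<in> {1..n}" for i using annulus_nz[OF x12(1) r(1) that] .
    have "((\<lambda>(k, l). (C k * xmono n k x) * (D l * xmono n l x)) has_sum (f x * g x)) (?E \<times> ?E)"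
      by (rule has_sum_product[OF C[OF x12(1)] D[OF x12(2)]])
    also have "?this \<longleftrightarrow> ((\<lambda>(m, k). C k * D (\<lambda>i. m i - k i) * xmono n m x) has_sum (f x * g x)) (?E \<times> ?E)"
    proof (rule has_sum_reindex_bij_witness[where i = "\<lambda>(m, k). (k, \<lambda>i. m i - k i)" and j = "\<lambda>(k, l). (\<lambda>i. k i + l i, k)"])
      fix p assume "p \<in> ?E \<times> ?E"
      obtain k l where p: "p = (k, l)" by force
      show "(case (case p of (k, l) \<Rightarrow> (\<lambda>i. k i + l i, k)) of (m, k) \<Rightarrow> C k * D (\<lambda>i. m i - k i) * xmono n m x) =
            (case p of (k, l) \<Rightarrow> C k * xmono n k x * (D l * xmono n l x))"
        using xmono_add[of n x k l, OF nz] by (simp add: p)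
    qed (auto simp: expts_def)
    finally have S: "((\<lambda>(m, k). C k * D (\<lambda>i. m i - k i) * xmono n m x) has_sum (f x * g x)) (?E \<times> ?E)" .
    show ?thesis
    proof (rule has_sum_SigmaD[OF S])
      fix m assume m: "m \<in> ?E"
      have "(\<lambda>k. C k * D (\<lambda>i. m i - k i) * xmono n m x) summable_on ?E"
        using summable_on_SigmaD1[of "\<lambda>m k. C k * D (\<lambda>i. m i - k i) * xmono n m x" ?E "\<lambda>_. ?E" m] has_sum_imp_summable[OF S] m
        by simp
      hence "((\<lambda>k. C k * D (\<lambda>i. m i - k i) * xmono n m x) has_sum infsum (\<lambda>k. C k * D (\<lambda>i. m i - k i) * xmono n m x) ?E) ?E"
        by (rule has_sum_infsum)
      thus "((\<lambda>k. case (m, k) of (m, k) \<Rightarrow> C k * D (\<lambda>i. m i - k i) * xmono n m x) has_sum coef m * xmono n m x) ?E"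
        by (simp add: coef_def infsum_cmult_left')
    qed
  qed
  hence "Defs.laurent_expansion n (\<lambda>x. f x * g x) coef"
    unfolding laurent_expansion_iff using r by (intro exI[of _ ?r]) auto
  thus ?thesis by blast
qed

lemma laurent_prod:
  "finite I \<Longrightarrow> (\<And>i. i \<in> I \<Longrightarrow> \<exists>coef. Defs.laurent_expansion n (f i) coef) \<Longrightarrow> \<exists>coef. Defs.laurent_expansion n (\<lambda>x. \<Prod>i\<in>I. f i x) coef"
  by (induction I rule: finite_induct) (auto intro: laurent_one laurent_mult)

text \<open>The Taylor series of \<open>\<phi>\<close> is evaluated at the monomial; its powers have
  different exponents because \<open>m\<close> is not 0, so no coefficients collide.\<close>

lemma laurent_monomial:
  assumes hol: "\<phi> holomorphic_on ball 0 R" and R: "R > 1" and m: "m \<in> expts n" "m \<noteq> (\<lambda>_. 0)"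
  shows "\<exists>coef. Defs.laurent_expansion n (\<lambda>x. \<phi> (xmono n m x)) coef"
proof -
  define a where "a p = (deriv ^^ p) \<phi> 0 / fact p" for p
  have a: "((\<lambda>p. a p * w ^ p) has_sum \<phi> w) UNIV" if w: "norm w < R" for w
  proof -
    have sums: "(\<lambda>p. a p * v ^ p) sums \<phi> v" if "norm v < R" for v
      using holomorphic_power_series[OF hol, of v] that by (simp add: a_def)
    obtain v where v: "norm w < v" "v < R" using dense[OF w] by auto
    have v0: "0 \<le> v" using v norm_ge_zero[of w] by linarith
    \<comment> \<open>Convergence at a point farther out gives absolute convergence at
      \<open>w\<close>, as is required of an unordered sum.\<close>
    have "summable (\<lambda>p. a p * (of_real v) ^ p)"
      using sums[of "of_real v"] v v0 by (auto simp: summable_def)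
    from powser_insidea[OF this, of w] have "summable (\<lambda>p. norm (a p * w ^ p))" using v v0 by simp
    thus ?thesis by (rule norm_summable_imp_has_sum[OF _ sums[OF w]])
  qed
  define d where "d = (\<Sum>i=1..n. nat \<bar>m i\<bar>)"
  \<comment> \<open>On the annulus of radius \<open>r\<close> the monomial is bounded by
    \<open>r ^ d\<close>; taking the root of order \<open>Suc d\<close> makes this strictly less
    than \<open>R\<close>.\<close>
  define r where "r = root (Suc d) R"
  have r1: "r > 1" using R unfolding r_def by simp
  have rd: "r ^ d < R"
  proof -
    have "r ^ d < r ^ Suc d" using r1 by (intro power_strict_increasing) auto
    also have "\<dots> = R" using R unfolding r_def by (intro real_root_pow_pos2) auto
    finally show ?thesis .
  qed
  have small: "norm (xmono n m x) < R" if x: "x \<in> annulus n r" for x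
  proof -
    have "norm (xmono n m x) \<le> (\<Prod>i=1..n. r ^ nat \<bar>m i\<bar>)"
      unfolding xmono_def prod_norm[symmetric]
    proof (rule prod_mono, safe)
      fix i assume i: "i \<in> {1..n}"
      have xi: "norm (x i) < r" "1 / r < norm (x i)" using x i by (auto simp: annulus_def)
      have x0: "norm (x i) > 0" using annulus_nz[OF x r1 i] by simp
      show "norm (x i powi m i) \<le> r ^ nat \<bar>m i\<bar>"
      proof (cases "m i \<ge> 0")
        case True
        thus ?thesis using xi by (simp add: power_int_def norm_power power_mono)
      next
        case False
        have "inverse (norm (x i)) \<le> r" using xi x0 r1 by (simp add: field_simps)
        hence "inverse (norm (x i)) ^ nat (- m i) \<le> r ^ nat (- m i)" by (intro power_mono) (use x0 in auto)
        thus ?thesis using False by (simp add: power_int_def norm_power norm_inverse)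
      qed
    qed auto
    also have "\<dots> = r ^ d" by (simp add: d_def power_sum)
    finally show ?thesis using rd by simp
  qed
  let ?h = "\<lambda>p i. int p * m i"
  obtain i0 where i0: "m i0 \<noteq> 0" using m(2) by auto
  have inj: "inj ?h"
  proof (rule injI)
    fix p p' assume "?h p = ?h p'"
    from fun_cong[OF this, of i0] show "p = p'" using i0 by simp
  qed
  have hE: "range ?h \<subseteq> expts n" using m(1) by (auto simp: expts_def)
  define coef where "coef k = (if k \<in> range ?h then a (inv ?h k) else 0)" for k
  have "((\<lambda>k. coef k * xmono n k x) has_sum \<phi> (xmono n m x)) (expts n)" if x: "x \<in> annulus n r" for x
  proof -
    have "((\<lambda>k. coef k * xmono n k x) \<circ> ?h) = (\<lambda>p. a p * xmono n m x ^ p)"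
      by (auto simp: coef_def inv_f_f[OF inj] xmono_power o_def)
    hence "((\<lambda>k. coef k * xmono n k x) has_sum \<phi> (xmono n m x)) (range ?h)"
      unfolding has_sum_reindex[OF inj] using a[OF small[OF x]] by simp
    thus ?thesis
      by (rule has_sum_cong_neutral[THEN iffD1, rotated 3]) (use hE in \<open>auto simp: coef_def\<close>)
  qed
  hence "Defs.laurent_expansion n (\<lambda>x. \<phi> (xmono n m x)) coef"
    unfolding laurent_expansion_iff using r1 by (intro exI[of _ r]) auto
  thus ?thesis by blast
qed

lemma laurent_single:
  assumes "\<phi> holomorphic_on ball 0 R" "R > 1" "i \<in> {1..n}" "\<alpha> \<noteq> 0"
  shows "\<exists>coef. Defs.laurent_expansion n (\<lambda>x. \<phi> (x i powi \<alpha>)) coef"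
proof (rule laurent_cong[OF _ laurent_monomial[OF assms(1,2), of "\<lambda>k. if k = i then \<alpha> else 0"]])
  fix x :: "nat \<Rightarrow> complex"
  have "xmono n (\<lambda>k. if k = i then \<alpha> else 0) x = (\<Prod>k=1..n. if k = i then x k powi \<alpha> else 1)"
    unfolding xmono_def by (rule prod.cong) auto
  thus "\<phi> (x i powi \<alpha>) = \<phi> (xmono n (\<lambda>k. if k = i then \<alpha> else 0) x)" using assms(3) by simp
qed (use assms in \<open>auto simp: expts_def fun_eq_iff\<close>)

lemma laurent_pair:
  assumes "\<phi> holomorphic_on ball 0 R" "R > 1" "i \<in> {1..n}" "j \<in> {1..n}" "i \<noteq> j" "\<alpha> \<noteq> 0"
  shows "\<exists>coef. Defs.laurent_expansion n (\<lambda>x. \<phi> (x i powi \<alpha> * x j powi \<beta>)) coef"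
proof (rule laurent_cong[OF _ laurent_monomial[OF assms(1,2), of "\<lambda>k. if k = i then \<alpha> else if k = j then \<beta> else 0"]])
  fix x :: "nat \<Rightarrow> complex"
  have "xmono n (\<lambda>k. if k = i then \<alpha> else if k = j then \<beta> else 0) x = (\<Prod>k=1..n. (if k = i then x k powi \<alpha> else 1) * (if k = j then x k powi \<beta> else 1))"
    unfolding xmono_def by (rule prod.cong) (use assms in auto)
  also have "\<dots> = x i powi \<alpha> * x j powi \<beta>" using assms unfolding prod.distrib by simp
  finally show "\<phi> (x i powi \<alpha> * x j powi \<beta>) = \<phi> (xmono n (\<lambda>k. if k = i then \<alpha> else if k = j then \<beta> else 0) x)" by simp
qed (use assms in \<open>auto simp: expts_def fun_eq_iff split: if_splits\<close>)

section \<open>Expansions of the two weights\<close>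

context nome
begin

lemma inverse_qp_holomorphic:
  assumes "norm e < 1"
  obtains R where "R > 1" "(\<lambda>z. inverse (qp (e * z))) holomorphic_on ball 0 R"
proof -
  obtain R where R: "R > 1" "norm e * R < 1"
  proof (cases "e = 0")
    case False
    have "1 < 1 / norm e" using assms False by simp
    then obtain R where "1 < R" "R < 1 / norm e" using dense by blast
    thus ?thesis using False that by (simp add: field_simps)
  qed (use that[of 2] in auto)
  have "qp (e * z) \<noteq> 0" if "norm z < R" for z
  proof (rule qp_nonzero)
    have "norm (e * z) \<le> norm e * R" using that by (simp add: norm_mult mult_left_mono)
    thus "norm (e * z) < 1" using R by simp
  qed
  hence "(\<lambda>z. inverse (qp (e * z))) holomorphic_on ball 0 R"
    by (auto intro!: holomorphic_intros)
  thus ?thesis using that R by blast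
qed

lemma laurent_qp_single:
  assumes "i \<in> {1..n}"
  shows "\<alpha> \<noteq> 0 \<Longrightarrow> \<exists>coef. Defs.laurent_expansion n (\<lambda>x. qp (e * x i powi \<alpha>)) coef"
    and "\<alpha> \<noteq> 0 \<Longrightarrow> norm e < 1 \<Longrightarrow> \<exists>coef. Defs.laurent_expansion n (\<lambda>x. inverse (qp (e * x i powi \<alpha>))) coef"
proof -
  assume \<alpha>: "\<alpha> \<noteq> 0"
  show "\<exists>coef. Defs.laurent_expansion n (\<lambda>x. qp (e * x i powi \<alpha>)) coef"
    by (rule laurent_single[of "\<lambda>z. qp (e * z)" 2]) (use \<alpha> assms in \<open>auto intro!: holomorphic_intros\<close>)
  assume "norm e < 1"
  then obtain R where R: "R > 1" "(\<lambda>z. inverse (qp (e * z))) holomorphic_on ball 0 R"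
    by (rule inverse_qp_holomorphic)
  show "\<exists>coef. Defs.laurent_expansion n (\<lambda>x. inverse (qp (e * x i powi \<alpha>))) coef"
    by (rule laurent_single[OF R(2,1) assms \<alpha>])
qed

lemma laurent_qp_pair:
  assumes "i \<in> {1..n}" "j \<in> {1..n}" "i \<noteq> j"
  shows "\<alpha> \<noteq> 0 \<Longrightarrow> \<exists>coef. Defs.laurent_expansion n (\<lambda>x. qp (e * (x i powi \<alpha> * x j powi \<beta>))) coef"
    and "\<alpha> \<noteq> 0 \<Longrightarrow> norm e < 1 \<Longrightarrow> \<exists>coef. Defs.laurent_expansion n (\<lambda>x. inverse (qp (e * (x i powi \<alpha> * x j powi \<beta>)))) coef"
proof -
  assume \<alpha>: "\<alpha> \<noteq> 0"
  show "\<exists>coef. Defs.laurent_expansion n (\<lambda>x. qp (e * (x i powi \<alpha> * x j powi \<beta>))) coef"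
    by (rule laurent_pair[of "\<lambda>z. qp (e * z)" 2]) (use \<alpha> assms in \<open>auto intro!: holomorphic_intros\<close>)
  assume "norm e < 1"
  then obtain R where R: "R > 1" "(\<lambda>z. inverse (qp (e * z))) holomorphic_on ball 0 R"
    by (rule inverse_qp_holomorphic)
  show "\<exists>coef. Defs.laurent_expansion n (\<lambda>x. inverse (qp (e * (x i powi \<alpha> * x j powi \<beta>)))) coef"
    by (rule laurent_pair[OF R(2,1) assms \<alpha>])
qed

lemma norm_mult_q: "norm e < 1 \<Longrightarrow> norm (e * q) < 1" "norm e < 1 \<Longrightarrow> norm (q * e) < 1"
  using q1 mult_strict_mono'[of "norm q" 1 "norm e" 1] by (auto simp: norm_mult mult.commute)

lemma laurent_\<delta>:
  assumes ij: "i \<in> {1..n}" "j \<in> {1..n}" "i \<noteq> j" and t: "norm t < 1"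
  shows "\<exists>coef. Defs.laurent_expansion n (\<lambda>x. \<delta> t (x i) (x j)) coef"
proof -
  note L1 = laurent_qp_pair(1)[OF ij] and L2 = laurent_qp_pair(2)[OF ij]
  \<comment> \<open>Each argument is brought to the form coefficient times monomial, with explicit
    coefficients 1 and integer exponents, to match the pattern of
    \<open>laurent_qp_pair\<close>.\<close>
  have "\<delta> t u v = qp (1 * (u powi 1 * v powi (-1))) * qp (1 * (u powi 1 * v powi 1)) * qp (q * (u powi (-1) * v powi 1)) * qp (q * (u powi (-1) * v powi (-1))) *
    (inverse (qp (t * (u powi 1 * v powi (-1)))) * inverse (qp (t * (u powi 1 * v powi 1))) * inverse (qp (t * q * (u powi (-1) * v powi 1))) * inverse (qp (t * q * (u powi (-1) * v powi (-1)))))" for u v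
    unfolding \<delta>_def inverse_mult_distrib by (simp add: power_int_minus mult.assoc)
  thus ?thesis
    by (rule laurent_cong) (intro laurent_mult L1 L2 t norm_mult_q; simp)
qed

lemma laurent_\<rho>:
  assumes ij: "i \<in> {1..n}" "j \<in> {1..n}" "i \<noteq> j" and t: "norm t < 1"
  shows "\<exists>coef. Defs.laurent_expansion n (\<lambda>x. \<rho> t (x i) (x j)) coef"
proof -
  note L1 = laurent_qp_pair(1)[OF ij] and L2 = laurent_qp_pair(2)[OF ij]
  have "\<rho> t u v = qp (1 * (u powi 1 * v powi 1)) * qp (1 * (u powi 1 * v powi (-1))) * qp (1 * (u powi (-1) * v powi 1)) * qp (1 * (u powi (-1) * v powi (-1))) *
    (inverse (qp (t * (u powi 1 * v powi 1))) * inverse (qp (t * (u powi 1 * v powi (-1)))) * inverse (qp (t * (u powi (-1) * v powi 1))) * inverse (qp (t * (u powi (-1) * v powi (-1)))))" for u v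
    unfolding \<rho>_def \<sigma>_def \<sigma>t_def inverse_mult_distrib by (simp add: power_int_minus mult.assoc)
  thus ?thesis
    by (rule laurent_cong) (intro laurent_mult L1 L2 t norm_mult_q; simp)
qed

lemma laurent_\<omega>:
  assumes i: "i \<in> {1..n}" and p: "norm a < 1" "norm b < 1" "norm c < 1" "norm d < 1"
  shows "\<exists>coef. Defs.laurent_expansion n (\<lambda>x. \<omega> a b c d (x i)) coef"
proof -
  note L1 = laurent_qp_single(1)[OF i] and L2 = laurent_qp_single(2)[OF i]
  have "\<omega> a b c d u = qp (1 * u powi 2) * qp (q * u powi (-2)) *
     (inverse (qp (c * u powi 1)) * inverse (qp (q * c * u powi (-1))) * inverse (qp (d * u powi 1)) * inverse (qp (q * d * u powi (-1))) *
      inverse (qp (a * u powi 1)) * inverse (qp (a * u powi (-1))) * inverse (qp (b * u powi 1)) * inverse (qp (b * u powi (-1))))" for u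
    unfolding \<omega>_def inverse_mult_distrib by (simp add: power_int_minus mult.assoc)
  thus ?thesis
    by (rule laurent_cong) (intro laurent_mult L1 L2 p norm_mult_q; simp)
qed

lemma laurent_\<tau>:
  assumes i: "i \<in> {1..n}" and p: "norm a < 1" "norm b < 1" "norm c < 1" "norm d < 1"
  shows "\<exists>coef. Defs.laurent_expansion n (\<lambda>x. \<tau> [a, b, c, d] (x i)) coef"
proof -
  note L1 = laurent_qp_single(1)[OF i] and L2 = laurent_qp_single(2)[OF i]
  have "\<tau> [a, b, c, d] u = qp (1 * u powi 2) * qp (1 * u powi (-2)) *
     (inverse (qp (a * u powi 1)) * inverse (qp (a * u powi (-1))) * inverse (qp (b * u powi 1)) * inverse (qp (b * u powi (-1))) *
      inverse (qp (c * u powi 1)) * inverse (qp (c * u powi (-1))) * inverse (qp (d * u powi 1)) * inverse (qp (d * u powi (-1))))" for u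
    unfolding \<tau>_def by (simp add: power_int_minus mult.assoc)
  thus ?thesis
    by (rule laurent_cong) (intro laurent_mult L1 L2 p norm_mult_q; simp)
qed

lemma laurent_pprod:
  assumes "finite S" "\<And>i j. i \<in> S \<Longrightarrow> j \<in> S \<Longrightarrow> i < j \<Longrightarrow> \<exists>coef. Defs.laurent_expansion n (\<lambda>x. s (x i) (x j)) coef"
  shows "\<exists>coef. Defs.laurent_expansion n (pprod S s) coef"
proof -
  have "\<exists>coef. Defs.laurent_expansion n (\<lambda>x. \<Prod>p\<in>{(i, j). i \<in> S \<and> j \<in> S \<and> i < j}. s (x (fst p)) (x (snd p))) coef"
    by (rule laurent_prod[OF finite_pairs[OF assms(1)]]) (use assms(2) in auto)
  thus ?thesis by (simp add: pprod_def[abs_def] case_prod_unfold)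
qed

lemma index_pairs_eq: "index_pairs n = {(i, j). i \<in> {1..n} \<and> j \<in> {1..n} \<and> i < j}"
  by (auto simp: index_pairs_def)

lemma qpochs_simps [simp]: "qpochs [] q = 1" "qpochs (z # zs) q = qp z * qpochs zs q"
  by (simp_all add: qpochs_def)

text \<open>The identity holds at every point, since \<open>inverse (P / Q) = Q / P\<close> is true
  for \<open>Q = 0\<close> too; this is how the convention at the poles yields the analytic
  value.\<close>

lemma inverse_Nabla: "1 / Nabla_CC n q t a b c d x = dens_II t [a, b, c, d] {1..n} x"
proof -
  have 1: "inverse (\<Prod>(i, j)\<in>index_pairs n. qpochs [t * x i * inverse (x j), t * x i * x j, t * inverse (x i) * x j, t * inverse (x i) * inverse (x j)] q /
        qpochs [x i * inverse (x j), x i * x j, inverse (x i) * x j, inverse (x i) * inverse (x j)] q) = pprod {1..n} (\<rho> t) x"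
    unfolding pprod_def index_pairs_eq prod_inversef[symmetric]
    by (rule prod.cong[OF refl]) (auto simp: \<rho>_def \<sigma>_def \<sigma>t_def divide_inverse mult_ac)
  have 2: "inverse (\<Prod>i=1..n. qpochs [a * x i, a * inverse (x i), b * x i, b * inverse (x i), c * x i, c * inverse (x i), d * x i, d * inverse (x i)] q /
        qpochs [(x i)\<^sup>2, inverse ((x i)\<^sup>2)] q) = (\<Prod>i=1..n. \<tau> [a, b, c, d] (x i))"
    unfolding prod_inversef[symmetric]
    by (rule prod.cong[OF refl]) (simp add: \<tau>_def divide_inverse mult_ac)
  show ?thesis
    unfolding Nabla_CC_def dens_II_\<rho> divide_inverse[of 1] inverse_mult_distrib 1 2 by simp
qed

lemma inverse_Delta: "1 / Delta_CC_plus n q t a b c d x = hybrid t a b c d {1..n} {} x"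
proof -
  have 1: "inverse (\<Prod>(i, j)\<in>index_pairs n. qpochs [t * x i * inverse (x j), t * x i * x j, t * q * inverse (x i) * x j, t * q * inverse (x i) * inverse (x j)] q /
        qpochs [x i * inverse (x j), x i * x j, q * inverse (x i) * x j, q * inverse (x i) * inverse (x j)] q) = pprod {1..n} (\<delta> t) x"
    unfolding pprod_def index_pairs_eq prod_inversef[symmetric]
    by (rule prod.cong[OF refl]) (auto simp: \<delta>_def divide_inverse mult_ac)
  have 2: "inverse (\<Prod>i=1..n. qpochs [c * x i, q * c * inverse (x i), d * x i, q * d * inverse (x i), a * x i, a * inverse (x i), b * x i, b * inverse (x i)] q /
        qpochs [(x i)\<^sup>2, q * inverse ((x i)\<^sup>2)] q) = (\<Prod>i=1..n. \<omega> a b c d (x i))"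
    unfolding prod_inversef[symmetric]
    by (rule prod.cong[OF refl]) (simp add: \<omega>_def divide_inverse mult_ac)
  show ?thesis
    unfolding Delta_CC_plus_def hybrid_def dens_II_\<rho> divide_inverse[of 1] inverse_mult_distrib 1 2 by simp
qed

lemma ct_Nabla:
  assumes "norm t < 1" "norm a < 1" "norm b < 1" "norm c < 1" "norm d < 1"
  shows "ct n (\<lambda>x. 1 / Nabla_CC n q t a b c d x) = int_II t [a, b, c, d] {1..n}"
  unfolding inverse_Nabla int_II_def
proof (rule ct_eq_integral)
  show "\<exists>coef. Defs.laurent_expansion n (dens_II t [a, b, c, d] {1..n}) coef"
    unfolding dens_II_\<rho>[abs_def] by (intro laurent_mult laurent_pprod laurent_prod laurent_\<rho> laurent_\<tau> assms) auto
  show "bdd_meas (torus {1..n}) (dens_II t [a, b, c, d] {1..n})"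
    by (rule bdd_meas_dens_II) (use assms in auto)
qed

lemma ct_Delta:
  assumes "norm t < 1" "norm a < 1" "norm b < 1" "norm c < 1" "norm d < 1"
  shows "ct n (\<lambda>x. 1 / Delta_CC_plus n q t a b c d x) = (\<integral>x. hybrid t a b c d {1..n} {} x \<partial>torus {1..n})"
  unfolding inverse_Delta
proof (rule ct_eq_integral)
  have "\<exists>coef. Defs.laurent_expansion n (\<lambda>x. pprod {1..n} (\<delta> t) x * (\<Prod>i\<in>{1..n}. \<omega> a b c d (x i))) coef"
    by (intro laurent_mult laurent_pprod laurent_prod laurent_\<delta> laurent_\<omega> assms) auto
  thus "\<exists>coef. Defs.laurent_expansion n (hybrid t a b c d {1..n} {}) coef"
    by (simp add: hybrid_def[abs_def] dens_II_\<rho>)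
  show "bdd_meas (torus {1..n}) (hybrid t a b c d {1..n} {})"
    by (rule bdd_meas_hybrid) (use assms in auto)
qed

end

section \<open>The length functions of signed permutations\<close>

text \<open>Inversions of type B, normalised so that a decreasing list of positive letters has none:
  a pair counts once if it is increasing and once if its sum is negative.\<close>

fun stat_s :: "int list \<Rightarrow> nat" where
  "stat_s [] = 0"
| "stat_s (h # ys) = length (filter (\<lambda>y. h < y) ys) + length (filter (\<lambda>y. h + y < 0) ys) + stat_s ys"

definition stat_d :: "int list \<Rightarrow> nat" where
  "stat_d ys = length (filter (\<lambda>y. y < 0) ys)"

lemma stat_s_swap: "stat_s (xs @ b # a # ys) + (if a < b then 1 else 0) = stat_s (xs @ a # b # ys) + (if b < a then 1 else 0)" for a b :: int
  by (induction xs) (auto simp: add.commute)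

text \<open>For an earlier letter \<open>h\<close> the conditions \<open>h < a\<close> and
  \<open>h + a < 0\<close> change places when \<open>a\<close> is negated.\<close>

lemma stat_s_negate_last: "stat_s (xs @ [- a]) = stat_s (xs @ [a])"
  by (induction xs) auto

lemma stat_d_swap: "stat_d (xs @ b # a # ys) = stat_d (xs @ a # b # ys)"
  by (simp add: stat_d_def)

text \<open>Reverses the moduli and keeps the signs. The identity then has the window
  \<open>n, ..., 1\<close>, so that changing the sign of the last entry affects the letter of least
  modulus and creates no inversion.\<close>

definition flip :: "nat \<Rightarrow> int \<Rightarrow> int" where
  "flip n a = (if a > 0 then int n + 1 - a else if a < 0 then - (int n + 1 + a) else 0)"

lemma flip_uminus: "flip n (- a) = - flip n a"
  by (simp add: flip_def)

lemma flip_val: "\<bar>a\<bar> \<le> int n \<Longrightarrow> flip n (flip n a) = a"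
  by (auto simp: flip_def)

lemma abs_flip: "a \<noteq> 0 \<Longrightarrow> \<bar>a\<bar> \<le> int n \<Longrightarrow> \<bar>flip n a\<bar> = int n + 1 - \<bar>a\<bar>"
  by (auto simp: flip_def)

lemma signed_perms_id: "id \<in> signed_perms n"
  by (auto simp: signed_perms_def permutes_id)

lemma signed_perms_comp: "v \<in> signed_perms n \<Longrightarrow> w \<in> signed_perms n \<Longrightarrow> v \<circ> w \<in> signed_perms n"
  by (auto simp: signed_perms_def intro: permutes_compose)

lemma signed_perms_inv: "w \<in> signed_perms n \<Longrightarrow> inv w \<in> signed_perms n"
proof -
  assume w: "w \<in> signed_perms n"
  hence p: "w permutes {- int n..int n}" and odd: "\<And>i. w (- i) = - w i" by (auto simp: signed_perms_def)
  have "inv w (- i) = - inv w i" for i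
    using odd[of "inv w i"] permutes_inverses[OF p] by metis
  thus ?thesis using permutes_inv[OF p] by (auto simp: signed_perms_def)
qed

lemma signed_perms_bij: "w \<in> signed_perms n \<Longrightarrow> bij w"
  by (auto simp: signed_perms_def permutes_bij)

lemma signed_perms_range:
  assumes "w \<in> signed_perms n" "i \<noteq> 0" "\<bar>i\<bar> \<le> int n"
  shows "w i \<noteq> 0" "\<bar>w i\<bar> \<le> int n"
proof -
  have p: "w permutes {- int n..int n}" and odd: "w (- i) = - w i" using assms by (auto simp: signed_perms_def)
  have "w i \<in> {- int n..int n}" using permutes_in_image[OF p, of i] assms by auto
  thus "\<bar>w i\<bar> \<le> int n" by auto
  show "w i \<noteq> 0"
  proof
    assume "w i = 0"
    hence "w (- i) = w i" using odd by simp
    hence "- i = i" using permutes_inj[OF p] by (simp add: inj_eq)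
    thus False using assms by simp
  qed
qed

lemma simple_refl_apply:
  assumes "1 \<le> i" "i < n"
  shows "simple_refl n i j = (if j = int i then int i + 1 else if j = int i + 1 then int i
    else if j = - int i then - (int i + 1) else if j = - (int i + 1) then - int i else j)"
proof -
  have "simple_refl n i j = Transposition.transpose (int i) (int i + 1) (Transposition.transpose (- int i) (- (int i + 1)) j)"
    using assms by (simp add: simple_refl_def)
  also have "Transposition.transpose (- int i) (- (int i + 1)) j =
      (if j = - int i then - (int i + 1) else if j = - (int i + 1) then - int i else j)"
    by (simp only: Transposition.transpose_def)
  finally show ?thesis
    using assms unfolding Transposition.transpose_def by presburger
qed

lemma simple_refl_last: "simple_refl n n j = (if j = int n then - int n else if j = - int n then int n else j)"
  by (simp add: simple_refl_def Transposition.transpose_def)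

lemma simple_refl_signed: "i \<in> {1..n} \<Longrightarrow> simple_refl n i \<in> signed_perms n"
proof -
  assume i: "i \<in> {1..n}"
  have "simple_refl n i permutes {- int n..int n}"
  proof (cases "i < n")
    case True
    show ?thesis unfolding simple_refl_def if_P[OF True]
      by (intro permutes_compose permutes_swap_id) (use i True in auto)
  next
    case False
    show ?thesis unfolding simple_refl_def if_not_P[OF False]
      by (intro permutes_swap_id) auto
  qed
  moreover have "simple_refl n i (- j) = - simple_refl n i j" for j
  proof (cases "i < n")
    case True
    have i1: "1 \<le> i" using i by simp
    show ?thesis unfolding simple_refl_apply[OF i1 True] using i1 by presburger
  next
    case False
    hence "i = n" using i by simp
    show ?thesis unfolding \<open>i = n\<close> simple_refl_last by presburger
  qed
  ultimately show ?thesis by (auto simp: signed_perms_def)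
qed

lemma simple_refl_involution:
  assumes i: "i \<in> {1..n}" shows "simple_refl n i \<circ> simple_refl n i = id"
proof (rule ext)
  fix j
  show "(simple_refl n i \<circ> simple_refl n i) j = id j"
  proof (cases "i < n")
    case True
    have i1: "1 \<le> i" using i by simp
    show ?thesis unfolding o_apply id_apply simple_refl_apply[OF i1 True] using i1 by presburger
  next
    case False
    hence "i = n" using i by simp
    show ?thesis unfolding \<open>i = n\<close> o_apply id_apply simple_refl_last by presburger
  qed
qed

text \<open>The one-line notation of the inverse, with the positive letters in reversed order: composing
  \<open>w\<close> on the left with a simple reflection then exchanges two neighbouring entries or changes the
  sign of the last one, so it changes exactly one of \<open>stat_s\<close> and \<open>stat_d\<close>, by one.\<close>

definition window :: "nat \<Rightarrow> (int \<Rightarrow> int) \<Rightarrow> int list" where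
  "window n w = map (\<lambda>j. flip n (inv w (int j))) [1..<Suc n]"

lemma inv_simple_comp:
  assumes "w \<in> signed_perms n" "i \<in> {1..n}"
  shows "inv (simple_refl n i \<circ> w) = inv w \<circ> simple_refl n i"
proof -
  have "bij (simple_refl n i)" "bij w"
    using assms simple_refl_signed signed_perms_bij by auto
  moreover have "inv (simple_refl n i) = simple_refl n i"
    by (rule inv_unique_comp[OF simple_refl_involution[OF assms(2)] simple_refl_involution[OF assms(2)]])
  ultimately show ?thesis by (simp add: o_inv_distrib)
qed

lemma upt_split: "1 \<le> i \<Longrightarrow> i < n \<Longrightarrow> [1..<Suc n] = [1..<i] @ i # Suc i # [Suc (Suc i)..<Suc n]"
proof -
  assume "1 \<le> i" "i < n"
  hence "[1..<Suc n] = [1..<i] @ [i..<Suc n]" using upt_add_eq_append[of 1 i "Suc n - i"] by simp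
  also have "[i..<Suc n] = i # Suc i # [Suc (Suc i)..<Suc n]"
    using \<open>i < n\<close> by (simp add: upt_conv_Cons)
  finally show ?thesis .
qed

lemma window_split:
  assumes "1 \<le> i" "i < n"
  obtains xs ys where "window n w = xs @ flip n (inv w (int i)) # flip n (inv w (int (Suc i))) # ys"
    and "w \<in> signed_perms n \<Longrightarrow> window n (simple_refl n i \<circ> w) = xs @ flip n (inv w (int (Suc i))) # flip n (inv w (int i)) # ys"
proof -
  let ?F = "\<lambda>v j. flip n (v (int j))"
  let ?xs = "map (?F (inv w)) [1..<i]" and ?ys = "map (?F (inv w)) [Suc (Suc i)..<Suc n]"
  have 1: "window n w = ?xs @ flip n (inv w (int i)) # flip n (inv w (int (Suc i))) # ?ys"
    unfolding window_def upt_split[OF assms] by simp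
  have "window n (simple_refl n i \<circ> w) = ?xs @ flip n (inv w (int (Suc i))) # flip n (inv w (int i)) # ?ys" if w: "w \<in> signed_perms n"
  proof -
    have *: "inv (simple_refl n i \<circ> w) = inv w \<circ> simple_refl n i"
      using inv_simple_comp[OF w] assms by auto
    have s: "simple_refl n i (int j) = int j" if "j \<noteq> i" "j \<noteq> Suc i" for j
      using assms that by (simp add: simple_refl_apply)
    have s': "simple_refl n i (int i) = int (Suc i)" "simple_refl n i (int (Suc i)) = int i"
      using assms by (simp_all add: simple_refl_apply)
    have "map (?F (inv w \<circ> simple_refl n i)) [1..<i] = ?xs" "map (?F (inv w \<circ> simple_refl n i)) [Suc (Suc i)..<Suc n] = ?ys"
      by (auto simp: s)
    thus ?thesis
      unfolding window_def * upt_split[OF assms] map_append list.map o_apply s' by (simp add: o_def)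
  qed
  with 1 that show ?thesis by blast
qed

lemma window_split_last:
  assumes "n \<ge> 1"
  obtains xs where "window n w = xs @ [flip n (inv w (int n))]"
    and "w \<in> signed_perms n \<Longrightarrow> window n (simple_refl n n \<circ> w) = xs @ [- flip n (inv w (int n))]"
proof -
  have upt: "[1..<Suc n] = [1..<n] @ [n]" using assms by simp
  let ?F = "\<lambda>v j. flip n (v (int j))"
  let ?xs = "map (?F (inv w)) [1..<n]"
  have 1: "window n w = ?xs @ [flip n (inv w (int n))]" unfolding window_def upt by simp
  have "window n (simple_refl n n \<circ> w) = ?xs @ [- flip n (inv w (int n))]" if w: "w \<in> signed_perms n"
  proof -
    have *: "inv (simple_refl n n \<circ> w) = inv w \<circ> simple_refl n n"
      using inv_simple_comp[OF w] assms by auto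
    have s: "simple_refl n n (int j) = int j" if "j < n" for j
      using assms that by (simp add: simple_refl_last)
    have s': "simple_refl n n (int n) = - int n" by (simp add: simple_refl_last)
    have "inv w (- int n) = - inv w (int n)"
      using signed_perms_inv[OF w] by (auto simp: signed_perms_def)
    moreover have "map (?F (inv w \<circ> simple_refl n n)) [1..<n] = ?xs" by (auto simp: s)
    ultimately show ?thesis
      unfolding window_def * upt map_append list.map o_apply s' by (simp add: flip_uminus o_def)
  qed
  with 1 that show ?thesis by blast
qed

lemma window_step:
  assumes w: "w \<in> signed_perms n" and i: "i \<in> {1..n}"
  shows "stat_s (window n (simple_refl n i \<circ> w)) \<le> stat_s (window n w) + (if i < n then 1 else 0)"
    and "stat_d (window n (simple_refl n i \<circ> w)) \<le> stat_d (window n w) + (if i = n then 1 else 0)"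
proof -
  have "stat_s (window n (simple_refl n i \<circ> w)) \<le> stat_s (window n w) + (if i < n then 1 else 0) \<and>
        stat_d (window n (simple_refl n i \<circ> w)) \<le> stat_d (window n w) + (if i = n then 1 else 0)"
  proof (cases "i < n")
    case True
    have i1: "1 \<le> i" using i by simp
    obtain xs ys where Ys: "window n w = xs @ flip n (inv w (int i)) # flip n (inv w (int (Suc i))) # ys"
      "window n (simple_refl n i \<circ> w) = xs @ flip n (inv w (int (Suc i))) # flip n (inv w (int i)) # ys"
      using window_split[OF i1 True, of w] w by metis
    show ?thesis
      unfolding Ys using stat_s_swap[of xs "flip n (inv w (int (Suc i)))" "flip n (inv w (int i))" ys] True
      by (auto simp: stat_d_swap split: if_splits)
  next
    case False
    hence [simp]: "i = n" using i by auto
    have n1: "n \<ge> 1" using i by simp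
    obtain xs where Ys: "window n w = xs @ [flip n (inv w (int n))]" "window n (simple_refl n n \<circ> w) = xs @ [- flip n (inv w (int n))]"
      using window_split_last[OF n1, of w] w by metis
    show ?thesis unfolding \<open>i = n\<close> Ys by (simp add: stat_s_negate_last stat_d_def)
  qed
  thus "stat_s (window n (simple_refl n i \<circ> w)) \<le> stat_s (window n w) + (if i < n then 1 else 0)"
    and "stat_d (window n (simple_refl n i \<circ> w)) \<le> stat_d (window n w) + (if i = n then 1 else 0)" by blast+
qed

lemma window_id: "stat_s (window n id) = 0" "stat_d (window n id) = 0"
proof -
  have Yid: "window n id = map (\<lambda>j. int n + 1 - int j) [1..<Suc n]"
    unfolding window_def by (rule map_cong) (auto simp: flip_def)
  have "stat_s ys = 0" if "sorted_wrt (>) ys" "\<forall>y\<in>set ys. y > 0" for ys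
    using that by (induction ys) (auto simp: filter_empty_conv)
  moreover have "sorted_wrt (>) (window n id)"
    unfolding Yid sorted_wrt_map by (rule sorted_wrt_mono_rel[OF _ sorted_wrt_upt]) auto
  moreover have pos: "\<forall>y\<in>set (window n id). y > 0" unfolding Yid by auto
  ultimately show "stat_s (window n id) = 0" by blast
  show "stat_d (window n id) = 0" unfolding stat_d_def using pos by (auto simp: filter_empty_conv)
qed

lemma word_prod_simps: "word_prod n [] = id" "word_prod n (i # is) = simple_refl n i \<circ> word_prod n is"
  by (simp_all add: word_prod_def)

text \<open>The estimate holds for each kind of letter separately. A bound on the total length alone
  would not determine the two counts in a reduced word.\<close>

lemma word_bound:
  assumes "set is \<subseteq> {1..n}"
  shows "word_prod n is \<in> signed_perms n \<and> stat_s (window n (word_prod n is)) \<le> length (filter (\<lambda>i. i < n) is)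
     \<and> stat_d (window n (word_prod n is)) \<le> length (filter (\<lambda>i. i = n) is)"
  using assms
proof (induction "is")
  case Nil
  show ?case unfolding word_prod_simps window_id by (intro conjI signed_perms_id) simp_all
next
  case (Cons i "is")
  hence i: "i \<in> {1..n}" and IH: "word_prod n is \<in> signed_perms n"
    "stat_s (window n (word_prod n is)) \<le> length (filter (\<lambda>i. i < n) is)" "stat_d (window n (word_prod n is)) \<le> length (filter (\<lambda>i. i = n) is)" by auto
  show ?case
    unfolding word_prod_simps
  proof (intro conjI)
    show "simple_refl n i \<circ> word_prod n is \<in> signed_perms n"
      by (rule signed_perms_comp[OF simple_refl_signed[OF i] IH(1)])
    have "length (filter (\<lambda>i. i < n) (i # is)) = length (filter (\<lambda>i. i < n) is) + (if i < n then 1 else 0)" by simp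
    thus "stat_s (window n (simple_refl n i \<circ> word_prod n is)) \<le> length (filter (\<lambda>i. i < n) (i # is))"
      using window_step(1)[OF IH(1) i] IH(2) by linarith
    have "length (filter (\<lambda>i. i = n) (i # is)) = length (filter (\<lambda>i. i = n) is) + (if i = n then 1 else 0)" by simp
    thus "stat_d (window n (simple_refl n i \<circ> word_prod n is)) \<le> length (filter (\<lambda>i. i = n) (i # is))"
      using window_step(2)[OF IH(1) i] IH(3) by linarith
  qed
qed

text \<open>A strictly decreasing list of \<open>n\<close> positive integers not exceeding
  \<open>n\<close> has to be \<open>n, ..., 1\<close>: \<open>low\<close> bounds the entries from
  the right end, \<open>up\<close> from the left end.\<close>

lemma window_decreasing_imp_id:
  assumes w: "w \<in> signed_perms n" and dec: "\<And>i. 1 \<le> i \<Longrightarrow> i < n \<Longrightarrow> flip n (inv w (int i)) > flip n (inv w (int (Suc i)))"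
    and pos: "n \<ge> 1 \<Longrightarrow> flip n (inv w (int n)) > 0"
  shows "w = id"
proof -
  let ?f = "\<lambda>i. flip n (inv w (int i))"
  note iw = signed_perms_inv[OF w]
  have low: "?f (n - k) \<ge> int (Suc k)" if "k < n" for k
    using that
  proof (induction k)
    case (Suc k)
    have "?f (n - Suc k) > ?f (Suc (n - Suc k))" using Suc.prems by (intro dec) auto
    moreover have "Suc (n - Suc k) = n - k" using Suc.prems by simp
    ultimately show ?case using Suc by simp
  qed (use pos in auto)
  have up: "?f (Suc k) \<le> int (n - k)" if "k < n" for k
    using that
  proof (induction k)
    case 0
    have "\<bar>inv w 1\<bar> \<le> int n" "inv w 1 \<noteq> 0" using signed_perms_range[OF iw, of 1] 0 by auto
    thus ?case by (auto simp: flip_def)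
  next
    case (Suc k)
    have "?f (Suc k) > ?f (Suc (Suc k))" using Suc.prems by (intro dec) auto
    thus ?case using Suc by simp
  qed
  have eq: "inv w (int i) = int i" if i: "1 \<le> i" "i \<le> n" for i
  proof -
    have "?f i \<ge> int n + 1 - int i" using low[of "n - i"] i by simp
    moreover have "?f i \<le> int n + 1 - int i" using up[of "i - 1"] i by (cases i) auto
    ultimately have "?f i = int n + 1 - int i" by linarith
    moreover have "\<bar>inv w (int i)\<bar> \<le> int n" "inv w (int i) \<noteq> 0" using signed_perms_range[OF iw, of "int i"] i by auto
    ultimately show ?thesis using i by (auto simp: flip_def split: if_splits)
  qed
  have "inv w j = j" for j
  proof -
    have odd: "inv w (- j) = - inv w j" for j using iw by (auto simp: signed_perms_def)
    have out: "inv w j = j" if "j \<notin> {- int n..int n}" using iw that by (auto simp: signed_perms_def permutes_def)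
    consider "j \<notin> {- int n..int n}" | "j = 0" | "1 \<le> j" "j \<le> int n" | "1 \<le> - j" "- j \<le> int n" by fastforce
    thus ?thesis
    proof cases
      case 2 thus ?thesis using odd[of 0] by simp
    next
      case 3 thus ?thesis using eq[of "nat j"] by simp
    next
      case 4 thus ?thesis using eq[of "nat (- j)"] odd[of j] by simp
    qed (use out in auto)
  qed
  hence "inv w = id" by auto
  thus ?thesis using signed_perms_bij[OF w] by (metis inv_id inv_inv_eq)
qed

text \<open>If no simple reflection lowers the sum of the statistics, then, the entries being
  distinct and nonzero, the window decreases strictly and ends with a positive letter, which only
  the identity does.\<close>

lemma exists_descent:
  assumes w: "w \<in> signed_perms n" and "w \<noteq> id"
  shows "\<exists>i\<in>{1..n}. stat_s (window n w) + stat_d (window n w) = Suc (stat_s (window n (simple_refl n i \<circ> w)) + stat_d (window n (simple_refl n i \<circ> w)))"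
proof (rule ccontr)
  assume no: "\<not> ?thesis"
  have inj: "flip n (inv w a) \<noteq> flip n (inv w b)" if "a \<noteq> b" "a \<noteq> 0" "b \<noteq> 0" "\<bar>a\<bar> \<le> int n" "\<bar>b\<bar> \<le> int n" for a b
  proof
    assume "flip n (inv w a) = flip n (inv w b)"
    hence "flip n (flip n (inv w a)) = flip n (flip n (inv w b))" by simp
    hence "inv w a = inv w b"
      using signed_perms_range[OF signed_perms_inv[OF w]] that by (simp add: flip_val)
    thus False using that signed_perms_bij[OF signed_perms_inv[OF w]] by (auto simp: bij_def inj_def)
  qed
  have "w = id"
  proof (rule window_decreasing_imp_id[OF w])
    fix i assume i: "1 \<le> i" "i < n"
    obtain xs ys where Ys: "window n w = xs @ flip n (inv w (int i)) # flip n (inv w (int (Suc i))) # ys"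
      "window n (simple_refl n i \<circ> w) = xs @ flip n (inv w (int (Suc i))) # flip n (inv w (int i)) # ys"
      using window_split[OF i, of w] w by metis
    have ne: "flip n (inv w (int i)) \<noteq> flip n (inv w (int (Suc i)))" by (rule inj) (use i in auto)
    have "i \<in> {1..n}" using i by auto
    with no have "stat_s (window n w) + stat_d (window n w) \<noteq> Suc (stat_s (window n (simple_refl n i \<circ> w)) + stat_d (window n (simple_refl n i \<circ> w)))" by blast
    thus "flip n (inv w (int i)) > flip n (inv w (int (Suc i)))"
      unfolding Ys using stat_s_swap[of xs "flip n (inv w (int (Suc i)))" "flip n (inv w (int i))" ys] ne
      by (auto simp: stat_d_swap split: if_splits)
  next
    assume n1: "n \<ge> 1"
    obtain xs where Ys: "window n w = xs @ [flip n (inv w (int n))]" "window n (simple_refl n n \<circ> w) = xs @ [- flip n (inv w (int n))]"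
      using window_split_last[OF n1, of w] w by metis
    have "flip n (inv w (int n)) \<noteq> flip n (inv w (- int n))" by (rule inj) (use n1 in auto)
    moreover have "inv w (- int n) = - inv w (int n)" using signed_perms_inv[OF w] by (auto simp: signed_perms_def)
    ultimately have ne: "flip n (inv w (int n)) \<noteq> 0" by (simp add: flip_uminus)
    have "n \<in> {1..n}" using n1 by auto
    with no have "stat_s (window n w) + stat_d (window n w) \<noteq> Suc (stat_s (window n (simple_refl n n \<circ> w)) + stat_d (window n (simple_refl n n \<circ> w)))" by blast
    thus "flip n (inv w (int n)) > 0"
      unfolding Ys using ne by (auto simp: stat_s_negate_last stat_d_def split: if_splits)
  qed
  with assms show False by simp
qed

lemma exists_short_word:
  "w \<in> signed_perms n \<Longrightarrow> \<exists>is. word_for n w is \<and> length is = stat_s (window n w) + stat_d (window n w)"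
proof (induction "stat_s (window n w) + stat_d (window n w)" arbitrary: w rule: less_induct)
  case less
  show ?case
  proof (cases "w = id")
    case True
    thus ?thesis by (intro exI[of _ "[]"]) (simp add: word_for_def word_prod_simps window_id)
  next
    case False
    then obtain i where i: "i \<in> {1..n}" and d: "stat_s (window n w) + stat_d (window n w) = Suc (stat_s (window n (simple_refl n i \<circ> w)) + stat_d (window n (simple_refl n i \<circ> w)))"
      using exists_descent[OF less.prems] by blast
    have "simple_refl n i \<circ> w \<in> signed_perms n"
      by (rule signed_perms_comp[OF simple_refl_signed[OF i] less.prems])
    with less.hyps[of "simple_refl n i \<circ> w"] d obtain js where js: "word_for n (simple_refl n i \<circ> w) js"
      "length js = stat_s (window n (simple_refl n i \<circ> w)) + stat_d (window n (simple_refl n i \<circ> w))" by auto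
    have "simple_refl n i \<circ> (simple_refl n i \<circ> w) = w"
      by (simp add: o_assoc simple_refl_involution[OF i])
    hence "word_for n w (i # js)" using js i by (auto simp: word_for_def word_prod_simps)
    thus ?thesis using js d by (intro exI[of _ "i # js"]) auto
  qed
qed

text \<open>Some word has as length the sum of the two statistics, and every word has at least that
  many letters of each kind. So in any reduced word, in particular the chosen one, both bounds are
  attained.\<close>

lemma ell_eq:
  assumes "w \<in> signed_perms n"
  shows "ell_s n w = stat_s (window n w)" "ell_d n w = stat_d (window n w)"
proof -
  obtain js where js: "word_for n w js" "length js = stat_s (window n w) + stat_d (window n w)"
    using exists_short_word[OF assms] by blast
  have ge: "length is \<ge> stat_s (window n w) + stat_d (window n w) \<and> stat_s (window n w) \<le> length (filter (\<lambda>i. i < n) is) \<and> stat_d (window n w) \<le> length (filter (\<lambda>i. i = n) is)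
     \<and> length is = length (filter (\<lambda>i. i < n) is) + length (filter (\<lambda>i. i = n) is)" if "word_for n w is" for "is"
  proof -
    have s: "set is \<subseteq> {1..n}" and w: "word_prod n is = w" using that by (auto simp: word_for_def)
    have "length is = length (filter (\<lambda>i. i < n) is) + length (filter (\<lambda>i. i = n) is)"
      using s by (induction "is") auto
    thus ?thesis using word_bound[OF s] unfolding w by auto
  qed
  have "reduced_word n w js"
    unfolding reduced_word_def
  proof (intro conjI allI impI js)
    fix ks assume "word_for n w ks"
    from ge[OF this] js(2) show "length js \<le> length ks" by linarith
  qed
  hence red: "reduced_word n w (SOME is. reduced_word n w is)" by (rule someI)
  let ?is = "SOME is. reduced_word n w is"
  have "length ?is \<le> length js" "word_for n w ?is" using red js by (auto simp: reduced_word_def)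
  with ge[of ?is] js show "ell_s n w = stat_s (window n w)" "ell_d n w = stat_d (window n w)"
    unfolding ell_s_def ell_d_def by linarith+
qed

section \<open>Summation over signed permutations through their windows\<close>

definition signed_lists :: "int set \<Rightarrow> int list set" where
  "signed_lists A = {ys. distinct (map abs ys) \<and> abs ` set ys = A}"

lemma window_in_SL: "w \<in> signed_perms n \<Longrightarrow> window n w \<in> signed_lists {1..int n}"
proof -
  assume w: "w \<in> signed_perms n"
  note iw = signed_perms_inv[OF w]
  have r: "inv w (int j) \<noteq> 0" "\<bar>inv w (int j)\<bar> \<le> int n" if "j \<in> {1..n}" for j
    using signed_perms_range[OF iw, of "int j"] that by auto
  have av: "\<bar>flip n (inv w (int j))\<bar> = int n + 1 - \<bar>inv w (int j)\<bar>" if "j \<in> {1..n}" for j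
    using abs_flip r[OF that] by blast
  have odd: "inv w (- j) = - inv w j" for j using iw by (auto simp: signed_perms_def)
  have injw: "inj (inv w)" using signed_perms_bij[OF iw] by (simp add: bij_def)
  have inj: "inj_on (\<lambda>j. \<bar>flip n (inv w (int j))\<bar>) {1..n}"
  proof (rule inj_onI)
    fix j k assume jk: "j \<in> {1..n}" "k \<in> {1..n}" "\<bar>flip n (inv w (int j))\<bar> = \<bar>flip n (inv w (int k))\<bar>"
    hence "inv w (int j) = inv w (int k) \<or> inv w (int j) = inv w (- int k)"
      unfolding odd by (simp add: av) (metis abs_eq_iff)
    thus "j = k" using jk injw by (auto simp: inj_eq)
  qed
  have set_upt: "set [1..<Suc n] = {1..n}" by auto
  have dist: "distinct (map abs (window n w))"
    unfolding window_def map_map distinct_map set_upt o_def using inj by simp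
  have img: "abs ` set (window n w) = (\<lambda>j. \<bar>flip n (inv w (int j))\<bar>) ` {1..n}"
    unfolding window_def set_map set_upt image_image ..
  have "abs ` set (window n w) \<subseteq> {1..int n}"
  proof -
    have "\<bar>flip n (inv w (int j))\<bar> \<in> {1..int n}" if "j \<in> {1..n}" for j
      using av[OF that] r[OF that] by auto
    thus ?thesis unfolding img by auto
  qed
  moreover have "card (abs ` set (window n w)) = card {1..int n}"
    unfolding img card_image[OF inj] by simp
  ultimately have "abs ` set (window n w) = {1..int n}"
    by (intro card_subset_eq) auto
  thus ?thesis using dist by (simp add: signed_lists_def)
qed

lemma window_inj: "inj_on (window n) (signed_perms n)"
proof (rule inj_onI)
  fix w w' assume w: "w \<in> signed_perms n" "w' \<in> signed_perms n" and eq: "window n w = window n w'"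
  note iw = signed_perms_inv[OF w(1)] signed_perms_inv[OF w(2)]
  have e: "inv w (int j) = inv w' (int j)" if j: "1 \<le> j" "j \<le> n" for j
  proof -
    have "flip n (inv w (int j)) = flip n (inv w' (int j))"
      using eq j unfolding window_def by auto
    hence "flip n (flip n (inv w (int j))) = flip n (flip n (inv w' (int j)))" by simp
    thus ?thesis using signed_perms_range[OF iw(1), of "int j"] signed_perms_range[OF iw(2), of "int j"] j by (simp add: flip_val)
  qed
  have "inv w j = inv w' j" for j
  proof -
    have odd: "inv w (- j) = - inv w j" "inv w' (- j) = - inv w' j" for j using iw by (auto simp: signed_perms_def)
    consider "j \<notin> {- int n..int n}" | "j = 0" | "1 \<le> j" "j \<le> int n" | "1 \<le> - j" "- j \<le> int n" by fastforce
    thus ?thesis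
    proof cases
      case 1 thus ?thesis using iw by (auto simp: signed_perms_def permutes_def)
    next
      case 2 thus ?thesis using odd[of 0] by simp
    next
      case 3 thus ?thesis using e[of "nat j"] by simp
    next
      case 4 thus ?thesis using e[of "nat (- j)"] odd[of j] by simp
    qed
  qed
  hence "inv w = inv w'" by auto
  thus "w = w'" using signed_perms_bij w by (metis inv_inv_eq)
qed

lemma window_surj:
  assumes ys: "ys \<in> signed_lists {1..int n}"
  shows "ys \<in> window n ` signed_perms n"
proof -
  have len: "length ys = n"
  proof -
    have "length ys = card (abs ` set ys)" using ys distinct_card[of "map abs ys"] by (simp add: signed_lists_def)
    thus ?thesis using ys by (simp add: signed_lists_def)
  qed
  define F where "F j = ys ! (nat j - 1)" for j :: int
  have Fr: "F j \<noteq> 0" "\<bar>F j\<bar> \<le> int n" if "1 \<le> j" "j \<le> int n" for j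
  proof -
    have "F j \<in> set ys" using that len by (auto simp: F_def)
    hence "\<bar>F j\<bar> \<in> {1..int n}" using ys by (auto simp: signed_lists_def)
    thus "F j \<noteq> 0" "\<bar>F j\<bar> \<le> int n" by auto
  qed
  have Finj: "j = k" if "1 \<le> j" "j \<le> int n" "1 \<le> k" "k \<le> int n" "\<bar>F j\<bar> = \<bar>F k\<bar>" for j k
  proof -
    have "map abs ys ! (nat j - 1) = map abs ys ! (nat k - 1)" using that len by (simp add: F_def)
    moreover have "nat j - 1 < length (map abs ys)" "nat k - 1 < length (map abs ys)" "distinct (map abs ys)"
      using that len ys by (auto simp: signed_lists_def)
    ultimately have "nat j - 1 = nat k - 1"
      using nth_eq_iff_index_eq by blast
    thus ?thesis using that by linarith
  qed
  \<comment> \<open>\<open>v\<close> is meant to be the inverse of the signed permutation sought: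
    \<open>flip\<close> undoes itself on letters of modulus at most \<open>n\<close>, and the values
    at negative arguments are forced by oddness.\<close>
  define v where "v j = (if 1 \<le> j \<and> j \<le> int n then flip n (F j) else if 1 \<le> - j \<and> - j \<le> int n then - flip n (F (- j)) else j)" for j
  have vpos: "v j = (if j \<le> int n then flip n (F j) else j)" if "j > 0" for j
    using that by (simp add: v_def)
  have vneg: "v j = (if - j \<le> int n then - flip n (F (- j)) else j)" if "j < 0" for j
    using that by (simp add: v_def)
  have vodd: "v (- j) = - v j" for j
  proof (cases j "0 :: int" rule: linorder_cases)
    case less
    hence "- j > 0" by simp
    from vpos[OF this] vneg[OF less] show ?thesis by simp
  next
    case greater
    hence "- j < 0" by simp
    from vneg[OF this] vpos[OF greater] show ?thesis by simp
  qed (simp add: v_def)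
  have vr: "\<bar>v j\<bar> = int n + 1 - \<bar>F \<bar>j\<bar>\<bar>" if "1 \<le> \<bar>j\<bar>" "\<bar>j\<bar> \<le> int n" for j
  proof (cases "j > 0")
    case True
    hence j: "1 \<le> j" "j \<le> int n" using that by auto
    have "v j = flip n (F j)" using vpos[OF True] j by simp
    thus ?thesis using abs_flip[OF Fr[OF j]] True by simp
  next
    case False
    hence j: "1 \<le> - j" "- j \<le> int n" using that by auto
    have "v j = - flip n (F (- j))" using vneg[of j] j by simp
    thus ?thesis using abs_flip[OF Fr[OF j]] False by simp
  qed
  have vin: "v j \<in> {- int n..int n}" if "j \<in> {- int n..int n}" for j
  proof (cases "j = 0")
    case False
    hence j: "1 \<le> \<bar>j\<bar>" "\<bar>j\<bar> \<le> int n" using that by auto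
    show ?thesis unfolding atLeastAtMost_iff using vr[OF j] Fr(1)[OF j] by linarith
  qed (simp add: v_def)
  have vnz: "v j \<noteq> 0" if "1 \<le> \<bar>j\<bar>" "\<bar>j\<bar> \<le> int n" for j
    using vr[OF that] Fr[of "\<bar>j\<bar>"] that by auto
  have vinj: "inj_on v {- int n..int n}"
  proof (rule inj_onI)
    fix j k assume jk: "j \<in> {- int n..int n}" "k \<in> {- int n..int n}" "v j = v k"
    show "j = k"
    proof (cases "j = 0 \<or> k = 0")
      case True
      have "v 0 = 0" by (simp add: v_def)
      moreover have "i = 0" if "v i = 0" "i \<in> {- int n..int n}" for i
      proof (rule ccontr)
        assume "i \<noteq> 0"
        hence "1 \<le> \<bar>i\<bar>" "\<bar>i\<bar> \<le> int n" using that by auto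
        thus False using vnz that by blast
      qed
      ultimately show ?thesis using True jk by metis
    next
      case False
      hence a: "1 \<le> \<bar>j\<bar>" "\<bar>j\<bar> \<le> int n" "1 \<le> \<bar>k\<bar>" "\<bar>k\<bar> \<le> int n" using jk by auto
      have "\<bar>F \<bar>j\<bar>\<bar> = \<bar>F \<bar>k\<bar>\<bar>" using vr[OF a(1,2)] vr[OF a(3,4)] jk(3) by simp
      hence "\<bar>j\<bar> = \<bar>k\<bar>" using Finj[of "\<bar>j\<bar>" "\<bar>k\<bar>"] a by simp
      hence "j = k \<or> j = - k" by (auto simp: abs_if split: if_splits)
      moreover have "j \<noteq> - k"
      proof
        assume "j = - k"
        hence "v k = - v k" using jk(3) vodd[of k] by simp
        thus False using vnz[OF a(3,4)] by simp
      qed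
      ultimately show ?thesis by simp
    qed
  qed
  have "v ` {- int n..int n} = {- int n..int n}"
  proof (rule endo_inj_surj[OF _ _ vinj])
    show "v ` {- int n..int n} \<subseteq> {- int n..int n}" using vin by blast
  qed simp
  hence "bij_betw v {- int n..int n} {- int n..int n}" using vinj by (simp add: bij_betw_def)
  hence "v permutes {- int n..int n}"
    by (rule bij_imp_permutes) (auto simp: v_def)
  hence v: "v \<in> signed_perms n" using vodd by (auto simp: signed_perms_def)
  have "inv (inv v) = v" using signed_perms_bij[OF v] by (rule inv_inv_eq)
  hence "window n (inv v) = map (\<lambda>j. flip n (v (int j))) [1..<Suc n]" by (simp add: window_def)
  also have "\<dots> = map (\<lambda>j. ys ! (j - 1)) [1..<Suc n]"
  proof (rule map_cong[OF refl])
    fix j assume "j \<in> set [1..<Suc n]"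
    hence j: "1 \<le> int j" "int j \<le> int n" by auto
    hence "v (int j) = flip n (F (int j))" using vpos[of "int j"] by simp
    thus "flip n (v (int j)) = ys ! (j - 1)" using flip_val[OF Fr(2)[OF j]] by (simp add: F_def)
  qed
  also have "\<dots> = ys"
    by (rule nth_equalityI) (simp_all add: len nth_map_upt del: upt_Suc)
  finally show ?thesis using signed_perms_inv[OF v] by (intro image_eqI[of _ _ "inv v"]) auto
qed

text \<open>The ranks counted from the top are \<open>0, ..., card A - 1\<close>. In the induction a
  new minimum gets the rank \<open>card A\<close> and leaves the other ranks unchanged.\<close>

lemma sum_rank:
  fixes A :: "int set" and f :: "nat \<Rightarrow> 'a :: comm_monoid_add"
  assumes "finite A"
  shows "(\<Sum>b\<in>A. f (card {a \<in> A. a > b})) = (\<Sum>r<card A. f r)"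
  using assms
proof (induction A rule: finite_linorder_min_induct)
  case (insert b A)
  have b: "b \<notin> A" using insert by auto
  have "(\<Sum>c\<in>A. f (card {a \<in> insert b A. a > c})) = (\<Sum>c\<in>A. f (card {a \<in> A. a > c}))"
  proof (rule sum.cong[OF refl])
    fix c assume c: "c \<in> A"
    have "{a \<in> insert b A. a > c} = {a \<in> A. a > c}" using insert.hyps(2) c by force
    thus "f (card {a \<in> insert b A. a > c}) = f (card {a \<in> A. a > c})" by (rule arg_cong)
  qed
  moreover have "{a \<in> insert b A. a > b} = A" using insert by auto
  ultimately have "(\<Sum>c\<in>insert b A. f (card {a \<in> insert b A. a > c})) = f (card A) + (\<Sum>c\<in>A. f (card {a \<in> A. a > c}))"
    by (simp only: sum.insert[OF insert.hyps(1) b])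
  also have "\<dots> = (\<Sum>r<card (insert b A). f r)"
    using insert.hyps(1) b by (simp add: insert.IH add.commute)
  finally show ?case .
qed auto

text \<open>After a head \<open>b\<close> a letter counts once if its modulus exceeds
  \<open>b\<close> and otherwise not at all; after \<open>- b\<close> it counts once if its modulus
  exceeds \<open>b\<close> and otherwise twice.\<close>

lemma head_count:
  fixes b :: int
  assumes "b > 0" "\<forall>y\<in>set ys. \<bar>y\<bar> \<noteq> b"
  shows "length (filter (\<lambda>y. b < y) ys) + length (filter (\<lambda>y. b + y < 0) ys) = length (filter (\<lambda>a. b < a) (map abs ys))"
    and "length (filter (\<lambda>y. - b < y) ys) + length (filter (\<lambda>y. - b + y < 0) ys) = 2 * length ys - length (filter (\<lambda>a. b < a) (map abs ys))"
proof -
  show "length (filter (\<lambda>y. b < y) ys) + length (filter (\<lambda>y. b + y < 0) ys) = length (filter (\<lambda>a. b < a) (map abs ys))"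
    using assms by (induction ys) (auto simp: abs_if split: if_splits)
  have "length (filter (\<lambda>y. - b < y) ys) + length (filter (\<lambda>y. - b + y < 0) ys) + length (filter (\<lambda>a. b < a) (map abs ys)) = 2 * length ys"
    using assms by (induction ys) (auto simp: abs_if split: if_splits)
  thus "length (filter (\<lambda>y. - b < y) ys) + length (filter (\<lambda>y. - b + y < 0) ys) = 2 * length ys - length (filter (\<lambda>a. b < a) (map abs ys))"
    by simp
qed

lemma finite_SL: "finite A \<Longrightarrow> finite (signed_lists A)"
proof (rule finite_subset)
  assume A: "finite A"
  show "signed_lists A \<subseteq> {ys. set ys \<subseteq> A \<union> uminus ` A \<and> length ys \<le> card A}"
  proof
    fix ys assume ys: "ys \<in> signed_lists A"
    have "length ys = card (abs ` set ys)" using ys distinct_card[of "map abs ys"] by (simp add: signed_lists_def)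
    moreover have "y \<in> A \<union> uminus ` A" if "y \<in> set ys" for y
    proof -
      have "\<bar>y\<bar> \<in> A" using that ys by (auto simp: signed_lists_def)
      thus ?thesis by (cases "y \<ge> 0") (auto simp: image_iff intro: bexI[of _ "- y"])
    qed
    ultimately show "ys \<in> {ys. set ys \<subseteq> A \<union> uminus ` A \<and> length ys \<le> card A}" using ys by (auto simp: signed_lists_def)
  qed
  show "finite {ys. set ys \<subseteq> A \<union> uminus ` A \<and> length ys \<le> card A}"
    using A by (intro finite_lists_length_le) auto
qed

text \<open>Removal of the first letter. If \<open>g\<close> of the other \<open>m\<close> moduli
  are larger, the heads \<open>b\<close> and \<open>- b\<close> contribute \<open>t ^ g\<close> and
  \<open>u * t ^ (2 * m - g)\<close>, and \<open>g\<close> takes each value from 0 to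
  \<open>m\<close> once. The alphabet \<open>A\<close> is arbitrary because the removed modulus
  leaves a gap.\<close>

lemma sum_SL:
  fixes t u :: complex
  assumes "finite A" "\<forall>a\<in>A. a > 0"
  shows "(\<Sum>ys\<in>signed_lists A. t ^ stat_s ys * u ^ stat_d ys) = (\<Prod>k<card A. (1 + u * t ^ k) * (\<Sum>r\<le>k. t ^ r))"
  using assms
proof (induction "card A" arbitrary: A)
  case 0
  hence "signed_lists A = {[]}" by (auto simp: signed_lists_def)
  thus ?case using 0 by (simp add: stat_d_def)
next
  case (Suc m)
  let ?T = "\<lambda>ys. t ^ stat_s ys * u ^ stat_d ys"
  have split: "signed_lists A = (\<lambda>(b, e, ys). (if e then b else - b) # ys) ` (SIGMA b:A. UNIV \<times> signed_lists (A - {b}))" (is "_ = ?h ` ?D")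
  proof (intro equalityI subsetI)
    fix zs assume zs: "zs \<in> signed_lists A"
    then obtain z ys where z: "zs = z # ys" using Suc by (cases zs) (auto simp: signed_lists_def)
    have "\<bar>z\<bar> \<in> A" "ys \<in> signed_lists (A - {\<bar>z\<bar>})" using zs by (auto simp: signed_lists_def z) (metis imageI)
    moreover have "zs = ?h (\<bar>z\<bar>, z \<ge> 0, ys)" by (auto simp: z)
    ultimately show "zs \<in> ?h ` ?D" by blast
  next
    fix zs assume "zs \<in> ?h ` ?D"
    then obtain b e ys where b: "b \<in> A" "ys \<in> signed_lists (A - {b})" "zs = (if e then b else - b) # ys" by auto
    have "b > 0" using b Suc.prems by auto
    thus "zs \<in> signed_lists A" using b by (auto simp: signed_lists_def split: if_splits)
  qed
  have inj: "inj_on ?h ?D"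
  proof (rule inj_onI)
    fix p p' assume p: "p \<in> ?D" "p' \<in> ?D" "?h p = ?h p'"
    obtain b e ys where pe: "p = (b, e, ys)" by (cases p) auto
    obtain b' e' ys' where pe': "p' = (b', e', ys')" by (cases p') auto
    have "b > 0" "b' > 0" using p Suc.prems by (auto simp: pe pe')
    thus "p = p'" using p by (auto simp: pe pe' split: if_splits)
  qed
  have cardA: "card (A - {b}) = m" if "b \<in> A" for b using Suc that by simp
  let ?g = "\<lambda>b. card {a \<in> A. a > b}"
  let ?P = "\<Prod>k<m. (1 + u * t ^ k) * (\<Sum>r\<le>k. t ^ r)"
  have sumT: "(\<Sum>e\<in>UNIV. ?T ((if e then b else - b) # ys)) = (t ^ ?g b + u * t ^ (2 * m - ?g b)) * ?T ys"
    if b: "b \<in> A" and ys: "ys \<in> signed_lists (A - {b})" for b ys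
  proof -
    have b0: "b > 0" using b Suc.prems by auto
    have ne: "\<forall>y\<in>set ys. \<bar>y\<bar> \<noteq> b" using ys by (auto simp: signed_lists_def)
    have len: "length ys = m"
      using ys distinct_card[of "map abs ys"] cardA[OF b] by (simp add: signed_lists_def)
    have g: "length (filter (\<lambda>a. b < a) (map abs ys)) = ?g b"
    proof -
      have "length (filter (\<lambda>a. b < a) (map abs ys)) = card (set (filter (\<lambda>a. b < a) (map abs ys)))"
        by (rule distinct_card[symmetric]) (use ys in \<open>simp add: signed_lists_def distinct_filter\<close>)
      also have "set (filter (\<lambda>a. b < a) (map abs ys)) = {a \<in> A. a > b}" using ys by (auto simp: signed_lists_def)
      finally show ?thesis .
    qed
    note h = head_count[OF b0 ne, unfolded g len]
    have 1: "?T (b # ys) = t ^ ?g b * ?T ys"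
      unfolding stat_s.simps h(1) using b0 by (simp add: stat_d_def power_add)
    have 2: "?T (- b # ys) = u * t ^ (2 * m - ?g b) * ?T ys"
      unfolding stat_s.simps h(2) using b0 by (simp add: stat_d_def power_add mult_ac)
    have "(\<Sum>e\<in>UNIV. ?T ((if e then b else - b) # ys)) = ?T (- b # ys) + ?T (b # ys)"
      by (simp add: UNIV_bool add.commute)
    also have "\<dots> = (t ^ ?g b + u * t ^ (2 * m - ?g b)) * ?T ys"
      unfolding 1 2 by (simp add: algebra_simps)
    finally show ?thesis .
  qed
  have "(\<Sum>ys\<in>signed_lists A. ?T ys) = (\<Sum>(b, e, ys)\<in>?D. ?T ((if e then b else - b) # ys))"
    unfolding split sum.reindex[OF inj] by (simp add: o_def case_prod_unfold)
  also have "\<dots> = (\<Sum>b\<in>A. \<Sum>(e, ys)\<in>UNIV \<times> signed_lists (A - {b}). ?T ((if e then b else - b) # ys))"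
    by (rule sum.Sigma[symmetric]) (use Suc finite_SL in auto)
  also have "\<dots> = (\<Sum>b\<in>A. \<Sum>ys\<in>signed_lists (A - {b}). \<Sum>e\<in>UNIV. ?T ((if e then b else - b) # ys))"
    unfolding sum.cartesian_product[symmetric] by (intro sum.cong refl sum.swap)
  also have "\<dots> = (\<Sum>b\<in>A. (t ^ ?g b + u * t ^ (2 * m - ?g b)) * (\<Sum>ys\<in>signed_lists (A - {b}). ?T ys))"
    unfolding sum_distrib_left by (intro sum.cong refl) (use sumT in auto)
  also have "\<dots> = (\<Sum>b\<in>A. (t ^ ?g b + u * t ^ (2 * m - ?g b)) * ?P)"
  proof (rule sum.cong[OF refl])
    fix b assume b: "b \<in> A"
    have "(\<Sum>ys\<in>signed_lists (A - {b}). ?T ys) = (\<Prod>k<card (A - {b}). (1 + u * t ^ k) * (\<Sum>r\<le>k. t ^ r))"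
      by (rule Suc.hyps(1)) (use cardA[OF b] Suc.prems in auto)
    thus "(t ^ ?g b + u * t ^ (2 * m - ?g b)) * (\<Sum>ys\<in>signed_lists (A - {b}). ?T ys) = (t ^ ?g b + u * t ^ (2 * m - ?g b)) * ?P"
      unfolding cardA[OF b] by simp
  qed
  also have "\<dots> = (\<Sum>b\<in>A. t ^ ?g b + u * t ^ (2 * m - ?g b)) * ?P"
    by (simp add: sum_distrib_right)
  also have "(\<Sum>b\<in>A. t ^ ?g b + u * t ^ (2 * m - ?g b)) = (\<Sum>r<card A. t ^ r + u * t ^ (2 * m - r))"
    by (rule sum_rank[OF Suc.prems(1), of "\<lambda>r. t ^ r + u * t ^ (2 * m - r)"])
  also have "\<dots> = (\<Sum>r\<le>m. t ^ r) + u * (\<Sum>r\<le>m. t ^ (2 * m - r))"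
    using Suc.hyps(2) by (simp add: sum.distrib sum_distrib_left lessThan_Suc_atMost flip: Suc.hyps(2))
  \<comment> \<open>Reversing the sum and writing \<open>2 * m - r = m + (m - r)\<close> exhibits
    the same geometric sum as for the positive heads.\<close>
  also have "(\<Sum>r\<le>m. t ^ (2 * m - r)) = (\<Sum>r\<le>m. t ^ m * t ^ r)"
    by (rule sum.reindex_bij_witness[of _ "\<lambda>r. m - r" "\<lambda>r. m - r"]) (auto simp: power_add[symmetric] intro!: arg_cong[of _ _ "power t"])
  also have "(\<Sum>r\<le>m. t ^ r) + u * (\<Sum>r\<le>m. t ^ m * t ^ r) = (1 + u * t ^ m) * (\<Sum>r\<le>m. t ^ r)"
    by (simp add: sum_distrib_left algebra_simps)
  finally show ?case unfolding Suc.hyps(2)[symmetric] by (simp add: mult_ac)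
qed

text \<open>The two-variable Poincare polynomial of type B in factored form.\<close>

theorem W0_product: "W0 n t tn = (\<Prod>k<n. (1 + tn * t ^ k) * (\<Sum>r\<le>k. t ^ r))"
proof -
  have bij: "bij_betw (window n) (signed_perms n) (signed_lists {1..int n})"
    using window_inj window_in_SL window_surj unfolding bij_betw_def by auto
  have "W0 n t tn = (\<Sum>w\<in>signed_perms n. t ^ stat_s (window n w) * tn ^ stat_d (window n w))"
    unfolding W0_def by (rule sum.cong[OF refl]) (simp add: ell_eq)
  also have "\<dots> = (\<Sum>ys\<in>signed_lists {1..int n}. t ^ stat_s ys * tn ^ stat_d ys)"
    by (rule sum.reindex_bij_betw[OF bij])
  also have "\<dots> = (\<Prod>k<n. (1 + tn * t ^ k) * (\<Sum>r\<le>k. t ^ r))"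
    by (subst sum_SL) auto
  finally show ?thesis .
qed

section \<open>The constant term identity\<close>

lemma prod_telescope_quotient:
  fixes f :: "nat \<Rightarrow> complex"
  assumes "\<And>e. e \<le> Suc m \<Longrightarrow> f e \<noteq> 0"
  shows "(\<Prod>e=1..m. f e / f (Suc e)) = f 1 / f (Suc m)"
  using assms by (induction m) auto

lemma index_pairs_Sigma: "index_pairs n = (SIGMA i:{1..n}. {i<..n})"
  by (auto simp: index_pairs_def)

context nome
begin

section \<open>The product side\<close>

lemma pair_qp_scaled: "pair_qp (map ((*) (s ^ m)) [a, b, c, d]) =
   qp (a * b * (s\<^sup>2) ^ m) * qp (a * c * (s\<^sup>2) ^ m) * qp (a * d * (s\<^sup>2) ^ m) * qp (b * c * (s\<^sup>2) ^ m) * qp (b * d * (s\<^sup>2) ^ m) * qp (c * d * (s\<^sup>2) ^ m)"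
proof -
  have e: "s ^ m * u * (s ^ m * v) = u * v * (s\<^sup>2) ^ m" for u v
  proof -
    have "s ^ m * u * (s ^ m * v) = u * v * (s * s) ^ m" unfolding power_mult_distrib by (simp only: mult_ac)
    thus ?thesis by (simp only: power2_eq_square)
  qed
  show ?thesis
    unfolding pair_qp.simps list.map prod_list.Cons prod_list.Nil e by (simp only: mult_1_left mult_1_right mult_ac)
qed

lemma norm_mult_less_one: "norm a < 1 \<Longrightarrow> norm b < 1 \<Longrightarrow> norm (a * b) < (1 :: real)" for a b :: complex
  using mult_strict_mono'[of "norm a" 1 "norm b" 1] by (simp add: norm_mult)

lemma norm_mult_power_less_one: "norm a < 1 \<Longrightarrow> norm t < 1 \<Longrightarrow> norm (a * t ^ k) < (1 :: real)" for a t :: complex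
proof -
  assume "norm a < 1" "norm t < 1"
  moreover have "norm (a * t ^ k) \<le> norm a"
    using \<open>norm t < 1\<close> by (simp add: norm_mult norm_power mult_left_le power_le_one)
  ultimately show ?thesis by linarith
qed

text \<open>One row of the double product, with \<open>m = n - i\<close> and
  \<open>e = j - i\<close>. The denominators are the numerators with the exponent of
  \<open>t\<close> moved by one, so the row telescopes in \<open>e\<close>. The condition on
  \<open>T\<close> keeps the intermediate factors \<open>qp (T * t ^ k)\<close> nonzero; otherwise
  they could not be cancelled.\<close>

lemma N0_s_row:
  assumes t: "norm t < 1" "t \<noteq> 0" and A: "norm (q * T) < 1" and T: "\<And>k. k \<le> 2 * m \<Longrightarrow> T * t ^ k \<noteq> 1"
  shows "(\<Prod>e=1..m. qpochs [t ^ e, t ^ (2 * m - e) * T, q * t ^ e, q * t ^ (2 * m - e) * T] q /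
        qpochs [t * t ^ e, t * t ^ (2 * m - e) * T, q * inverse t * t ^ e, q * inverse t * t ^ (2 * m - e) * T] q)
   = qp t / qp (t ^ Suc m) * (qp (q * t ^ m) / qp q) * (qp (T * t ^ m) / qp (T * t ^ (2 * m))) *
     (if m = 0 then 1 else qp (q * T * t ^ (2 * m - 1)) / qp (q * T * t ^ (m - 1)))"
proof -
  have nzq: "qp (q * t ^ k) \<noteq> 0" for k by (rule qp_nonzero[OF norm_mult_power_less_one[OF q1 t(1)]])
  have nzA: "qp (q * T * t ^ k) \<noteq> 0" for k by (rule qp_nonzero[OF norm_mult_power_less_one[OF A t(1)]])
  have nzt: "qp (t * t ^ k) \<noteq> 0" for k by (rule qp_nonzero[OF norm_mult_power_less_one[OF t(1) t(1)]])
  have nzT: "qp (T * t ^ k) \<noteq> 0" if "k \<le> 2 * m" for k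
    unfolding qp_Suc[of "T * t ^ k"] using T[OF that] nzA[of k] by (simp add: mult_ac)
  \<comment> \<open>Four sequences whose successive quotients make up one factor of the row;
    \<open>F2\<close> and \<open>F3\<close> enter with inverted quotients.\<close>
  define F1 where "F1 e = qp (t ^ e)" for e
  define F2 where "F2 e = qp (q * t ^ (e - 1))" for e
  define F3 where "F3 e = qp (T * t ^ (2 * m + 1 - e))" for e
  define F4 where "F4 e = qp (q * T * t ^ (2 * m - e))" for e
  have step: "qpochs [t ^ e, t ^ (2 * m - e) * T, q * t ^ e, q * t ^ (2 * m - e) * T] q /
        qpochs [t * t ^ e, t * t ^ (2 * m - e) * T, q * inverse t * t ^ e, q * inverse t * t ^ (2 * m - e) * T] q =
        (F1 e / F1 (Suc e)) * inverse (F2 e / F2 (Suc e)) * inverse (F3 e / F3 (Suc e)) * (F4 e / F4 (Suc e))" if e: "e \<in> {1..m}" for e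
  proof -
    have 1: "t * t ^ (2 * m - e) = t ^ (2 * m + 1 - e)" using e by (simp add: Suc_diff_le flip: power_Suc)
    have 2: "q * inverse t * t ^ e = q * t ^ (e - 1)"
      using e t by (cases e) auto
    have 3: "q * inverse t * t ^ (2 * m - e) = q * t ^ (2 * m - Suc e)"
    proof -
      have "2 * m - e = Suc (2 * m - Suc e)" using e by auto
      thus ?thesis using t by simp
    qed
    have 4: "2 * m + 1 - Suc e = 2 * m - e" "Suc e - 1 = e" by auto
    show ?thesis
      unfolding F1_def F2_def F3_def F4_def 1 2 3 4 qpochs_simps
      by (simp add: divide_inverse mult_ac)
  qed
  have "(\<Prod>e=1..m. qpochs [t ^ e, t ^ (2 * m - e) * T, q * t ^ e, q * t ^ (2 * m - e) * T] q /
        qpochs [t * t ^ e, t * t ^ (2 * m - e) * T, q * inverse t * t ^ e, q * inverse t * t ^ (2 * m - e) * T] q)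
    = (\<Prod>e=1..m. (F1 e / F1 (Suc e)) * inverse (F2 e / F2 (Suc e)) * inverse (F3 e / F3 (Suc e)) * (F4 e / F4 (Suc e)))"
    by (rule prod.cong[OF refl step])
  also have "\<dots> = (\<Prod>e=1..m. F1 e / F1 (Suc e)) * inverse (\<Prod>e=1..m. F2 e / F2 (Suc e)) * inverse (\<Prod>e=1..m. F3 e / F3 (Suc e)) * (\<Prod>e=1..m. F4 e / F4 (Suc e))"
    by (simp only: prod.distrib prod_inversef[symmetric] o_def)
  also have "(\<Prod>e=1..m. F1 e / F1 (Suc e)) = qp t / qp (t ^ Suc m)"
  proof -
    have "(\<Prod>e=1..k. F1 e / F1 (Suc e)) = F1 1 / F1 (Suc k)" for k
    proof (induction k)
      case 0
      have "F1 1 \<noteq> 0" using nzt[of 0] by (simp add: F1_def)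
      thus ?case by simp
    next
      case (Suc k)
      have "F1 (Suc k) \<noteq> 0" using nzt[of k] by (simp add: F1_def)
      thus ?case using Suc by simp
    qed
    thus ?thesis by (simp add: F1_def)
  qed
  also have "inverse (\<Prod>e=1..m. F2 e / F2 (Suc e)) = qp (q * t ^ m) / qp q"
    by (subst prod_telescope_quotient) (auto simp: F2_def nzq)
  also have "inverse (\<Prod>e=1..m. F3 e / F3 (Suc e)) = qp (T * t ^ m) / qp (T * t ^ (2 * m))"
  proof -
    have "(\<Prod>e=1..k. F3 e / F3 (Suc e)) = F3 1 / F3 (Suc k)" if "k \<le> m" for k
      using that
    proof (induction k)
      case 0
      have "F3 1 \<noteq> 0" using nzT[of "2 * m"] by (simp add: F3_def)
      thus ?case by simp
    next
      case (Suc k)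
      have "F3 (Suc k) \<noteq> 0" using nzT by (simp add: F3_def)
      thus ?case using Suc by simp
    qed
    from this[of m] show ?thesis by (simp add: F3_def mult_2)
  qed
  also have "(\<Prod>e=1..m. F4 e / F4 (Suc e)) = (if m = 0 then 1 else qp (q * T * t ^ (2 * m - 1)) / qp (q * T * t ^ (m - 1)))"
  proof -
    have e: "2 * m - Suc m = m - 1" by simp
    show ?thesis by (subst prod_telescope_quotient) (use e nzA nzA[of 0] in \<open>auto simp: F4_def\<close>)
  qed
  finally show ?thesis .
qed

text \<open>The factors \<open>qp (q * t ^ m)\<close>, \<open>qp (U * t ^ m)\<close> and
  \<open>qp (U * t ^ (2 * m))\<close>, where \<open>U = t0 * tn\<close>, cancel between
  \<open>N0_gd\<close> and the rows of \<open>N0_s\<close>; the assumption on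
  \<open>t0 * tn * t ^ k\<close> guarantees that those with \<open>U\<close> are nonzero. The
  factors with \<open>A = a * b * c * d\<close> telescope from row to row.\<close>

lemma N0_product:
  assumes n: "n \<ge> 1" and s: "norm s < 1" "s \<noteq> 0" and p: "norm a < 1" "norm b < 1" "norm c < 1" "norm d < 1"
    and T0: "q * (t0 * tn) = a * b * c * d" and T: "\<And>k. k \<le> 2 * n - 2 \<Longrightarrow> t0 * tn * (s\<^sup>2) ^ k \<noteq> 1"
  shows "N0_gd n q (s\<^sup>2) a b c d * N0_s n q (s\<^sup>2) t0 tn =
    inverse (qp q) ^ n * (\<Prod>m<n. qp (s\<^sup>2) * qp ((s\<^sup>2) ^ (n - 1 + m) * prod_list [a, b, c, d]) / (qp ((s\<^sup>2) ^ Suc m) * pair_qp (map ((*) (s ^ m)) [a, b, c, d])))"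
proof -
  define t where "t = s\<^sup>2"
  define U where "U = t0 * tn"
  define A where "A = a * b * c * d"
  have t: "norm t < 1" "t \<noteq> 0" using s by (auto simp: t_def norm_power power_less_one_iff)
  have qU: "q * U = A" using T0 by (simp add: U_def A_def)
  have nA: "norm A < 1" unfolding A_def by (intro norm_mult_less_one p)
  have iqA: "inverse q * a * b * c * d = U" unfolding mult.assoc using T0 by (simp add: U_def field_simps)
  have nzA: "qp (A * t ^ k) \<noteq> 0" for k by (rule qp_nonzero[OF norm_mult_power_less_one[OF nA t(1)]])
  have nzq: "qp (q * t ^ k) \<noteq> 0" for k by (rule qp_nonzero[OF norm_mult_power_less_one[OF q1 t(1)]])
  have TU: "U * t ^ k \<noteq> 1" if "k \<le> 2 * n - 2" for k using T[OF that] by (simp add: U_def t_def)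
  have nzU: "qp (U * t ^ k) \<noteq> 0" if "k \<le> 2 * n - 2" for k
    unfolding qp_Suc[of "U * t ^ k"] using TU[OF that] nzA[of k] by (simp add: qU[symmetric] mult_ac)
  define G where "G m = pair_qp (map ((*) (s ^ m)) [a, b, c, d])" for m
  define Bm where "Bm m = (if m = 0 then 1 else qp (A * t ^ (2 * m - 1)) / qp (A * t ^ (m - 1)))" for m
  have gd: "N0_gd n q t a b c d = (\<Prod>m<n. qp (A * t ^ (2 * m)) * qp (U * t ^ (2 * m)) / (qp (q * t ^ m) * qp (U * t ^ m) * G m))"
  proof -
    have "N0_gd n q t a b c d = (\<Prod>i=1..n. qp (A * t ^ (2 * (n - i))) * qp (U * t ^ (2 * (n - i))) / (qp (q * t ^ (n - i)) * qp (U * t ^ (n - i)) * G (n - i)))"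
      unfolding N0_gd_def iqA G_def pair_qp_scaled t_def[symmetric] A_def[symmetric]
      by (rule prod.cong[OF refl]) (simp add: mult_ac)
    also have "\<dots> = (\<Prod>m<n. qp (A * t ^ (2 * m)) * qp (U * t ^ (2 * m)) / (qp (q * t ^ m) * qp (U * t ^ m) * G m))"
      by (rule prod.reindex_bij_witness[of _ "\<lambda>m. n - m" "\<lambda>i. n - i"]) (use n in auto)
    finally show ?thesis .
  qed
  have st: "N0_s n q t t0 tn = (\<Prod>m<n. qp t / qp (t ^ Suc m) * (qp (q * t ^ m) / qp q) * (qp (U * t ^ m) / qp (U * t ^ (2 * m))) * Bm m)"
  proof -
    let ?R = "\<lambda>m e. qpochs [t ^ e, t ^ (2 * m - e) * U, q * t ^ e, q * t ^ (2 * m - e) * U] q /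
        qpochs [t * t ^ e, t * t ^ (2 * m - e) * U, q * inverse t * t ^ e, q * inverse t * t ^ (2 * m - e) * U] q"
    have "N0_s n q t t0 tn = (\<Prod>(i, j)\<in>(SIGMA i:{1..n}. {i<..n}). ?R (n - i) (j - i))"
      unfolding N0_s_def index_pairs_Sigma
    proof (rule prod.cong[OF refl], clarify)
      fix i j assume ij: "i \<in> {1..n}" "j \<in> {i<..n}"
      hence "2 * n - i - j = 2 * (n - i) - (j - i)" by auto
      thus "qpochs [t ^ (j - i), t ^ (2 * n - i - j) * t0 * tn, q * t ^ (j - i), q * t ^ (2 * n - i - j) * t0 * tn] q /
        qpochs [t * t ^ (j - i), t * t ^ (2 * n - i - j) * t0 * tn, q * inverse t * t ^ (j - i), q * inverse t * t ^ (2 * n - i - j) * t0 * tn] q = ?R (n - i) (j - i)"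
        by (simp add: U_def mult.assoc)
    qed
    also have "\<dots> = (\<Prod>i=1..n. \<Prod>j\<in>{i<..n}. ?R (n - i) (j - i))"
      by (rule prod.Sigma[symmetric]) auto
    also have "\<dots> = (\<Prod>i=1..n. \<Prod>e=1..n - i. ?R (n - i) e)"
    proof (rule prod.cong[OF refl])
      fix i assume "i \<in> {1..n}"
      thus "(\<Prod>j\<in>{i<..n}. ?R (n - i) (j - i)) = (\<Prod>e=1..n - i. ?R (n - i) e)"
        by (intro prod.reindex_bij_witness[of _ "\<lambda>e. i + e" "\<lambda>j. j - i"]) auto
    qed
    also have "\<dots> = (\<Prod>m<n. \<Prod>e=1..m. ?R m e)"
      by (rule prod.reindex_bij_witness[of _ "\<lambda>m. n - m" "\<lambda>i. n - i"]) (use n in auto)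
    also have "\<dots> = (\<Prod>m<n. qp t / qp (t ^ Suc m) * (qp (q * t ^ m) / qp q) * (qp (U * t ^ m) / qp (U * t ^ (2 * m))) * Bm m)"
    proof (rule prod.cong[OF refl])
      fix m assume m: "m \<in> {..<n}"
      show "(\<Prod>e=1..m. ?R m e) = qp t / qp (t ^ Suc m) * (qp (q * t ^ m) / qp q) * (qp (U * t ^ m) / qp (U * t ^ (2 * m))) * Bm m"
        unfolding Bm_def qU[symmetric]
        by (rule N0_s_row[OF t]) (use nA qU TU m in auto)
    qed
    finally show ?thesis .
  qed
  \<comment> \<open>The exponents fill the interval from \<open>k - 1\<close> to
    \<open>2 * k - 2\<close>. Passing to \<open>Suc k\<close> removes \<open>k - 1\<close> and adds
    \<open>2 * k - 1\<close> and \<open>2 * k\<close>, which is the effect of the factor with index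
    \<open>k\<close>.\<close>
  have BmP: "(\<Prod>m<k. qp (A * t ^ (2 * m)) * Bm m) = (\<Prod>m<k. qp (A * t ^ (k - 1 + m)))" for k
  proof (induction k)
    case (Suc k)
    show ?case
    proof (cases k)
      case (Suc k')
      define N where "N e = qp (A * t ^ e)" for e
      have "(\<Prod>m<k. N (k' + m)) * N (k' + k) * N (k' + Suc k) = N k' * (\<Prod>m<Suc k. N (k + m))"
      proof -
        have "(\<Prod>m<Suc (Suc k). N (k' + m)) = (\<Prod>m<k. N (k' + m)) * N (k' + k) * N (k' + Suc k)"
          by (simp only: prod.lessThan_Suc)
        moreover have "(\<Prod>m<Suc (Suc k). N (k' + m)) = N k' * (\<Prod>m<Suc k. N (k + m))"
          unfolding prod.lessThan_Suc_shift[of _ "Suc k"] using Suc by (simp del: prod.lessThan_Suc)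
        ultimately show ?thesis by (simp only:)
      qed
      moreover have "N k' \<noteq> 0" using nzA by (simp add: N_def)
      ultimately have "(\<Prod>m<k. N (k' + m)) * (N (k' + Suc k) * (N (k' + k) / N k')) = (\<Prod>m<Suc k. N (k + m))"
        by (simp add: field_simps del: prod.lessThan_Suc)
      moreover have "k' + Suc k = 2 * k" "k' + k = 2 * k - 1" "k - 1 = k'" "k \<noteq> 0" "Suc k - 1 = k" using Suc by auto
      ultimately show ?thesis
        unfolding prod.lessThan_Suc[of "\<lambda>m. qp (A * t ^ (2 * m)) * Bm m"] Suc.IH
        unfolding Bm_def N_def by (simp only: if_False)
    qed (simp add: Bm_def)
  qed simp
  have "N0_gd n q t a b c d * N0_s n q t t0 tn = (\<Prod>m<n. inverse (qp q) * (qp t / (qp (t ^ Suc m) * G m)) * (qp (A * t ^ (2 * m)) * Bm m))"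
    unfolding gd st prod.distrib[symmetric]
  proof (rule prod.cong[OF refl])
    fix m assume m: "m \<in> {..<n}"
    have nz: "qp (q * t ^ m) \<noteq> 0" "qp (U * t ^ m) \<noteq> 0" "qp (U * t ^ (2 * m)) \<noteq> 0"
      using nzq nzU m by auto
    have alg: "X * Y / (P * Q * g) * (v / w * (P / r) * (Q / Y) * B) = inverse r * (v / (w * g)) * (X * B)"
      if "P \<noteq> 0" "Q \<noteq> 0" "Y \<noteq> 0" for X Y P Q g v w r B :: complex
    proof -
      have "P * (Q * (Y * (inverse P * (inverse Q * inverse Y)))) = 1" using that by (simp add: field_simps)
      thus ?thesis by (simp add: divide_inverse mult_ac)
    qed
    show "qp (A * t ^ (2 * m)) * qp (U * t ^ (2 * m)) / (qp (q * t ^ m) * qp (U * t ^ m) * G m) *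
       (qp t / qp (t ^ Suc m) * (qp (q * t ^ m) / qp q) * (qp (U * t ^ m) / qp (U * t ^ (2 * m))) * Bm m) =
       inverse (qp q) * (qp t / (qp (t ^ Suc m) * G m)) * (qp (A * t ^ (2 * m)) * Bm m)"
      by (rule alg[OF nz])
  qed
  also have "\<dots> = inverse (qp q) ^ n * ((\<Prod>m<n. qp t / (qp (t ^ Suc m) * G m)) * (\<Prod>m<n. qp (A * t ^ (n - 1 + m))))"
  proof -
    have "(\<Prod>m<n. r * F m * H m) = r ^ n * ((\<Prod>m<n. F m) * (\<Prod>m<n. H m))" for r F H
      by (simp add: prod.distrib mult.assoc)
    thus ?thesis unfolding BmP[symmetric] .
  qed
  also have "(\<Prod>m<n. qp t / (qp (t ^ Suc m) * G m)) * (\<Prod>m<n. qp (A * t ^ (n - 1 + m))) =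
      (\<Prod>m<n. qp t * qp (t ^ (n - 1 + m) * prod_list [a, b, c, d]) / (qp (t ^ Suc m) * G m))"
    unfolding prod.distrib[symmetric] by (rule prod.cong[OF refl]) (simp add: A_def mult_ac)
  finally show ?thesis unfolding t_def G_def .
qed

end

theorem mainTheorem14:
  fixes n :: nat
    and sq st st0 su0 stn sun :: complex
    and q t t0 tn a b c d :: complex
  assumes "n \<ge> 1"
    and "q = sq\<^sup>2" and "t = st\<^sup>2" and "t0 = st0\<^sup>2" and "tn = stn\<^sup>2"
    and "su0 \<noteq> 0" and "sun \<noteq> 0"
    and "a = sq * st0 * su0" and "b = - (sq * st0 * inverse su0)"
    and "c = stn * sun" and "d = - (stn * inverse sun)"
    and "0 < norm q" and "norm q < 1"
    and "0 < norm t" and "norm t < 1"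
    and "norm a < 1" and "norm b < 1" and "norm c < 1" and "norm d < 1"
    and "\<And>k. k \<le> 2 * n - 2 \<Longrightarrow> t0 * tn * t ^ k \<noteq> 1"
  shows "1 / W0 n t tn * ct n (\<lambda>x. 1 / Delta_CC_plus n q t a b c d x)
           = 1 / W0 n t tn * pair11_plus n q t a b c d
       \<and> 1 / W0 n t tn * pair11_plus n q t a b c d = angle11_plus n q t a b c d
       \<and> angle11_plus n q t a b c d = N0_gd n q t a b c d * N0_s n q t t0 tn"
proof -
  interpret nome q using assms(12,13) by unfold_locales
  note p = assms(16-19)
  have s: "norm st < 1" "st \<noteq> 0"
    using assms(14,15) unfolding \<open>t = st\<^sup>2\<close> by (auto simp: norm_power power_less_one_iff)
  \<comment> \<open>This turns the factors \<open>1 - c * d * t ^ k\<close> of the symmetrisation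
    into the factors \<open>1 + tn * t ^ k\<close> of \<open>W0\<close>.\<close>
  have cd: "c * d = - tn" using assms by (simp add: power2_eq_square)
  have "a * b = - (q * t0)" using assms by (simp add: power2_eq_square)
  hence abcd: "q * (t0 * tn) = a * b * c * d" using cd by (simp add: mult.assoc)
  have t1: "1 - t ^ Suc k \<noteq> 0" for k
  proof
    assume "1 - t ^ Suc k = 0"
    hence "norm (t ^ Suc k) = 1" by simp
    moreover have "norm (t ^ Suc k) < 1"
      using assms(15) by (simp add: norm_power power_less_one_iff del: power_Suc)
    ultimately show False by simp
  qed
  have geo: "(\<Sum>r\<le>k. t ^ r) = (1 - t ^ Suc k) / (1 - t)" for k
    using one_diff_power_eq[of t "Suc k"] t1[of 0] by (simp add: lessThan_Suc_atMost field_simps)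
  have W: "W0 n t tn = (\<Prod>k<n. (1 + tn * t ^ k) * ((1 - t ^ Suc k) / (1 - t)))"
    unfolding W0_product geo ..
  \<comment> \<open>The norm of \<open>tn\<close> is that of \<open>c * d\<close>, hence less than
    1, so that no factor \<open>1 + tn * t ^ k\<close> vanishes.\<close>
  have W_nz: "W0 n t tn \<noteq> 0"
  proof -
    have "1 + tn * t ^ k \<noteq> 0" for k
    proof
      assume "1 + tn * t ^ k = 0"
      hence "norm (tn * t ^ k) = 1" by (metis add_eq_0_iff norm_minus_cancel norm_one)
      moreover have "norm tn < 1"
        using norm_mult_less_one[OF p(3,4)] unfolding cd by simp
      ultimately show False using norm_mult_power_less_one[of tn t k] assms(15) by simp
    qed
    thus ?thesis unfolding W using t1 t1[of 0] by auto
  qed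
  let ?J = "int_II t [a, b, c, d] {1..n}"
  have nabla: "ct n (\<lambda>x. 1 / Nabla_CC n q t a b c d x) = ?J"
    by (rule ct_Nabla[OF assms(15) p])
  have "ct n (\<lambda>x. 1 / Delta_CC_plus n q t a b c d x) = (\<integral>x. hybrid t a b c d {1..n} {} x \<partial>torus {1..n})"
    by (rule ct_Delta[OF assms(15) p])
  also have "\<dots> = (\<Prod>m\<in>{0<..n}. (1 - t ^ m) * (1 - c * d * t ^ (m - 1)) / ((1 - t) * (2 * of_nat m))) * ?J"
    using hybrid_integral[OF p s, of n n] unfolding \<open>t = st\<^sup>2\<close> by simp
  \<comment> \<open>With \<open>m = Suc k\<close> each factor is one of \<open>W0\<close> divided by
    \<open>2 * m\<close>; these divisors multiply to \<open>2 ^ n * fact n\<close>, the order of the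
    hyperoctahedral group.\<close>
  also have "(\<Prod>m\<in>{0<..n}. (1 - t ^ m) * (1 - c * d * t ^ (m - 1)) / ((1 - t) * (2 * of_nat m))) =
      (\<Prod>k<n. ((1 + tn * t ^ k) * ((1 - t ^ Suc k) / (1 - t))) * (1 / (2 * of_nat (Suc k))))"
  proof -
    have shift: "(\<Prod>m\<in>{0<..n}. f m) = (\<Prod>k<n. f (Suc k))" for f :: "nat \<Rightarrow> complex"
      by (rule prod.reindex_bij_witness[of _ Suc "\<lambda>m. m - 1"]) auto
    have alg: "(1 - x) * (1 - - y * z) / (w * v) = ((1 + y * z) * ((1 - x) / w)) * (1 / v)" for x y z w v :: complex
      by (simp add: divide_inverse mult_ac)
    show ?thesis unfolding shift cd diff_Suc_1 alg ..
  qed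
  also have "\<dots> = W0 n t tn * (\<Prod>k<n. 1 / (2 * of_nat (Suc k)))"
    unfolding W by (simp only: prod.distrib)
  also have "(\<Prod>k<n. 1 / (2 * of_nat (Suc k))) = 1 / (2 ^ n * fact n :: complex)"
    by (induction n) (simp_all add: mult_ac)
  finally have delta: "ct n (\<lambda>x. 1 / Delta_CC_plus n q t a b c d x) = W0 n t tn * (1 / (2 ^ n * fact n) * ?J)"
    by (simp only: mult.assoc)
  have J: "?J = fact n * (2 / qp q) ^ n * (\<Prod>m<n. qp t * qp (t ^ (n - 1 + m) * prod_list [a, b, c, d]) / (qp (t ^ Suc m) * pair_qp (map ((*) (st ^ m)) [a, b, c, d])))"
    unfolding \<open>t = st\<^sup>2\<close> by (rule type_II_integral) (use s p in auto)
  have N: "N0_gd n q t a b c d * N0_s n q t t0 tn =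
    inverse (qp q) ^ n * (\<Prod>m<n. qp t * qp (t ^ (n - 1 + m) * prod_list [a, b, c, d]) / (qp (t ^ Suc m) * pair_qp (map ((*) (st ^ m)) [a, b, c, d])))"
    unfolding \<open>t = st\<^sup>2\<close> by (rule N0_product[OF assms(1) s p abcd]) (use assms(20) \<open>t = st\<^sup>2\<close> in auto)
  have "1 / (2 ^ n * fact n) * ?J = N0_gd n q t a b c d * N0_s n q t t0 tn"
  proof -
    have "1 / (2 ^ n * F) * (F * (2 / r) ^ n * P) = inverse r ^ n * P" if "F \<noteq> 0" for F r P :: complex
      using that by (cases "r = 0") (simp_all add: field_simps power_divide power_0_left)
    thus ?thesis unfolding J N by (simp only: fact_nonzero not_False_eq_True)
  qed
  thus ?thesis
    unfolding pair11_plus_def angle11_plus_def nabla delta using W_nz by simp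
qed

end
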